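(* Let $N$ be a compact Riemannian manifold and let $\phi : S^2 \to N$ be a harmonic map from the $2$-sphere. Then any Jacobi field $v$ along $\phi$ is conformal, i.e. for every local complex coordinate $z$ on $S^2$, $\left\langle \frac{\nabla v}{\partial z}, \frac{\partial^{c}\phi}{\partial z}\right\rangle^{\mathbf C} = 0$; equivalently, any smooth variation $\{\phi_t\}$ of $\phi$ tangent to a Jacobi field is conformal to first order.
   Context: All manifolds and maps are smooth ($C^\infty$); manifolds are compact without boundary. $S^2$ carries its standard Riemann surface structure (and any Riemannian metric compatible with it; harmonicity and the Jacobi condition below do not depend on this choice). A vector field along $\phi:M\to N$ is a smooth section of $\phi^{-1}TN$. $\nabla$ denotes the connections induced by the Levi-Civita connections. The tension field is $\tau(\phi)=\mathrm{Trace}\,\nabla d\phi$, and $\phi$ is harmonic if $\tau(\phi)=0$. For $\phi$ harmonic, the Jacobi operator is $J_\phi(v)=\Delta v-\mathrm{Trace}\,R^N(d\phi,v)d\phi$, where $\Delta=-\mathrm{Trace}\,\nabla^2$ on $\phi^{-1}TN$ and the curvature sign convention is $R(X,Y)=-[\nabla_X,\nabla_Y]+\nabla_{[X,Y]}$. A Jacobi field along $\phi$ is a vector field $v$ along $\phi$ with $J_\phi(v)=0$. A smooth variation $\{\phi_t\}$ of $\phi$ is a smooth map $M\times I\to N$, $(x,t)\mapsto\phi_t(x)$, with $I\ni 0$ an open interval and $\phi_0=\phi$; it is tangent to $v$ if $v=\frac{\partial\phi_t}{\partial t}\big|_{t=0}$. Let $\langle\ ,\ \rangle^{\mathbf C}$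 be the complex-bilinear extension of the metric of $N$ to $T^{c}N=TN\otimes_{\mathbb R}\mathbb C$, let $d^{c}\phi:T^{c}M\to T^{c}N$ be the complex-linear extension of $d\phi$, and for a local complex coordinate $z$ on a Riemann surface $M$ put $\frac{\partial^{c}\phi}{\partial z}=d^{c}\phi(\frac{\partial}{\partial z})$; extend $\nabla$ complex-linearly and put $\frac{\nabla}{\partial z}=\nabla_{\partial/\partial z}$. Set $\eta^{\mathbf R}(\phi)=\left\langle\frac{\partial^{c}\phi}{\partial z},\frac{\partial^{c}\phi}{\partial z}\right\rangle^{\mathbf C}$. The variation $\{\phi_t\}$ is conformal to first order if, for every local complex coordinate, $\eta^{\mathbf R}(\phi)=0$ and $\frac{\partial}{\partial t}\big|_{t=0}\eta^{\mathbf R}(\phi_t)=0$. *)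

theory Defs
  imports "HOL-Analysis.Analysis"
begin

section \<open>Smooth maps between Euclidean spaces\<close>

abbreviation dir_deriv :: "('a::real_normed_vector \<Rightarrow> 'b::real_normed_vector) \<Rightarrow> 'a \<Rightarrow> 'a \<Rightarrow> 'b"
  where "dir_deriv f x v \<equiv> frechet_derivative f (at x) v"

text \<open>On an open set of a Euclidean space: all directional derivatives up to order \<open>k\<close> exist
  (with total differentiability at each stage) and are continuous.\<close>

primrec Ck_on :: "nat \<Rightarrow> 'a set \<Rightarrow> ('a::real_normed_vector \<Rightarrow> 'b::real_normed_vector) \<Rightarrow> bool" where
  "Ck_on 0 S f \<longleftrightarrow> continuous_on S f"
| "Ck_on (Suc k) S f \<longleftrightarrow>
     (\<forall>x\<in>S. f differentiable (at x)) \<and> (\<forall>v. Ck_on k S (\<lambda>x. dir_deriv f x v))"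

definition smooth_on :: "'a set \<Rightarrow> ('a::real_normed_vector \<Rightarrow> 'b::real_normed_vector) \<Rightarrow> bool"
  where "smooth_on S f \<longleftrightarrow> (\<forall>k. Ck_on k S f)"


section \<open>Manifolds and smooth maps\<close>

text \<open>A chart is a pair of its domain and its coordinate map; the values of the coordinate map
  off the domain are irrelevant.\<close>

type_synonym ('p, 'e) chart = "'p set \<times> ('p \<Rightarrow> 'e)"

record ('p, 'e) manifold =
  mtop :: "'p topology"
  atlas :: "('p, 'e) chart set"

abbreviation points :: "('p, 'e) manifold \<Rightarrow> 'p set"
  where "points M \<equiv> topspace (mtop M)"

definition chart_range :: "('p, 'e) chart \<Rightarrow> 'e set"
  where "chart_range c = snd c ` fst c"

definition chart_inv :: "('p, 'e) chart \<Rightarrow> 'e \<Rightarrow> 'p"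
  where "chart_inv c = inv_into (fst c) (snd c)"

definition is_chart :: "'p topology \<Rightarrow> ('p, 'e::topological_space) chart \<Rightarrow> bool"
  where "is_chart X c \<longleftrightarrow> openin X (fst c) \<and> open (chart_range c) \<and>
    homeomorphic_map (subtopology X (fst c)) (top_of_set (chart_range c)) (snd c)"

definition transition :: "('p, 'e) chart \<Rightarrow> ('p, 'e) chart \<Rightarrow> 'e \<Rightarrow> 'e"
  where "transition c c' = snd c' \<circ> chart_inv c"

definition smooth_manifold :: "('p, 'e::euclidean_space) manifold \<Rightarrow> bool"
  where "smooth_manifold M \<longleftrightarrow>
    Hausdorff_space (mtop M) \<and> second_countable (mtop M) \<and>
    (\<forall>c\<in>atlas M. is_chart (mtop M) c) \<and>
    (\<Union>c\<in>atlas M. fst c) = points M \<and>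
    (\<forall>c\<in>atlas M. \<forall>c'\<in>atlas M. smooth_on (snd c ` (fst c \<inter> fst c')) (transition c c'))"

definition local_rep :: "('p, 'e) chart \<Rightarrow> ('q, 'f) chart \<Rightarrow> ('p \<Rightarrow> 'q) \<Rightarrow> 'e \<Rightarrow> 'f"
  where "local_rep c d f = snd d \<circ> f \<circ> chart_inv c"

definition rep_domain :: "('p, 'e) chart \<Rightarrow> ('q, 'f) chart \<Rightarrow> ('p \<Rightarrow> 'q) \<Rightarrow> 'e set"
  where "rep_domain c d f = snd c ` {p \<in> fst c. f p \<in> fst d}"

definition smooth_map ::
    "('p, 'e::euclidean_space) manifold \<Rightarrow> ('q, 'f::euclidean_space) manifold \<Rightarrow> ('p \<Rightarrow> 'q) \<Rightarrow> bool"
  where "smooth_map M N f \<longleftrightarrow> continuous_map (mtop M) (mtop N) f \<and>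
    (\<forall>c\<in>atlas M. \<forall>d\<in>atlas N. smooth_on (rep_domain c d f) (local_rep c d f))"

definition times_interval ::
    "('p, 'e::euclidean_space) manifold \<Rightarrow> real set \<Rightarrow> ('p \<times> real, 'e \<times> real) manifold"
  where "times_interval M I =
    \<lparr> mtop = prod_topology (mtop M) (top_of_set I),
      atlas = (\<lambda>c. (fst c \<times> I, \<lambda>(p, t). (snd c p, t))) ` atlas M \<rparr>"


section \<open>Tangent vectors and Riemannian metrics\<close>

text \<open>A tangent vector at \<open>p\<close> is the family of its components in the charts around \<open>p\<close>, subject to
  the usual transformation law.  The entries at other indices carry no meaning.\<close>

definition tangent_vector ::
    "('p, 'e::euclidean_space) manifold \<Rightarrow> 'p \<Rightarrow> (('p, 'e) chart \<Rightarrow> 'e) \<Rightarrow> bool"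
  where "tangent_vector M p w \<longleftrightarrow>
    (\<forall>c\<in>atlas M. \<forall>c'\<in>atlas M. p \<in> fst c \<inter> fst c' \<longrightarrow>
       w c' = dir_deriv (transition c c') (snd c p) (w c))"

text \<open>A Riemannian metric is given by its coefficients: \<open>g c x a b\<close> is the inner product at the
  point with coordinate \<open>x\<close> in the chart \<open>c\<close> of the vectors with components \<open>a\<close> and \<open>b\<close>.\<close>

type_synonym 'e local_metric = "'e \<Rightarrow> 'e \<Rightarrow> 'e \<Rightarrow> real"
type_synonym ('p, 'e) metric_tensor = "('p, 'e) chart \<Rightarrow> 'e local_metric"

definition riemannian_metric ::
    "('p, 'e::euclidean_space) manifold \<Rightarrow> ('p, 'e) metric_tensor \<Rightarrow> bool"
  where "riemannian_metric M g \<longleftrightarrow>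
    (\<forall>c\<in>atlas M.
       (\<forall>a b. smooth_on (chart_range c) (\<lambda>x. g c x a b)) \<and>
       (\<forall>x\<in>chart_range c. bilinear (g c x) \<and> (\<forall>a b. g c x a b = g c x b a) \<and>
          (\<forall>a. a \<noteq> 0 \<longrightarrow> g c x a a > 0))) \<and>
    (\<forall>c\<in>atlas M. \<forall>c'\<in>atlas M. \<forall>p\<in>fst c \<inter> fst c'. \<forall>a b.
       g c (snd c p) a b =
       g c' (snd c' p) (dir_deriv (transition c c') (snd c p) a)
                       (dir_deriv (transition c c') (snd c p) b))"


section \<open>Levi-Civita connection, curvature and traces in coordinates\<close>

text \<open>\<open>christoffel g x a b\<close> is \<open>\<nabla>\<^sub>a b\<close> for constant coordinate vector fields, by the Koszul formula.\<close>

definition christoffel :: "'e::euclidean_space local_metric \<Rightarrow> 'e \<Rightarrow> 'e \<Rightarrow> 'e \<Rightarrow> 'e"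
  where "christoffel g x a b = (THE z. \<forall>w. 2 * g x z w =
      dir_deriv (\<lambda>y. g y b w) x a + dir_deriv (\<lambda>y. g y a w) x b - dir_deriv (\<lambda>y. g y a b) x w)"

definition nabla :: "'e::euclidean_space local_metric \<Rightarrow> ('e \<Rightarrow> 'e) \<Rightarrow> ('e \<Rightarrow> 'e) \<Rightarrow> 'e \<Rightarrow> 'e"
  where "nabla g X Y x = dir_deriv Y x (X x) + christoffel g x (X x) (Y x)"

definition lie_bracket :: "('e::euclidean_space \<Rightarrow> 'e) \<Rightarrow> ('e \<Rightarrow> 'e) \<Rightarrow> 'e \<Rightarrow> 'e"
  where "lie_bracket X Y x = dir_deriv Y x (X x) - dir_deriv X x (Y x)"

text \<open>Sign convention: \<open>R(X,Y) = -[\<nabla>\<^sub>X,\<nabla>\<^sub>Y] + \<nabla>\<^bsub>[X,Y]\<^esub>\<close>.\<close>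

definition curvature_op ::
    "'e::euclidean_space local_metric \<Rightarrow> ('e \<Rightarrow> 'e) \<Rightarrow> ('e \<Rightarrow> 'e) \<Rightarrow> ('e \<Rightarrow> 'e) \<Rightarrow> 'e \<Rightarrow> 'e"
  where "curvature_op g X Y Z x =
    - (nabla g X (nabla g Y Z) x - nabla g Y (nabla g X Z) x) + nabla g (lie_bracket X Y) Z x"

text \<open>The curvature tensor evaluates the tensorial expression above on constant extensions.\<close>

definition curvature :: "'e::euclidean_space local_metric \<Rightarrow> 'e \<Rightarrow> 'e \<Rightarrow> 'e \<Rightarrow> 'e \<Rightarrow> 'e"
  where "curvature g x a b z = curvature_op g (\<lambda>_. a) (\<lambda>_. b) (\<lambda>_. z) x"

text \<open>The connection induced on \<open>\<phi>\<^sup>-\<^sup>1TN\<close>; \<open>F\<close> and \<open>V\<close> represent the map and the section.\<close>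

definition pullback_nabla ::
    "'f::euclidean_space local_metric \<Rightarrow> ('e::euclidean_space \<Rightarrow> 'f) \<Rightarrow>
     ('e \<Rightarrow> 'e) \<Rightarrow> ('e \<Rightarrow> 'f) \<Rightarrow> 'e \<Rightarrow> 'f"
  where "pullback_nabla g F X V x =
    dir_deriv V x (X x) + christoffel g (F x) (dir_deriv F x (X x)) (V x)"

text \<open>\<open>h\<^sup>i\<^sup>j B\<^sub>i\<^sub>j\<close>: the vector \<open>z\<close> attached to the \<open>i\<close>-th basis vector \<open>b\<close> has components \<open>h\<^sup>i\<^sup>j\<close>.\<close>

definition metric_trace ::
    "('e::euclidean_space \<Rightarrow> 'e \<Rightarrow> real) \<Rightarrow> ('e \<Rightarrow> 'e \<Rightarrow> 'f::euclidean_space) \<Rightarrow> 'f"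
  where "metric_trace h B = (\<Sum>b\<in>Basis. B b (THE z. \<forall>w. h z w = b \<bullet> w))"

text \<open>\<open>\<nabla>d\<phi>\<close> on \<open>T\<^sup>*M \<otimes> \<phi>\<^sup>-\<^sup>1TN\<close> and \<open>\<nabla>\<^sup>2v\<close>, both evaluated on constant extensions of \<open>a\<close> and \<open>b\<close>.\<close>

definition nabla_d ::
    "'e::euclidean_space local_metric \<Rightarrow> 'f::euclidean_space local_metric \<Rightarrow>
     ('e \<Rightarrow> 'f) \<Rightarrow> 'e \<Rightarrow> 'e \<Rightarrow> 'e \<Rightarrow> 'f"
  where "nabla_d h g F x a b =
    pullback_nabla g F (\<lambda>_. a) (\<lambda>y. dir_deriv F y b) x
    - dir_deriv F x (nabla h (\<lambda>_. a) (\<lambda>_. b) x)"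

definition nabla_sq ::
    "'e::euclidean_space local_metric \<Rightarrow> 'f::euclidean_space local_metric \<Rightarrow>
     ('e \<Rightarrow> 'f) \<Rightarrow> ('e \<Rightarrow> 'f) \<Rightarrow> 'e \<Rightarrow> 'e \<Rightarrow> 'e \<Rightarrow> 'f"
  where "nabla_sq h g F V x a b =
    pullback_nabla g F (\<lambda>_. a) (pullback_nabla g F (\<lambda>_. b) V) x
    - pullback_nabla g F (nabla h (\<lambda>_. a) (\<lambda>_. b)) V x"

definition tension_field ::
    "'e::euclidean_space local_metric \<Rightarrow> 'f::euclidean_space local_metric \<Rightarrow> ('e \<Rightarrow> 'f) \<Rightarrow> 'e \<Rightarrow> 'f"
  where "tension_field h g F x = metric_trace (h x) (nabla_d h g F x)"

definition rough_laplacian ::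
    "'e::euclidean_space local_metric \<Rightarrow> 'f::euclidean_space local_metric \<Rightarrow>
     ('e \<Rightarrow> 'f) \<Rightarrow> ('e \<Rightarrow> 'f) \<Rightarrow> 'e \<Rightarrow> 'f"
  where "rough_laplacian h g F V x = - metric_trace (h x) (nabla_sq h g F V x)"

definition jacobi_operator ::
    "'e::euclidean_space local_metric \<Rightarrow> 'f::euclidean_space local_metric \<Rightarrow>
     ('e \<Rightarrow> 'f) \<Rightarrow> ('e \<Rightarrow> 'f) \<Rightarrow> 'e \<Rightarrow> 'f"
  where "jacobi_operator h g F V x = rough_laplacian h g F V x
    - metric_trace (h x)
        (\<lambda>a b. curvature g (F x) (dir_deriv F x a) (V x) (dir_deriv F x b))"


section \<open>Harmonic maps, Jacobi fields and variations\<close>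

definition harmonic_map ::
    "('m, 'e::euclidean_space) manifold \<Rightarrow> ('m, 'e) metric_tensor \<Rightarrow>
     ('n, 'f::euclidean_space) manifold \<Rightarrow> ('n, 'f) metric_tensor \<Rightarrow> ('m \<Rightarrow> 'n) \<Rightarrow> bool"
  where "harmonic_map M h N g \<phi> \<longleftrightarrow> smooth_map M N \<phi> \<and>
    (\<forall>c\<in>atlas M. \<forall>d\<in>atlas N. \<forall>x\<in>rep_domain c d \<phi>.
       tension_field (h c) (g d) (local_rep c d \<phi>) x = 0)"

definition section_rep ::
    "('m, 'e) chart \<Rightarrow> ('n, 'f) chart \<Rightarrow> ('m \<Rightarrow> ('n, 'f) chart \<Rightarrow> 'f) \<Rightarrow> 'e \<Rightarrow> 'f"
  where "section_rep c d v x = v (chart_inv c x) d"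

definition vector_field_along ::
    "('m, 'e::euclidean_space) manifold \<Rightarrow> ('n, 'f::euclidean_space) manifold \<Rightarrow>
     ('m \<Rightarrow> 'n) \<Rightarrow> ('m \<Rightarrow> ('n, 'f) chart \<Rightarrow> 'f) \<Rightarrow> bool"
  where "vector_field_along M N \<phi> v \<longleftrightarrow>
    (\<forall>p\<in>points M. tangent_vector N (\<phi> p) (v p)) \<and>
    (\<forall>c\<in>atlas M. \<forall>d\<in>atlas N. smooth_on (rep_domain c d \<phi>) (section_rep c d v))"

definition jacobi_field ::
    "('m, 'e::euclidean_space) manifold \<Rightarrow> ('m, 'e) metric_tensor \<Rightarrow>
     ('n, 'f::euclidean_space) manifold \<Rightarrow> ('n, 'f) metric_tensor \<Rightarrow>
     ('m \<Rightarrow> 'n) \<Rightarrow> ('m \<Rightarrow> ('n, 'f) chart \<Rightarrow> 'f) \<Rightarrow> bool"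
  where "jacobi_field M h N g \<phi> v \<longleftrightarrow> vector_field_along M N \<phi> v \<and>
    (\<forall>c\<in>atlas M. \<forall>d\<in>atlas N. \<forall>x\<in>rep_domain c d \<phi>.
       jacobi_operator (h c) (g d) (local_rep c d \<phi>) (section_rep c d v) x = 0)"

definition smooth_variation ::
    "('m, 'e::euclidean_space) manifold \<Rightarrow> ('n, 'f::euclidean_space) manifold \<Rightarrow>
     ('m \<Rightarrow> 'n) \<Rightarrow> real set \<Rightarrow> (real \<Rightarrow> 'm \<Rightarrow> 'n) \<Rightarrow> bool"
  where "smooth_variation M N \<phi> I \<Phi> \<longleftrightarrow>
    open I \<and> is_interval I \<and> 0 \<in> I \<and>
    smooth_map (times_interval M I) N (\<lambda>(p, t). \<Phi> t p) \<and>
    (\<forall>p\<in>points M. \<Phi> 0 p = \<phi> p)"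

definition variation_tangent_to ::
    "('m, 'e::euclidean_space) manifold \<Rightarrow> ('n, 'f::euclidean_space) manifold \<Rightarrow>
     (real \<Rightarrow> 'm \<Rightarrow> 'n) \<Rightarrow> ('m \<Rightarrow> ('n, 'f) chart \<Rightarrow> 'f) \<Rightarrow> bool"
  where "variation_tangent_to M N \<Phi> v \<longleftrightarrow>
    (\<forall>p\<in>points M. \<forall>d\<in>atlas N. \<Phi> 0 p \<in> fst d \<longrightarrow>
       ((\<lambda>t. snd d (\<Phi> t p)) has_vector_derivative v p d) (at 0))"


section \<open>Complexification and conformality\<close>

text \<open>The complexification of a real vector space \<open>'f\<close> is \<open>'f \<times> 'f\<close>, with \<open>(a, b)\<close> standing for
  \<open>a + \<i> b\<close>.\<close>

definition complex_linear_ext :: "('e \<Rightarrow> 'f) \<Rightarrow> 'e \<times> 'e \<Rightarrow> 'f \<times> 'f"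
  where "complex_linear_ext L w = (L (fst w), L (snd w))"

definition complex_bilinear_ext :: "('f \<Rightarrow> 'f \<Rightarrow> real) \<Rightarrow> 'f \<times> 'f \<Rightarrow> 'f \<times> 'f \<Rightarrow> complex"
  where "complex_bilinear_ext g w w' =
    Complex (g (fst w) (fst w') - g (snd w) (snd w')) (g (fst w) (snd w') + g (snd w) (fst w'))"

text \<open>\<open>\<partial>/\<partial>z = (\<partial>/\<partial>x - \<i> \<partial>/\<partial>y) / 2\<close>, where \<open>1\<close> and \<open>\<i>\<close> are the components of \<open>\<partial>/\<partial>x\<close> and \<open>\<partial>/\<partial>y\<close>
  in a complex coordinate \<open>z = x + \<i> y\<close>.\<close>

definition d_dz :: "complex \<times> complex"
  where "d_dz = (1 / 2, - \<i> / 2)"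

definition map_dz :: "(complex \<Rightarrow> 'f::euclidean_space) \<Rightarrow> complex \<Rightarrow> 'f \<times> 'f"
  where "map_dz F x = complex_linear_ext (dir_deriv F x) d_dz"

definition nabla_dz ::
    "'f::euclidean_space local_metric \<Rightarrow> (complex \<Rightarrow> 'f) \<Rightarrow> (complex \<Rightarrow> 'f) \<Rightarrow> complex \<Rightarrow> 'f \<times> 'f"
  where "nabla_dz g F V x = complex_linear_ext (\<lambda>a. pullback_nabla g F (\<lambda>_. a) V x) d_dz"

definition eta_R :: "'f::euclidean_space local_metric \<Rightarrow> (complex \<Rightarrow> 'f) \<Rightarrow> complex \<Rightarrow> complex"
  where "eta_R g F x = complex_bilinear_ext (g (F x)) (map_dz F x) (map_dz F x)"

text \<open>In the two definitions below \<open>M\<close> is a Riemann surface, its atlas consisting of all its local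
  complex coordinates.\<close>

definition conformal_field ::
    "('m, complex) manifold \<Rightarrow> ('n, 'f::euclidean_space) manifold \<Rightarrow> ('n, 'f) metric_tensor \<Rightarrow>
     ('m \<Rightarrow> 'n) \<Rightarrow> ('m \<Rightarrow> ('n, 'f) chart \<Rightarrow> 'f) \<Rightarrow> bool"
  where "conformal_field M N g \<phi> v \<longleftrightarrow>
    (\<forall>c\<in>atlas M. \<forall>d\<in>atlas N. \<forall>x\<in>rep_domain c d \<phi>.
       complex_bilinear_ext (g d (local_rep c d \<phi> x))
         (nabla_dz (g d) (local_rep c d \<phi>) (section_rep c d v) x)
         (map_dz (local_rep c d \<phi>) x) = 0)"

text \<open>For fixed \<open>x\<close> in the domain below, the chart \<open>d\<close> contains \<open>\<Phi> t (chart_inv c x)\<close> for all \<open>t\<close> near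
  \<open>0\<close>, so \<open>\<eta>\<^sup>R(\<phi>\<^sub>t)\<close> may be differentiated at \<open>t = 0\<close> in this chart.\<close>

definition conformal_to_first_order ::
    "('m, complex) manifold \<Rightarrow> ('n, 'f::euclidean_space) manifold \<Rightarrow> ('n, 'f) metric_tensor \<Rightarrow>
     ('m \<Rightarrow> 'n) \<Rightarrow> (real \<Rightarrow> 'm \<Rightarrow> 'n) \<Rightarrow> bool"
  where "conformal_to_first_order M N g \<phi> \<Phi> \<longleftrightarrow>
    (\<forall>c\<in>atlas M. \<forall>d\<in>atlas N. \<forall>x\<in>rep_domain c d \<phi>.
       eta_R (g d) (local_rep c d \<phi>) x = 0 \<and>
       ((\<lambda>t. eta_R (g d) (local_rep c d (\<Phi> t)) x) has_vector_derivative 0) (at 0))"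


section \<open>The 2-sphere\<close>

text \<open>\<open>S\<^sup>2\<close> is the unit sphere of \<open>\<complex> \<times> \<real>\<close>, i.e. of \<open>\<real>\<^sup>3\<close>.  The two stereographic coordinates (the second
  one conjugated) are related by \<open>z \<mapsto> 1/z\<close> and generate the standard complex structure.\<close>

definition stereo_north :: "(complex \<times> real, complex) chart"
  where "stereo_north = (sphere 0 1 - {(0, 1)}, \<lambda>(w, s). w / of_real (1 - s))"

definition stereo_south :: "(complex \<times> real, complex) chart"
  where "stereo_south = (sphere 0 1 - {(0, -1)}, \<lambda>(w, s). cnj w / of_real (1 + s))"

definition holomorphically_compatible :: "('p, complex) chart \<Rightarrow> ('p, complex) chart \<Rightarrow> bool"
  where "holomorphically_compatible c c' \<longleftrightarrow>
    transition c c' holomorphic_on (snd c ` (fst c \<inter> fst c')) \<and>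
    transition c' c holomorphic_on (snd c' ` (fst c \<inter> fst c'))"

definition sphere2 :: "(complex \<times> real, complex) manifold"
  where "sphere2 =
    \<lparr> mtop = top_of_set (sphere 0 1),
      atlas = {c. is_chart (top_of_set (sphere 0 1)) c \<and>
                  holomorphically_compatible stereo_north c \<and>
                  holomorphically_compatible stereo_south c} \<rparr>"

text \<open>Compatibility of a metric with a Riemann surface structure: it is conformal to \<open>|dz|\<^sup>2\<close> in
  every local complex coordinate.\<close>

definition compatible_metric :: "('m, complex) manifold \<Rightarrow> ('m, complex) metric_tensor \<Rightarrow> bool"
  where "compatible_metric M h \<longleftrightarrow> riemannian_metric M h \<and>
    (\<forall>c\<in>atlas M. \<forall>x\<in>chart_range c. \<exists>r>0. \<forall>a b. h c x a b = r * (a \<bullet> b))"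

end

theory Submission
  imports Defs "HOL-Complex_Analysis.Complex_Analysis"
begin

text \<open>The form \<open>\<eta> = \<langle>\<phi>\<^sub>z, \<phi>\<^sub>z\<rangle> dz\<^sup>2\<close> of a harmonic map is a holomorphic quadratic differential, and on the sphere
  every such differential vanishes: in the stereographic coordinates, related by \<open>z \<mapsto> 1/z\<close>, its
  coefficient is entire and tends to \<open>0\<close> at infinity.  A Jacobi field \<open>v\<close> along \<open>\<phi>\<close> is treated by the same
  argument: the pair \<open>(\<phi>, v)\<close> satisfies the harmonic map equation in \<open>TN\<close> with the complete lift of \<open>g\<close>, an
  indefinite metric, and the corresponding quadratic differential is \<open>2 \<langle>\<nabla>v/\<partial>z, \<phi>\<^sub>z\<rangle> dz\<^sup>2\<close>, the
  derivative of \<open>\<eta>\<close> along any variation tangent to \<open>v\<close>.\<close>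

section \<open>Calculus\<close>

text \<open>A Jacobi field need not be tangent to a variation through harmonic maps, so \<eta> = 0
  cannot simply be differentiated along such a variation. The pair (\<phi>, v) replaces it: it keeps
  exactly the first-order information, and the complete lift is what differentiating
  \<open>g\<close> to first order produces. The price is indefiniteness. \<open>christoffel\<close>
  is a definite description whose unique value is obtained here from positivity, so for the lift the
  harmonic map equation is only stated tested against vectors (\<open>lowered_tension\<close>). This
  suffices for holomorphy: the two Cauchy-Riemann equations are the tests against the two coordinate
  derivatives of the map. No manifold structure on TN is built. A map into a bundle is a family
  \<open>u p d\<close> of coordinate values indexed by the charts \<open>d\<close> of N, with one
  symmetric form \<open>G d\<close> per chart and invariance under change of \<open>d\<close>;
  \<open>hopf_lift_eq_0\<close> then serves both \<phi> and (\<phi>, v). The source metric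
  disappears early, since on surfaces a conformal metric merely rescales both operators, the second
  one along a harmonic map.\<close>

lemma dir_deriv_eqI: "(f has_derivative f') (at x) \<Longrightarrow> dir_deriv f x v = f' v"
  by (metis frechet_derivative_at)

lemma has_derivative_dir_deriv:
  "f differentiable (at x) \<Longrightarrow> (f has_derivative dir_deriv f x) (at x)"
  by (simp add: frechet_derivative_works)

section \<open>Symmetry of second derivatives\<close>

lemma has_real_derivative_along_line:
  fixes f :: "'a::real_normed_vector \<Rightarrow> real"
  assumes "f differentiable (at (p + s *\<^sub>R a))"
  shows "((\<lambda>s. f (p + s *\<^sub>R a)) has_real_derivative dir_deriv f (p + s *\<^sub>R a) a) (at s)"
proof -
  let ?D = "dir_deriv f (p + s *\<^sub>R a)"
  have "((\<lambda>s. f (p + s *\<^sub>R a)) has_derivative (\<lambda>h. ?D (h *\<^sub>R a))) (at s)"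
    by (rule has_derivative_compose[where f = "\<lambda>s. p + s *\<^sub>R a" and g = f])
      (auto intro!: derivative_eq_intros has_derivative_dir_deriv assms)
  moreover have "(\<lambda>h. ?D (h *\<^sub>R a)) = (*) (?D a)"
    using linear_frechet_derivative[OF assms] by (auto simp: linear_cmul)
  ultimately show ?thesis
    by (simp add: has_field_derivative_def)
qed

text \<open>The mean value theorem is used twice: along \<open>a\<close> for the difference of two
  translates of \<open>f\<close>, then along \<open>b\<close> for the derivative in direction
  \<open>a\<close>. The second difference itself is symmetric in \<open>a\<close> and
  \<open>b\<close>, which is the source of the symmetry of the second derivative.\<close>

lemma second_difference:
  fixes f :: "'a::real_normed_vector \<Rightarrow> real"
  assumes "h > 0"
    and S: "\<And>s t. 0 \<le> s \<Longrightarrow> s \<le> h \<Longrightarrow> 0 \<le> t \<Longrightarrow> t \<le> h \<Longrightarrow> x + s *\<^sub>R a + t *\<^sub>R b \<in> S"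
    and f: "\<And>y. y \<in> S \<Longrightarrow> f differentiable (at y)"
    and f': "\<And>y. y \<in> S \<Longrightarrow> (\<lambda>y. dir_deriv f y a) differentiable (at y)"
  obtains s t where "0 < s" "s < h" "0 < t" "t < h"
    "f (x + h *\<^sub>R a + h *\<^sub>R b) - f (x + h *\<^sub>R a) - f (x + h *\<^sub>R b) + f x
      = h\<^sup>2 * dir_deriv (\<lambda>y. dir_deriv f y a) (x + s *\<^sub>R a + t *\<^sub>R b) b"
proof -
  define k where "k s = f ((x + h *\<^sub>R b) + s *\<^sub>R a) - f (x + s *\<^sub>R a)" for s
  have "\<exists>s. 0 < s \<and> s < h \<and> k h - k 0 =
      (h - 0) * (dir_deriv f ((x + h *\<^sub>R b) + s *\<^sub>R a) a - dir_deriv f (x + s *\<^sub>R a) a)"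
  proof (rule MVT2)
    fix s assume s: "0 \<le> s" "s \<le> h"
    have "(x + h *\<^sub>R b) + s *\<^sub>R a \<in> S" "x + s *\<^sub>R a \<in> S"
      using S[OF s, of h] S[OF s, of 0] \<open>h > 0\<close> by (simp_all add: algebra_simps)
    then show "(k has_real_derivative
        dir_deriv f ((x + h *\<^sub>R b) + s *\<^sub>R a) a - dir_deriv f (x + s *\<^sub>R a) a) (at s)"
      unfolding k_def by (intro DERIV_diff has_real_derivative_along_line f)
  qed (use \<open>h > 0\<close> in simp)
  then obtain s where s: "0 < s" "s < h" and ks: "k h - k 0 =
      h * (dir_deriv f ((x + h *\<^sub>R b) + s *\<^sub>R a) a - dir_deriv f (x + s *\<^sub>R a) a)"
    by auto
  have "\<exists>t. 0 < t \<and> t < h \<and>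
      dir_deriv f ((x + s *\<^sub>R a) + h *\<^sub>R b) a - dir_deriv f ((x + s *\<^sub>R a) + 0 *\<^sub>R b) a =
      (h - 0) * dir_deriv (\<lambda>y. dir_deriv f y a) (x + s *\<^sub>R a + t *\<^sub>R b) b"
    using \<open>h > 0\<close> s S f' by (intro MVT2 has_real_derivative_along_line) auto
  then obtain t where "0 < t" "t < h" and
    "dir_deriv f ((x + s *\<^sub>R a) + h *\<^sub>R b) a - dir_deriv f (x + s *\<^sub>R a) a =
      h * dir_deriv (\<lambda>y. dir_deriv f y a) (x + s *\<^sub>R a + t *\<^sub>R b) b"
    by auto
  moreover have "f (x + h *\<^sub>R a + h *\<^sub>R b) - f (x + h *\<^sub>R a) - f (x + h *\<^sub>R b) + f x = k h - k 0"
    by (simp add: k_def algebra_simps)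
  ultimately show thesis
    using that[OF s] ks by (simp add: power2_eq_square algebra_simps)
qed

text \<open>The same second difference is \<open>h\<^sup>2\<close> times either mixed derivative,
  each taken at some point of one small parallelogram at \<open>x\<close>. Continuity at
  \<open>x\<close> then brings the two mixed derivatives within any \<open>e\<close> of each
  other.\<close>

lemma second_derivative_symmetric_real:
  fixes f :: "'a::real_normed_vector \<Rightarrow> real"
  assumes "open S" "x \<in> S"
    and f: "\<And>y. y \<in> S \<Longrightarrow> f differentiable (at y)"
    and f': "\<And>y v. y \<in> S \<Longrightarrow> (\<lambda>y. dir_deriv f y v) differentiable (at y)"
    and cont: "\<And>u v. continuous_on S (\<lambda>y. dir_deriv (\<lambda>y. dir_deriv f y u) y v)"
  shows "dir_deriv (\<lambda>y. dir_deriv f y a) x b = dir_deriv (\<lambda>y. dir_deriv f y b) x a"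
proof -
  let ?D = "\<lambda>u v y. dir_deriv (\<lambda>y. dir_deriv f y u) y v"
  have "\<bar>?D a b x - ?D b a x\<bar> \<le> e" if "e > 0" for e
  proof -
    have "eventually (\<lambda>y. y \<in> S \<and> dist (?D a b y) (?D a b x) < e / 2 \<and>
        dist (?D b a y) (?D b a x) < e / 2) (nhds x)"
    proof (intro eventually_conj)
      show "eventually (\<lambda>y. y \<in> S) (nhds x)"
        using \<open>open S\<close> \<open>x \<in> S\<close> by (rule eventually_nhds_in_open)
      have "isCont (?D u v) x" for u v
        using cont \<open>open S\<close> \<open>x \<in> S\<close> by (auto simp: continuous_on_eq_continuous_at)
      then have "eventually (\<lambda>y. dist (?D u v y) (?D u v x) < e / 2) (nhds x)" for u v
        using \<open>e > 0\<close> tendsto_at_iff_tendsto_nhds[of "?D u v" x]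
        by (intro tendstoD) (auto simp: isCont_def)
      then show "eventually (\<lambda>y. dist (?D a b y) (?D a b x) < e / 2) (nhds x)"
        "eventually (\<lambda>y. dist (?D b a y) (?D b a x) < e / 2) (nhds x)" by auto
    qed
    then obtain d where "d > 0" and d: "\<And>y. dist y x < d \<Longrightarrow> y \<in> S \<and>
        dist (?D a b y) (?D a b x) < e / 2 \<and> dist (?D b a y) (?D b a x) < e / 2"
      unfolding eventually_nhds_metric by blast
    \<comment> \<open>This size keeps the parallelogram within \<open>d / 2\<close> of
      \<open>x\<close>; the summand 1 covers \<open>a = b = 0\<close>.\<close>
    define h where "h = d / (2 * (norm a + norm b + 1))"
    have pos: "norm a + norm b + 1 > 0"
      by (simp add: add_nonneg_pos)
    have "h > 0" using \<open>d > 0\<close> pos by (simp add: h_def)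
    have near: "dist (x + s *\<^sub>R u + t *\<^sub>R v) x < d"
      if "0 \<le> s" "s \<le> h" "0 \<le> t" "t \<le> h" "{u, v} = {a, b}" for s t u v
    proof -
      have ab: "norm u + norm v = norm a + norm b"
        using that(5) by (auto simp: doubleton_eq_iff)
      have "dist (x + s *\<^sub>R u + t *\<^sub>R v) x = norm (s *\<^sub>R u + t *\<^sub>R v)"
        by (simp add: dist_norm)
      also have "\<dots> \<le> s * norm u + t * norm v"
        using that by (metis abs_of_nonneg norm_scaleR norm_triangle_ineq)
      also have "\<dots> \<le> h * (norm u + norm v)"
        using that by (simp add: distrib_left mult_right_mono add_mono)
      also have "\<dots> \<le> h * (norm a + norm b + 1)"
        using \<open>h > 0\<close> ab by simp
      also have "\<dots> = d / 2"
        using pos by (simp add: h_def field_simps)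
      finally show ?thesis using \<open>d > 0\<close> by simp
    qed
    obtain s t where 1: "0 < s" "s < h" "0 < t" "t < h"
      "f (x + h *\<^sub>R a + h *\<^sub>R b) - f (x + h *\<^sub>R a) - f (x + h *\<^sub>R b) + f x
        = h\<^sup>2 * ?D a b (x + s *\<^sub>R a + t *\<^sub>R b)"
      by (rule second_difference[OF \<open>h > 0\<close>, of x a b S f]) (auto intro: f f' d[THEN conjunct1] near)
    obtain s' t' where 2: "0 < s'" "s' < h" "0 < t'" "t' < h"
      "f (x + h *\<^sub>R b + h *\<^sub>R a) - f (x + h *\<^sub>R b) - f (x + h *\<^sub>R a) + f x
        = h\<^sup>2 * ?D b a (x + s' *\<^sub>R b + t' *\<^sub>R a)"
      by (rule second_difference[OF \<open>h > 0\<close>, of x b a S f]) (auto intro: f f' d[THEN conjunct1] near)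
    have "x + h *\<^sub>R b + h *\<^sub>R a = x + h *\<^sub>R a + h *\<^sub>R b" by simp
    with 1(5) 2(5)[unfolded this] have "h\<^sup>2 * ?D a b (x + s *\<^sub>R a + t *\<^sub>R b) = h\<^sup>2 * ?D b a (x + s' *\<^sub>R b + t' *\<^sub>R a)"
      by linarith
    then have "?D a b (x + s *\<^sub>R a + t *\<^sub>R b) = ?D b a (x + s' *\<^sub>R b + t' *\<^sub>R a)"
      using \<open>h > 0\<close> by simp
    moreover have "dist (?D a b (x + s *\<^sub>R a + t *\<^sub>R b)) (?D a b x) < e / 2"
      using 1 by (intro d[THEN conjunct2, THEN conjunct1] near) auto
    moreover have "dist (?D b a (x + s' *\<^sub>R b + t' *\<^sub>R a)) (?D b a x) < e / 2"
      using 2 by (intro d[THEN conjunct2, THEN conjunct2] near) auto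
    ultimately show ?thesis
      unfolding dist_real_def by linarith
  qed
  then have "\<bar>?D a b x - ?D b a x\<bar> \<le> 0"
    using field_le_epsilon[of "\<bar>?D a b x - ?D b a x\<bar>" 0] by simp
  then show ?thesis by linarith
qed

lemma smooth_on_imp_differentiable: "smooth_on S f \<Longrightarrow> x \<in> S \<Longrightarrow> f differentiable (at x)"
  unfolding smooth_on_def using Ck_on.simps(2) by blast

lemma smooth_on_dir_deriv: "smooth_on S f \<Longrightarrow> smooth_on S (\<lambda>x. dir_deriv f x v)"
  unfolding smooth_on_def using Ck_on.simps(2) by blast

lemma smooth_on_imp_continuous_on: "smooth_on S f \<Longrightarrow> continuous_on S f"
  unfolding smooth_on_def using Ck_on.simps(1) by blast

text \<open>Reduction to real-valued functions by taking components. The component identities are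
  proved at all points of \<open>S\<close>, because they are themselves differentiated once
  more.\<close>

lemma second_derivative_symmetric:
  fixes f :: "'a::real_normed_vector \<Rightarrow> 'b::euclidean_space"
  assumes S: "open S" "x \<in> S" and f: "smooth_on S f"
  shows "dir_deriv (\<lambda>y. dir_deriv f y a) x b = dir_deriv (\<lambda>y. dir_deriv f y b) x a"
proof (rule euclidean_eqI)
  fix i :: 'b assume "i \<in> Basis"
  let ?f = "\<lambda>y. f y \<bullet> i"
  have inner: "dir_deriv (\<lambda>y. k y \<bullet> i) y v = dir_deriv k y v \<bullet> i"
    "(\<lambda>y. k y \<bullet> i) differentiable (at y)" if "smooth_on S k" "y \<in> S" for k :: "'a \<Rightarrow> 'b" and y v
  proof -
    have "((\<lambda>y. k y \<bullet> i) has_derivative (\<lambda>h. dir_deriv k y h \<bullet> i)) (at y)"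
      using has_derivative_dir_deriv[OF smooth_on_imp_differentiable[OF that]]
      by (rule has_derivative_inner_left)
    then show "dir_deriv (\<lambda>y. k y \<bullet> i) y v = dir_deriv k y v \<bullet> i"
      "(\<lambda>y. k y \<bullet> i) differentiable (at y)"
      by (auto simp: dir_deriv_eqI differentiable_def)
  qed
  have eq1: "dir_deriv ?f y u = dir_deriv f y u \<bullet> i" if "y \<in> S" for y u
    using inner f that by blast
  have deriv2: "((\<lambda>y. dir_deriv ?f y u) has_derivative (\<lambda>v. dir_deriv (\<lambda>y. dir_deriv f y u) y v \<bullet> i)) (at y)"
    if "y \<in> S" for y u
  proof (rule has_derivative_transform_within_open[OF _ S(1) that])
    show "((\<lambda>y. dir_deriv f y u \<bullet> i) has_derivative
        (\<lambda>v. dir_deriv (\<lambda>y. dir_deriv f y u) y v \<bullet> i)) (at y)"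
      by (intro has_derivative_inner_left has_derivative_dir_deriv smooth_on_imp_differentiable[OF _ that]
          smooth_on_dir_deriv f)
  qed (simp add: eq1)
  have eq2: "dir_deriv (\<lambda>y. dir_deriv ?f y u) y v = dir_deriv (\<lambda>y. dir_deriv f y u) y v \<bullet> i"
    if "y \<in> S" for y u v using deriv2[OF that] by (rule dir_deriv_eqI)
  have "dir_deriv (\<lambda>y. dir_deriv ?f y a) x b = dir_deriv (\<lambda>y. dir_deriv ?f y b) x a"
  proof (rule second_derivative_symmetric_real[OF S])
    show "?f differentiable (at y)" if "y \<in> S" for y
      using inner f that by blast
    show "(\<lambda>y. dir_deriv ?f y v) differentiable (at y)" if "y \<in> S" for y v
      using deriv2[OF that] by (auto simp: differentiable_def)
    have "continuous_on S (\<lambda>y. dir_deriv (\<lambda>y. dir_deriv f y u) y v \<bullet> i)" for u v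
      by (intro continuous_intros smooth_on_imp_continuous_on smooth_on_dir_deriv f)
    then show "continuous_on S (\<lambda>y. dir_deriv (\<lambda>y. dir_deriv ?f y u) y v)" for u v
      by (rule continuous_on_eq) (simp add: eq2)
  qed
  then show "dir_deriv (\<lambda>y. dir_deriv f y a) x b \<bullet> i = dir_deriv (\<lambda>y. dir_deriv f y b) x a \<bullet> i"
    by (simp add: eq2 S)
qed

section \<open>Bilinear forms depending on a point\<close>

lemma bilinear_expand:
  fixes B :: "'a::euclidean_space \<Rightarrow> 'b::euclidean_space \<Rightarrow> 'c::real_vector"
  assumes "bilinear B"
  shows "B a b = (\<Sum>i\<in>Basis. \<Sum>j\<in>Basis. ((a \<bullet> i) * (b \<bullet> j)) *\<^sub>R B i j)"
proof -
  have "B a b = B (\<Sum>i\<in>Basis. (a \<bullet> i) *\<^sub>R i) (\<Sum>j\<in>Basis. (b \<bullet> j) *\<^sub>R j)"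
    by (simp add: euclidean_representation)
  also have "\<dots> = (\<Sum>i\<in>Basis. \<Sum>j\<in>Basis. ((a \<bullet> i) * (b \<bullet> j)) *\<^sub>R B i j)"
    by (simp add: bilinear_sum[OF assms] bilinear_lmul[OF assms] bilinear_rmul[OF assms]
        sum.cartesian_product mult.commute)
  finally show ?thesis .
qed

lemma dir_deriv_cong_open:
  assumes "open W" "x \<in> W" "\<And>y. y \<in> W \<Longrightarrow> f y = k y"
  shows "dir_deriv f x v = dir_deriv k x v"
proof -
  have "(f has_derivative D) (at x) \<longleftrightarrow> (k has_derivative D) (at x)" for D
    using assms by (metis has_derivative_transform_within_open)
  then show ?thesis by (simp add: frechet_derivative_def)
qed

text \<open>Each bilinearity identity holds throughout the neighbourhood \<open>W\<close>, so it may
  be differentiated in the base point.\<close>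

lemma dir_deriv_bilinear_family:
  fixes B :: "'y::real_normed_vector \<Rightarrow> 'a::euclidean_space \<Rightarrow> 'b::euclidean_space \<Rightarrow> 'c::real_normed_vector"
  assumes W: "open W" "x \<in> W" and B: "\<And>y. y \<in> W \<Longrightarrow> bilinear (B y)"
    and diff: "\<And>a b. (\<lambda>y. B y a b) differentiable (at x)"
  shows "bilinear (\<lambda>a b. dir_deriv (\<lambda>y. B y a b) x k)"
proof -
  note D = has_derivative_dir_deriv[OF diff]
  have "dir_deriv (\<lambda>y. B y (a + a') b) x k = dir_deriv (\<lambda>y. B y a b) x k + dir_deriv (\<lambda>y. B y a' b) x k" for a a' b
  proof -
    have "dir_deriv (\<lambda>y. B y (a + a') b) x k = dir_deriv (\<lambda>y. B y a b + B y a' b) x k"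
      by (rule dir_deriv_cong_open[OF W]) (simp add: B bilinear_ladd)
    also have "\<dots> = dir_deriv (\<lambda>y. B y a b) x k + dir_deriv (\<lambda>y. B y a' b) x k"
      by (rule dir_deriv_eqI) (intro has_derivative_add D)
    finally show ?thesis .
  qed
  moreover have "dir_deriv (\<lambda>y. B y a (b + b')) x k = dir_deriv (\<lambda>y. B y a b) x k + dir_deriv (\<lambda>y. B y a b') x k" for a b b'
  proof -
    have "dir_deriv (\<lambda>y. B y a (b + b')) x k = dir_deriv (\<lambda>y. B y a b + B y a b') x k"
      by (rule dir_deriv_cong_open[OF W]) (simp add: B bilinear_radd)
    also have "\<dots> = dir_deriv (\<lambda>y. B y a b) x k + dir_deriv (\<lambda>y. B y a b') x k"
      by (rule dir_deriv_eqI) (intro has_derivative_add D)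
    finally show ?thesis .
  qed
  moreover have "dir_deriv (\<lambda>y. B y (r *\<^sub>R a) b) x k = r *\<^sub>R dir_deriv (\<lambda>y. B y a b) x k" for r a b
  proof -
    have "dir_deriv (\<lambda>y. B y (r *\<^sub>R a) b) x k = dir_deriv (\<lambda>y. r *\<^sub>R B y a b) x k"
      by (rule dir_deriv_cong_open[OF W]) (simp add: B bilinear_lmul)
    also have "\<dots> = r *\<^sub>R dir_deriv (\<lambda>y. B y a b) x k"
      by (rule dir_deriv_eqI) (intro has_derivative_scaleR_right D)
    finally show ?thesis .
  qed
  moreover have "dir_deriv (\<lambda>y. B y a (r *\<^sub>R b)) x k = r *\<^sub>R dir_deriv (\<lambda>y. B y a b) x k" for r a b
  proof -
    have "dir_deriv (\<lambda>y. B y a (r *\<^sub>R b)) x k = dir_deriv (\<lambda>y. r *\<^sub>R B y a b) x k"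
      by (rule dir_deriv_cong_open[OF W]) (simp add: B bilinear_rmul)
    also have "\<dots> = r *\<^sub>R dir_deriv (\<lambda>y. B y a b) x k"
      by (rule dir_deriv_eqI) (intro has_derivative_scaleR_right D)
    finally show ?thesis .
  qed
  ultimately show ?thesis
    unfolding bilinear_def by (auto intro!: linearI)
qed

text \<open>Product rule with three dependences: base point, first and second argument. Expansion in
  a basis reduces it to finitely many scalar products, so differentiability of the entries
  \<open>B y a b\<close> for fixed \<open>a\<close> and \<open>b\<close> is enough.\<close>

lemma has_derivative_bilinear_family:
  fixes B :: "'y::real_normed_vector \<Rightarrow> 'a::euclidean_space \<Rightarrow> 'b::euclidean_space \<Rightarrow> 'c::real_normed_vector"
    and F :: "'z::real_normed_vector \<Rightarrow> 'y"
  assumes W: "open W" "F z \<in> W" and B: "\<And>y. y \<in> W \<Longrightarrow> bilinear (B y)"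
    and diff: "\<And>a b. (\<lambda>y. B y a b) differentiable (at (F z))"
    and F: "(F has_derivative F') (at z)"
    and u: "(u has_derivative u') (at z)"
    and w: "(w has_derivative w') (at z)"
  shows "((\<lambda>z. B (F z) (u z) (w z)) has_derivative
    (\<lambda>h. dir_deriv (\<lambda>y. B y (u z) (w z)) (F z) (F' h) + B (F z) (u' h) (w z) + B (F z) (u z) (w' h))) (at z)"
proof -
  let ?D = "\<lambda>a b. dir_deriv (\<lambda>y. B y a b) (F z)"
  have comp: "((\<lambda>z. B (F z) a b) has_derivative (\<lambda>h. ?D a b (F' h))) (at z)" for a b
    by (rule has_derivative_compose[OF F has_derivative_dir_deriv[OF diff]])
  have D: "?D a b k = (\<Sum>i\<in>Basis. \<Sum>j\<in>Basis. ((a \<bullet> i) * (b \<bullet> j)) *\<^sub>R ?D i j k)" for a b k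
    by (rule bilinear_expand[OF dir_deriv_bilinear_family[OF W B diff]])
  have "((\<lambda>z. \<Sum>i\<in>Basis. \<Sum>j\<in>Basis. ((u z \<bullet> i) * (w z \<bullet> j)) *\<^sub>R B (F z) i j) has_derivative
    (\<lambda>h. \<Sum>i\<in>Basis. \<Sum>j\<in>Basis. ((u z \<bullet> i) * (w z \<bullet> j)) *\<^sub>R ?D i j (F' h) +
      ((u z \<bullet> i) * (w' h \<bullet> j) + (u' h \<bullet> i) * (w z \<bullet> j)) *\<^sub>R B (F z) i j)) (at z)"
    by (intro has_derivative_sum has_derivative_scaleR has_derivative_mult has_derivative_inner_left comp u w)
  also have "(\<lambda>h. \<Sum>i\<in>Basis. \<Sum>j\<in>Basis. ((u z \<bullet> i) * (w z \<bullet> j)) *\<^sub>R ?D i j (F' h) +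
      ((u z \<bullet> i) * (w' h \<bullet> j) + (u' h \<bullet> i) * (w z \<bullet> j)) *\<^sub>R B (F z) i j) =
    (\<lambda>h. ?D (u z) (w z) (F' h) + B (F z) (u' h) (w z) + B (F z) (u z) (w' h))"
  proof
    fix h
    show "(\<Sum>i\<in>Basis. \<Sum>j\<in>Basis. ((u z \<bullet> i) * (w z \<bullet> j)) *\<^sub>R ?D i j (F' h) +
        ((u z \<bullet> i) * (w' h \<bullet> j) + (u' h \<bullet> i) * (w z \<bullet> j)) *\<^sub>R B (F z) i j) =
      ?D (u z) (w z) (F' h) + B (F z) (u' h) (w z) + B (F z) (u z) (w' h)"
      unfolding D[of "u z" "w z" "F' h"]
        bilinear_expand[OF B[OF W(2)], of "u' h" "w z"] bilinear_expand[OF B[OF W(2)], of "u z" "w' h"]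
      by (simp add: scaleR_left_distrib sum.distrib)
  qed
  finally have *: "((\<lambda>z. \<Sum>i\<in>Basis. \<Sum>j\<in>Basis. ((u z \<bullet> i) * (w z \<bullet> j)) *\<^sub>R B (F z) i j) has_derivative
    (\<lambda>h. ?D (u z) (w z) (F' h) + B (F z) (u' h) (w z) + B (F z) (u z) (w' h))) (at z)" .
  have "isCont F z" using F has_derivative_continuous by blast
  then have "eventually (\<lambda>z. F z \<in> W) (nhds z)"
    using W by (simp add: isCont_def tendsto_at_iff_tendsto_nhds topological_tendstoD)
  then have "eventually (\<lambda>z. (\<Sum>i\<in>Basis. \<Sum>j\<in>Basis. ((u z \<bullet> i) * (w z \<bullet> j)) *\<^sub>R B (F z) i j) = B (F z) (u z) (w z)) (at z)"
    by (auto simp: eventually_at_filter elim!: eventually_mono intro!: bilinear_expand[symmetric] B)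
  then show ?thesis
    using bilinear_expand[OF B[OF W(2)], of "u z" "w z"]
    by (intro has_derivative_transform_eventually[OF *]) auto
qed

text \<open>A product rule for a factor \<open>s\<close> that is merely continuous: since
  \<open>f x = 0\<close>, the change of \<open>s\<close> contributes only to second order. It
  permits a bootstrap in which \<open>s\<close> is not yet known to be differentiable.\<close>

lemma has_derivative_mult_vanishing:
  fixes f s :: "'a::real_normed_vector \<Rightarrow> real"
  assumes f: "(f has_derivative f') (at x)" and f0: "f x = 0" and s: "isCont s x"
  shows "((\<lambda>y. s y * f y) has_derivative (\<lambda>h. s x * f' h)) (at x)"
  unfolding has_derivative_at_alt
proof (intro conjI allI impI)
  have lin: "bounded_linear f'" using f by (rule has_derivative_bounded_linear)
  then show "bounded_linear (\<lambda>h. s x * f' h)"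
    by (rule bounded_linear_const_mult)
  obtain K where K: "K > 0" "\<And>h. norm (f' h) \<le> norm h * K"
    using lin bounded_linear.pos_bounded by blast
  fix e :: real assume "e > 0"
  \<comment> \<open>\<open>e1\<close> and \<open>e2\<close> each account for half of
    \<open>e\<close>. The bound 1 built into \<open>e2\<close> gives
    \<open>\<bar>s y\<bar> \<le> \<bar>s x\<bar> + 1\<close>, which explains the denominator of
    \<open>e1\<close>.\<close>
  define e1 where "e1 = e / (2 * (\<bar>s x\<bar> + 1))"
  define e2 where "e2 = min 1 (e / (2 * K))"
  have e1: "e1 > 0" and e2: "e2 > 0"
    using \<open>e > 0\<close> K by (simp_all add: e1_def e2_def add_nonneg_pos)
  obtain d1 where d1: "d1 > 0" "\<And>y. norm (y - x) < d1 \<Longrightarrow> norm (f y - f' (y - x)) \<le> e1 * norm (y - x)"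
    using f e1 f0 unfolding has_derivative_at_alt by fastforce
  obtain d2 where d2: "d2 > 0" "\<And>y. norm (y - x) < d2 \<Longrightarrow> \<bar>s y - s x\<bar> < e2"
    using s e2 unfolding continuous_at dist_norm LIM_def
    by (metis isCont_def LIM_eq diff_self norm_zero real_norm_def s)
  show "\<exists>d>0. \<forall>y. norm (y - x) < d \<longrightarrow>
    norm (s y * f y - s x * f x - s x * f' (y - x)) \<le> e * norm (y - x)"
  proof (intro exI[of _ "min d1 d2"] conjI allI impI)
    fix y assume "norm (y - x) < min d1 d2"
    then have 1: "norm (f y - f' (y - x)) \<le> e1 * norm (y - x)" and 2: "\<bar>s y - s x\<bar> < e2"
      using d1 d2 by auto
    have sy: "\<bar>s y\<bar> \<le> \<bar>s x\<bar> + 1" using 2 unfolding e2_def by linarith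
    have "s y * f y - s x * f x - s x * f' (y - x) = s y * (f y - f' (y - x)) + (s y - s x) * f' (y - x)"
      by (simp add: f0 algebra_simps)
    also have "norm \<dots> \<le> \<bar>s y\<bar> * norm (f y - f' (y - x)) + \<bar>s y - s x\<bar> * norm (f' (y - x))"
      by (simp add: order_trans[OF abs_triangle_ineq] abs_mult)
    also have "\<dots> \<le> (\<bar>s x\<bar> + 1) * (e1 * norm (y - x)) + e2 * (norm (y - x) * K)"
      using sy 1 2 K e2 by (intro add_mono mult_mono) auto
    also have "\<dots> \<le> e / 2 * norm (y - x) + e / 2 * norm (y - x)"
    proof (rule add_mono)
      have "\<bar>s x\<bar> + 1 > 0" by (simp add: add_nonneg_pos)
      then show "(\<bar>s x\<bar> + 1) * (e1 * norm (y - x)) \<le> e / 2 * norm (y - x)"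
        by (simp add: e1_def field_simps)
      have "e2 * K \<le> e / (2 * K) * K"
        using K by (intro mult_right_mono) (simp_all add: e2_def)
      also have "\<dots> = e / 2" using K by simp
      finally have "e2 * K \<le> e / 2" .
      then show "e2 * (norm (y - x) * K) \<le> e / 2 * norm (y - x)"
        by (metis mult.commute mult.assoc mult_right_mono norm_ge_zero)
    qed
    finally show "norm (s y * f y - s x * f x - s x * f' (y - x)) \<le> e * norm (y - x)"
      by (simp add: field_simps)
  qed (use d1 d2 in auto)
qed

section \<open>Vectors represented by a positive definite form\<close>

lemma linear_expand:
  fixes f :: "'a::euclidean_space \<Rightarrow> 'b::real_vector"
  assumes "linear f"
  shows "f a = (\<Sum>i\<in>Basis. (a \<bullet> i) *\<^sub>R f i)"
proof -
  have "f a = f (\<Sum>i\<in>Basis. (a \<bullet> i) *\<^sub>R i)"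
    by (simp add: euclidean_representation)
  then show ?thesis
    by (simp only: linear_sum[OF assms] linear_cmul[OF assms])
qed

text \<open>The map lowers the index of a vector. A vector in its kernel is orthogonal to itself,
  hence zero by positivity.\<close>

lemma inj_linear_form_components:
  fixes B :: "'a::euclidean_space \<Rightarrow> 'a \<Rightarrow> real"
  assumes B: "bilinear B" and pos: "\<And>a. a \<noteq> 0 \<Longrightarrow> B a a > 0"
  shows "linear (\<lambda>z. \<Sum>i\<in>Basis. B z i *\<^sub>R i)" "inj (\<lambda>z. \<Sum>i\<in>Basis. B z i *\<^sub>R i)"
proof -
  show lin: "linear (\<lambda>z. \<Sum>i\<in>Basis. B z i *\<^sub>R i)"
    by (rule linearI)
      (simp_all add: bilinear_ladd[OF B] bilinear_lmul[OF B] scaleR_left_distrib sum.distrib scaleR_sum_right)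
  have "z = 0" if "(\<Sum>i\<in>Basis. B z i *\<^sub>R i) = 0" for z
  proof -
    have "B z i = 0" if "i \<in> Basis" for i
      using arg_cong[OF \<open>(\<Sum>i\<in>Basis. B z i *\<^sub>R i) = 0\<close>, of "\<lambda>v. v \<bullet> i"] that by (simp add: inner_sum_left_Basis)
    then have "B z z = 0"
      using linear_expand[of "B z" z] B by (simp add: bilinear_def)
    then show "z = 0" using pos[of z] by force
  qed
  then show "inj (\<lambda>z. \<Sum>i\<in>Basis. B z i *\<^sub>R i)"
    using lin linear_injective_0 by blast
qed

lemma positive_form_cancel:
  fixes B :: "'a::euclidean_space \<Rightarrow> 'a \<Rightarrow> real"
  assumes B: "bilinear B" and pos: "\<And>a. a \<noteq> 0 \<Longrightarrow> B a a > 0" and "\<And>w. B z w = B z' w"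
  shows "z = z'"
proof -
  have "B (z - z') (z - z') = 0"
    using assms(3) by (simp add: bilinear_lsub[OF B])
  then show ?thesis using pos[of "z - z'"] by force
qed

text \<open>Lowering the index is an injective endomorphism of a finite-dimensional space, hence
  surjective; matching values on the basis determines the whole linear form.\<close>

lemma riesz_positive_form:
  fixes B :: "'a::euclidean_space \<Rightarrow> 'a \<Rightarrow> real"
  assumes B: "bilinear B" and pos: "\<And>a. a \<noteq> 0 \<Longrightarrow> B a a > 0" and l: "linear l"
  shows "\<exists>!z. \<forall>w. B z w = l w"
proof -
  have "surj (\<lambda>z. \<Sum>i\<in>Basis. B z i *\<^sub>R i)"
    using inj_linear_form_components[OF B pos] linear_injective_imp_surjective by blast
  then obtain z where z: "(\<Sum>i\<in>Basis. l i *\<^sub>R i) = (\<Sum>i\<in>Basis. B z i *\<^sub>R i)"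
    using surjD[of "\<lambda>z. \<Sum>i\<in>Basis. B z i *\<^sub>R i" "\<Sum>i\<in>Basis. l i *\<^sub>R i"] by blast
  have "B z i = l i" if "i \<in> Basis" for i
    using arg_cong[OF z, of "\<lambda>v. v \<bullet> i"] that by (simp add: inner_sum_left_Basis)
  moreover have "linear (B z)" using B by (simp add: bilinear_def)
  ultimately have "B z = l" using l by (intro linear_eq_stdbasis) auto
  then show ?thesis using positive_form_cancel[OF B pos] by metis
qed

text \<open>An implicitly defined vector is differentiated without differentiating an inverse
  matrix. The form is frozen at \<open>x\<close>, which leaves an error \<open>?m\<close> that is
  linear in \<open>Z\<close> and vanishes at \<open>x\<close>. The argument is a bootstrap:
  \<open>Z\<close> is bounded near \<open>x\<close>, hence continuous there, hence
  differentiable.\<close>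

lemma differentiable_riesz_representative:
  fixes G :: "'y::real_normed_vector \<Rightarrow> 'a::euclidean_space \<Rightarrow> 'a \<Rightarrow> real" and Z :: "'y \<Rightarrow> 'a"
  assumes W: "open W" "x \<in> W" and G: "\<And>y. y \<in> W \<Longrightarrow> bilinear (G y)"
    and pos: "\<And>a. a \<noteq> 0 \<Longrightarrow> G x a a > 0"
    and diff: "\<And>a b. (\<lambda>y. G y a b) differentiable (at x)"
    and k: "\<And>b. (\<lambda>y. k y b) differentiable (at x)"
    and Z: "\<And>y b. y \<in> W \<Longrightarrow> G y (Z y) b = k y b"
  shows "Z differentiable (at x)"
proof -
  let ?T = "\<lambda>z. \<Sum>i\<in>Basis. G x z i *\<^sub>R i"
  let ?m = "\<lambda>i y. \<Sum>j\<in>Basis. (Z y \<bullet> j) * (G y j i - G x j i)"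
  obtain T' where T': "linear T'" "T' \<circ> ?T = id"
    using linear_injective_left_inverse inj_linear_form_components[OF G[OF W(2)] pos] by blast
  \<comment> \<open>Lowering \<open>Z y\<close> with \<open>G x\<close> instead of
    \<open>G y\<close> changes the data \<open>k y\<close> by \<open>?m\<close>; the fixed left
    inverse \<open>T'\<close> then recovers \<open>Z y\<close>.\<close>
  have Zeq: "Z y = T' (\<Sum>i\<in>Basis. (k y i - ?m i y) *\<^sub>R i)" if "y \<in> W" for y
  proof -
    have "G x (Z y) i = k y i - ?m i y" if "i \<in> Basis" for i
    proof -
      have expand: "G y' (Z y) i = (\<Sum>j\<in>Basis. (Z y \<bullet> j) * G y' j i)" if "y' \<in> W" for y'
      proof -
        have "linear (\<lambda>a. G y' a i)" using G[OF that] by (simp add: bilinear_def)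
        from linear_expand[OF this, of "Z y"] show ?thesis by simp
      qed
      show ?thesis
        using Z[OF \<open>y \<in> W\<close>, of i] expand[OF W(2)] expand[OF \<open>y \<in> W\<close>]
        by (simp add: right_diff_distrib sum_subtractf)
    qed
    then have "?T (Z y) = (\<Sum>i\<in>Basis. (k y i - ?m i y) *\<^sub>R i)" by simp
    moreover have "T' (?T (Z y)) = Z y" using fun_cong[OF T'(2), of "Z y"] by simp
    ultimately show ?thesis by simp
  qed
  have evW: "eventually (\<lambda>y. y \<in> W) (at x)"
    using W by (rule eventually_at_in_open')
  have contG: "((\<lambda>y. G y j i - G x j i) \<longlongrightarrow> 0) (at x)" for i j
    using differentiable_imp_continuous_within[OF diff] unfolding continuous_within
    by (simp add: LIM_zero)
  have contk: "((\<lambda>y. k y i) \<longlongrightarrow> k x i) (at x)" for i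
    using differentiable_imp_continuous_within[OF k] unfolding continuous_within .
  obtain C where C: "C > 0" "\<And>v. norm (T' v) \<le> C * norm v"
    using linear_bounded_pos[OF T'(1)] by blast
  define \<delta> where "\<delta> y = (\<Sum>i\<in>Basis. \<Sum>j\<in>Basis. \<bar>G y j i - G x j i\<bar>)" for y
  define K where "K y = (\<Sum>i\<in>Basis. \<bar>k y i\<bar>)" for y
  have "(\<delta> \<longlongrightarrow> (\<Sum>i\<in>(Basis::'a set). \<Sum>j\<in>(Basis::'a set). \<bar>0\<bar>)) (at x)"
    unfolding \<delta>_def by (intro tendsto_sum tendsto_rabs contG)
  then have "(\<delta> \<longlongrightarrow> 0) (at x)" by simp
  \<comment> \<open>With this threshold the error term, which is at most
    \<open>C * norm (Z y) * \<delta> y\<close>, is at most half of \<open>norm (Z y)\<close> and is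
    absorbed on the left. This is where the factor 2 in the bound for \<open>Z\<close> comes
    from.\<close>
  then have ev\<delta>: "eventually (\<lambda>y. \<delta> y < 1 / (2 * C)) (at x)"
    using C by (intro order_tendstoD) auto
  have "(K \<longlongrightarrow> K x) (at x)"
    unfolding K_def by (intro tendsto_sum tendsto_rabs contk)
  then have evK: "eventually (\<lambda>y. K y < K x + 1) (at x)"
    by (intro order_tendstoD) auto
  have "eventually (\<lambda>y. norm (Z y) \<le> 2 * C * (K x + 1)) (at x)"
    using evW ev\<delta> evK
  proof eventually_elim
    fix y assume y: "y \<in> W" "\<delta> y < 1 / (2 * C)" "K y < K x + 1"
    have m: "\<bar>?m i y\<bar> \<le> norm (Z y) * (\<Sum>j\<in>Basis. \<bar>G y j i - G x j i\<bar>)" for i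
      unfolding sum_distrib_left
      by (intro order_trans[OF sum_abs] sum_mono) (simp add: abs_mult mult_right_mono Basis_le_norm)
    have "norm (\<Sum>i\<in>Basis. (k y i - ?m i y) *\<^sub>R i) \<le> (\<Sum>i\<in>Basis. \<bar>k y i - ?m i y\<bar>)"
      by (intro order_trans[OF norm_sum] sum_mono) simp
    also have "\<dots> \<le> (\<Sum>i\<in>Basis. \<bar>k y i\<bar> + norm (Z y) * (\<Sum>j\<in>Basis. \<bar>G y j i - G x j i\<bar>))"
      by (intro sum_mono order_trans[OF abs_triangle_ineq4] add_left_mono m)
    also have "\<dots> = K y + norm (Z y) * \<delta> y"
      by (simp add: K_def \<delta>_def sum.distrib sum_distrib_left)
    finally have s: "norm (\<Sum>i\<in>Basis. (k y i - ?m i y) *\<^sub>R i) \<le> K y + norm (Z y) * \<delta> y" .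
    have "norm (Z y) = norm (T' (\<Sum>i\<in>Basis. (k y i - ?m i y) *\<^sub>R i))"
      by (rule arg_cong[OF Zeq[OF y(1)]])
    also have "\<dots> \<le> C * (K y + norm (Z y) * \<delta> y)"
      using C s by (blast intro: order_trans mult_left_mono less_imp_le)
    also have "\<dots> \<le> C * ((K x + 1) + norm (Z y) * (1 / (2 * C)))"
      using C y by (intro mult_left_mono add_mono) auto
    also have "\<dots> = C * (K x + 1) + norm (Z y) / 2"
      using C by (simp add: field_simps)
    finally show "norm (Z y) \<le> 2 * C * (K x + 1)" by simp
  qed
  then have bdd: "eventually (\<lambda>y. norm (Z y \<bullet> j) \<le> 2 * C * (K x + 1)) (at x)" if "j \<in> Basis" for j
    by (rule eventually_mono) (use that in \<open>auto intro: order_trans[OF Basis_le_norm]\<close>)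
  have m0: "(?m i \<longlongrightarrow> 0) (at x)" for i
    by (intro tendsto_null_sum lim_null_mult_left_bounded[OF bdd contG])
  have "isCont Z x"
  proof -
    have lim: "((\<lambda>y. \<Sum>i\<in>Basis. (k y i - ?m i y) *\<^sub>R i) \<longlongrightarrow> (\<Sum>i\<in>Basis. (k x i - 0) *\<^sub>R i)) (at x)"
      by (intro tendsto_intros contk m0)
    have "((\<lambda>y. T' (\<Sum>i\<in>Basis. (k y i - ?m i y) *\<^sub>R i)) \<longlongrightarrow> T' (\<Sum>i\<in>Basis. (k x i - 0) *\<^sub>R i)) (at x)"
      using linear_continuous_at[OF T'(1)[unfolded linear_conv_bounded_linear]] lim
      by (rule isCont_tendsto_compose)
    moreover have "T' (\<Sum>i\<in>Basis. (k x i - 0) *\<^sub>R i) = Z x"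
      using Zeq[OF W(2)] by simp
    ultimately have "((\<lambda>y. T' (\<Sum>i\<in>Basis. (k y i - ?m i y) *\<^sub>R i)) \<longlongrightarrow> Z x) (at x)" by simp
    then show ?thesis unfolding isCont_def
      by (rule Lim_transform_eventually) (use evW in \<open>auto elim!: eventually_mono simp: Zeq[symmetric]\<close>)
  qed
  then have contZ: "isCont (\<lambda>y. Z y \<bullet> j) x" for j
    by (intro continuous_intros)
  have "((\<lambda>y. G y j i - G x j i) has_derivative dir_deriv (\<lambda>y. G y j i) x) (at x)" for i j
    using has_derivative_diff[OF has_derivative_dir_deriv[OF diff] has_derivative_const] by simp
  \<comment> \<open>Only continuity of \<open>Z\<close> is available here, but the other factor
    vanishes at \<open>x\<close>.\<close>
  then have "((\<lambda>y. (Z y \<bullet> j) * (G y j i - G x j i)) has_derivative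
      (\<lambda>h. (Z x \<bullet> j) * dir_deriv (\<lambda>y. G y j i) x h)) (at x)" for i j
    by (intro has_derivative_mult_vanishing contZ) auto
  then have m: "?m i differentiable (at x)" for i
    by (intro differentiable_sum) (auto simp: differentiable_def)
  have "(\<lambda>y. \<Sum>i\<in>Basis. (k y i - ?m i y) *\<^sub>R i) differentiable (at x)"
    by (intro differentiable_sum ballI differentiable_scaleR differentiable_diff k m differentiable_const finite_Basis)
  then obtain D where "((\<lambda>y. \<Sum>i\<in>Basis. (k y i - ?m i y) *\<^sub>R i) has_derivative D) (at x)"
    by (auto simp: differentiable_def)
  then have "((\<lambda>y. T' (\<Sum>i\<in>Basis. (k y i - ?m i y) *\<^sub>R i)) has_derivative (\<lambda>h. T' (D h))) (at x)"
    by (rule bounded_linear.has_derivative[OF T'(1)[unfolded linear_conv_bounded_linear]])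
  then have "(Z has_derivative (\<lambda>h. T' (D h))) (at x)"
    by (rule has_derivative_transform_within_open[OF _ W]) (simp add: Zeq[symmetric])
  then show ?thesis by (auto simp: differentiable_def)
qed

section \<open>Coordinate metrics and conservation of the stress-energy tensor\<close>

text \<open>The common ground of Riemannian metrics and their complete lifts: the lift is
  indefinite, and all that is established about the regularity of its entries is
  differentiability.\<close>

definition form_field :: "'k::euclidean_space set \<Rightarrow> 'k local_metric \<Rightarrow> bool"
  where "form_field W g \<longleftrightarrow> open W \<and>
    (\<forall>y\<in>W. bilinear (g y) \<and> (\<forall>a b. g y a b = g y b a) \<and> (\<forall>a b. (\<lambda>y. g y a b) differentiable (at y)))"

definition local_riemannian :: "'k::euclidean_space set \<Rightarrow> 'k local_metric \<Rightarrow> bool"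
  where "local_riemannian W g \<longleftrightarrow> open W \<and> (\<forall>a b. smooth_on W (\<lambda>x. g x a b)) \<and>
    (\<forall>x\<in>W. bilinear (g x) \<and> (\<forall>a b. g x a b = g x b a) \<and> (\<forall>a. a \<noteq> 0 \<longrightarrow> g x a a > 0))"

definition pullback_form ::
    "'k::euclidean_space local_metric \<Rightarrow> ('e::euclidean_space \<Rightarrow> 'k) \<Rightarrow> 'e \<Rightarrow> 'e \<Rightarrow> 'e \<Rightarrow> real"
  where "pullback_form g F x a b = g (F x) (dir_deriv F x a) (dir_deriv F x b)"

text \<open>For \<open>S = pullback_form g F x\<close> this is \<open>4 \<langle>F\<^sub>z, F\<^sub>z\<rangle>\<close>.\<close>

definition hopf :: "(complex \<Rightarrow> complex \<Rightarrow> real) \<Rightarrow> complex"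
  where "hopf S = Complex (S 1 1 - S \<i> \<i>) (- 2 * S 1 \<i>)"

text \<open>Twice the inner product of \<open>w\<close> with the tension field for the flat source metric.  The Koszul
  formula avoids \<open>christoffel\<close>, because \<open>g\<close> will also be the indefinite complete lift.\<close>

definition lowered_tension ::
    "'k::euclidean_space local_metric \<Rightarrow> ('e::euclidean_space \<Rightarrow> 'k) \<Rightarrow> 'e \<Rightarrow> 'k \<Rightarrow> real"
  where "lowered_tension g F x w = (\<Sum>e\<in>Basis.
    2 * g (F x) (dir_deriv (\<lambda>y. dir_deriv F y e) x e) w +
    2 * dir_deriv (\<lambda>y. g y (dir_deriv F x e) w) (F x) (dir_deriv F x e) -
    dir_deriv (\<lambda>y. g y (dir_deriv F x e) (dir_deriv F x e)) (F x) w)"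

lemma form_field_imp:
  assumes "form_field W g" "y \<in> W"
  shows "open W" "bilinear (g y)" "g y a b = g y b a" "(\<lambda>y. g y a b) differentiable (at y)"
  using assms by (auto simp: form_field_def)

lemma local_riemannian_imp:
  assumes "local_riemannian W g" "y \<in> W"
  shows "open W" "smooth_on W (\<lambda>x. g x a b)" "bilinear (g y)" "g y a b = g y b a"
    "a \<noteq> 0 \<Longrightarrow> g y a a > 0"
  using assms by (auto simp: local_riemannian_def)

lemma local_riemannian_imp_form_field: "local_riemannian W g \<Longrightarrow> form_field W g"
  unfolding form_field_def local_riemannian_def by (blast intro: smooth_on_imp_differentiable)

lemma form_field_has_derivative:
  assumes g: "form_field W g" and "F x \<in> W"
    and "(F has_derivative F') (at x)" "(u has_derivative u') (at x)" "(v has_derivative v') (at x)"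
  shows "((\<lambda>x. g (F x) (u x) (v x)) has_derivative (\<lambda>h. dir_deriv (\<lambda>y. g y (u x) (v x)) (F x) (F' h) +
    g (F x) (u' h) (v x) + g (F x) (u x) (v' h))) (at x)"
  using assms by (intro has_derivative_bilinear_family[of W]) (auto simp: form_field_def)

lemma form_field_dir_deriv_commute:
  assumes "form_field W g" "y \<in> W"
  shows "dir_deriv (\<lambda>y. g y a b) y k = dir_deriv (\<lambda>y. g y b a) y k"
  using assms by (intro dir_deriv_cong_open[of W]) (auto simp: form_field_def)

lemma form_field_dir_deriv_bilinear:
  assumes "form_field W g" "y \<in> W"
  shows "bilinear (\<lambda>a b. dir_deriv (\<lambda>y. g y a b) y k)"
  using assms by (intro dir_deriv_bilinear_family[of W]) (auto simp: form_field_def)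

section \<open>Holomorphy of the quadratic differential\<close>

lemma field_differentiable_if_Cauchy_Riemann:
  assumes "(f has_derivative D) (at x)" and "D \<i> = \<i> * D 1"
  shows "f field_differentiable (at x)"
proof -
  have lin: "linear D" using assms(1) by (rule has_derivative_linear)
  have "D h = D 1 * h" for h
  proof -
    have "D h = D (Re h *\<^sub>R 1 + Im h *\<^sub>R \<i>)"
      by (rule arg_cong[of _ _ D]) (simp add: complex_eq_iff)
    also have "\<dots> = Re h *\<^sub>R D 1 + Im h *\<^sub>R (\<i> * D 1)"
      by (simp only: linear_add[OF lin] linear_cmul[OF lin] assms(2))
    also have "\<dots> = D 1 * h"
      by (simp add: complex_eq_iff algebra_simps)
    finally show ?thesis .
  qed
  then have "(*) (D 1) = D"
    by (intro ext) (rule sym)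
  with assms(1) have "(f has_derivative (*) (D 1)) (at x)"
    by (simp only:)
  then show ?thesis
    unfolding field_differentiable_def has_field_derivative_def by blast
qed

text \<open>The Cauchy-Riemann equations for \<open>hopf\<close> say that the stress-energy tensor
  is divergence free. They result from pairing the tension with the tangential vectors
  \<open>dir_deriv F x 1\<close> and \<open>dir_deriv F x \<i>\<close>; positivity of
  \<open>g\<close> does not enter, so the lift is covered.\<close>

lemma hopf_pullback_form_field_differentiable:
  fixes F :: "complex \<Rightarrow> 'k::euclidean_space"
  assumes g: "form_field W g" and x: "F x \<in> W"
    and F: "F differentiable (at x)"
    and F': "\<And>a. (\<lambda>y. dir_deriv F y a) differentiable (at x)"
    and mixed: "dir_deriv (\<lambda>y. dir_deriv F y \<i>) x 1 = dir_deriv (\<lambda>y. dir_deriv F y 1) x \<i>"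
    and L: "\<And>w. lowered_tension g F x w = 0"
  shows "(\<lambda>y. hopf (pullback_form g F y)) field_differentiable (at x)"
proof -
  define F1 where "F1 = dir_deriv F x 1"
  define F2 where "F2 = dir_deriv F x \<i>"
  define F2nd where "F2nd a h = dir_deriv (\<lambda>y. dir_deriv F y a) x h" for a h
  define D where "D a b h = dir_deriv (\<lambda>y. g y (dir_deriv F x a) (dir_deriv F x b)) (F x) (dir_deriv F x h) +
    g (F x) (F2nd a h) (dir_deriv F x b) + g (F x) (dir_deriv F x a) (F2nd b h)" for a b h
  have S: "((\<lambda>y. pullback_form g F y a b) has_derivative D a b) (at x)" for a b
    unfolding pullback_form_def D_def F2nd_def
    by (intro form_field_has_derivative[where F = F, OF g x] has_derivative_dir_deriv F F')
  define f' where "f' h = of_real (D 1 1 h - D \<i> \<i> h) + \<i> * of_real (- 2 * D 1 \<i> h)" for h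
  have "((\<lambda>y. hopf (pullback_form g F y)) has_derivative f') (at x)"
    unfolding hopf_def Complex_eq f'_def
    by (intro has_derivative_add has_derivative_of_real has_derivative_mult_right has_derivative_diff S)
  moreover have "f' \<i> = \<i> * f' 1"
  proof -
    note gs = form_field_imp(3)[OF g x] and ds = form_field_dir_deriv_commute[OF g x]
    have sym: "g (F x) F1 (F2nd 1 \<i>) = g (F x) (F2nd 1 \<i>) F1" "g (F x) F1 (F2nd 1 1) = g (F x) (F2nd 1 1) F1"
      "g (F x) F1 (F2nd \<i> \<i>) = g (F x) (F2nd \<i> \<i>) F1" "g (F x) F2 (F2nd 1 \<i>) = g (F x) (F2nd 1 \<i>) F2"
      "g (F x) F2 (F2nd \<i> \<i>) = g (F x) (F2nd \<i> \<i>) F2"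
      "dir_deriv (\<lambda>y. g y F2 F1) (F x) F2 = dir_deriv (\<lambda>y. g y F1 F2) (F x) F2"
      by (rule gs ds)+
    have m: "F2nd \<i> 1 = F2nd 1 \<i>" using mixed by (simp add: F2nd_def)
    \<comment> \<open>The test vector \<open>F2\<close> yields the real part of the equation
      \<open>f' \<i> = \<i> * f' 1\<close>, and \<open>F1\<close> the imaginary part.\<close>
    have L1: "lowered_tension g F x F1 = 0" and L2: "lowered_tension g F x F2 = 0" by (rule L)+
    have "D 1 1 \<i> - D \<i> \<i> \<i> = 2 * D 1 \<i> 1"
      using L2 sym unfolding lowered_tension_def D_def Basis_complex_def
      by (simp add: m flip: F1_def F2_def F2nd_def)
    moreover have "- 2 * D 1 \<i> \<i> = D 1 1 1 - D \<i> \<i> 1"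
      using L1 sym unfolding lowered_tension_def D_def Basis_complex_def
      by (simp add: m flip: F1_def F2_def F2nd_def)
    ultimately show ?thesis
      unfolding f'_def by (simp add: complex_eq_iff)
  qed
  ultimately show ?thesis by (rule field_differentiable_if_Cauchy_Riemann)
qed

section \<open>The Levi-Civita connection in coordinates\<close>

lemma christoffel_koszul:
  assumes g: "local_riemannian W g" and x: "x \<in> W"
  shows "2 * g x (christoffel g x a b) w =
    dir_deriv (\<lambda>y. g y b w) x a + dir_deriv (\<lambda>y. g y a w) x b - dir_deriv (\<lambda>y. g y a b) x w"
proof -
  let ?l = "\<lambda>w. dir_deriv (\<lambda>y. g y b w) x a + dir_deriv (\<lambda>y. g y a w) x b - dir_deriv (\<lambda>y. g y a b) x w"
  note ff = local_riemannian_imp_form_field[OF g]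
  have "linear (\<lambda>w. dir_deriv (\<lambda>y. g y c w) x k)" for c k
    using form_field_dir_deriv_bilinear[OF ff x] by (simp add: bilinear_def)
  moreover have "linear (dir_deriv (\<lambda>y. g y a b) x)"
    by (rule linear_frechet_derivative[OF form_field_imp(4)[OF ff x]])
  ultimately have "linear (\<lambda>w. (1/2) *\<^sub>R ?l w)"
    by (intro linear_compose_scale_right linear_compose_sub linear_compose_add)
  \<comment> \<open>The right-hand side of the Koszul formula is linear in \<open>w\<close>, so
    positivity of \<open>g x\<close> makes the description in \<open>christoffel\<close> well
    defined.\<close>
  then have "\<exists>!z. \<forall>w. g x z w = (1/2) *\<^sub>R ?l w"
    using local_riemannian_imp[OF g x] by (intro riesz_positive_form) auto
  then have "\<exists>!z. \<forall>w. 2 * g x z w = ?l w"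
    by (simp add: field_simps)
  from theI'[OF this] show ?thesis
    unfolding christoffel_def by blast
qed

lemma christoffel_eqI:
  assumes g: "local_riemannian W g" and x: "x \<in> W"
    and "\<And>w. 2 * g x z w =
      dir_deriv (\<lambda>y. g y b w) x a + dir_deriv (\<lambda>y. g y a w) x b - dir_deriv (\<lambda>y. g y a b) x w"
  shows "christoffel g x a b = z"
proof (rule positive_form_cancel[of "g x"])
  show "g x (christoffel g x a b) w = g x z w" for w
    using christoffel_koszul[OF g x, of a b w] assms(3)[of w] by simp
qed (use local_riemannian_imp[OF g x] in auto)

lemma christoffel_commute:
  assumes g: "local_riemannian W g" and x: "x \<in> W"
  shows "christoffel g x a b = christoffel g x b a"
  by (rule christoffel_eqI[OF g x]) (simp add: christoffel_koszul[OF g x]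
      form_field_dir_deriv_commute[OF local_riemannian_imp_form_field[OF g] x, of a b])

text \<open>After lowering the index, linearity in the second slot can be read off the Koszul
  formula; the first slot follows by symmetry.\<close>

lemma bilinear_christoffel:
  assumes g: "local_riemannian W g" and x: "x \<in> W"
  shows "bilinear (christoffel g x)"
proof -
  note ff = local_riemannian_imp_form_field[OF g]
  note B = form_field_dir_deriv_bilinear[OF ff x] and gx = local_riemannian_imp(3)[OF g x]
  have L: "linear (dir_deriv (\<lambda>y. g y a b) x)" for a b
    by (rule linear_frechet_derivative[OF form_field_imp(4)[OF ff x]])
  have right: "linear (christoffel g x a)" for a
  proof (rule linearI)
    fix b b' r
    have "2 * g x (christoffel g x a b + christoffel g x a b') w =
        2 * g x (christoffel g x a b) w + 2 * g x (christoffel g x a b') w"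
      "2 * g x (r *\<^sub>R christoffel g x a b) w = r * (2 * g x (christoffel g x a b) w)" for w
      by (simp_all add: bilinear_ladd[OF gx] bilinear_lmul[OF gx])
    note * = this[unfolded christoffel_koszul[OF g x]]
    show "christoffel g x a (b + b') = christoffel g x a b + christoffel g x a b'"
      by (rule christoffel_eqI[OF g x])
        (simp add: * bilinear_ladd[OF B] bilinear_radd[OF B] linear_add[OF L])
    show "christoffel g x a (r *\<^sub>R b) = r *\<^sub>R christoffel g x a b"
      by (rule christoffel_eqI[OF g x])
        (simp add: * bilinear_lmul[OF B] bilinear_rmul[OF B] linear_cmul[OF L] algebra_simps)
  qed
  moreover have "linear (\<lambda>a. christoffel g x a b)" for b
    using right[of b] by (simp add: christoffel_commute[OF g x, of _ b])
  ultimately show ?thesis by (simp add: bilinear_def)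
qed

text \<open>The Christoffel symbol represents, with respect to \<open>g y\<close>, a linear form
  built from first derivatives of \<open>g\<close>; form and data are both differentiable in
  \<open>y\<close>.\<close>

lemma christoffel_differentiable:
  assumes g: "local_riemannian W g" and x: "x \<in> W"
  shows "(\<lambda>y. christoffel g y a b) differentiable (at x)"
proof (rule differentiable_riesz_representative[of W x g])
  let ?k = "\<lambda>y w. (dir_deriv (\<lambda>y. g y b w) y a + dir_deriv (\<lambda>y. g y a w) y b - dir_deriv (\<lambda>y. g y a b) y w) / 2"
  note sm = smooth_on_imp_differentiable[OF _ x] local_riemannian_imp(2)[OF g x]
  show "(\<lambda>y. g y a b) differentiable (at x)" for a b by (intro sm)
  have d: "(\<lambda>y. dir_deriv (\<lambda>y. g y c w) y k) differentiable (at x)" for c w k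
    by (intro sm smooth_on_dir_deriv)
  show "(\<lambda>y. ?k y w) differentiable (at x)" for w
    by (intro differentiable_divide differentiable_diff differentiable_add d differentiable_const) simp
  show "g y (christoffel g y a b) w = ?k y w" if "y \<in> W" for y w
    using christoffel_koszul[OF g that, of a b w] by simp
qed (use local_riemannian_imp[OF g] x in auto)

text \<open>This is the Koszul formula differentiated along \<open>k\<close>. The last term is the
  derivative of the lowering metric itself, with the Christoffel vector frozen at
  \<open>x\<close>.\<close>

lemma christoffel_dir_deriv:
  assumes g: "local_riemannian W g" and x: "x \<in> W"
  shows "2 * g x (dir_deriv (\<lambda>y. christoffel g y a b) x k) w =
    dir_deriv (\<lambda>y. dir_deriv (\<lambda>y. g y b w) y a) x k +
    dir_deriv (\<lambda>y. dir_deriv (\<lambda>y. g y a w) y b) x k -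
    dir_deriv (\<lambda>y. dir_deriv (\<lambda>y. g y a b) y w) x k -
    2 * dir_deriv (\<lambda>y. g y (christoffel g x a b) w) x k"
proof -
  let ?K = "\<lambda>y. dir_deriv (\<lambda>y. g y b w) y a + dir_deriv (\<lambda>y. g y a w) y b - dir_deriv (\<lambda>y. g y a b) y w"
  note sm = smooth_on_imp_differentiable[OF _ x] smooth_on_dir_deriv local_riemannian_imp(2)[OF g x]
  note gx = local_riemannian_imp(3)[OF g x]
  have "((\<lambda>y. 2 * g y (christoffel g y a b) w) has_derivative
     (\<lambda>k. 2 * (dir_deriv (\<lambda>y. g y (christoffel g x a b) w) x k +
       g x (dir_deriv (\<lambda>y. christoffel g y a b) x k) w + g x (christoffel g x a b) 0))) (at x)"
    by (intro has_derivative_mult_right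
        form_field_has_derivative[where F = "\<lambda>y. y", OF local_riemannian_imp_form_field[OF g] x]
        has_derivative_dir_deriv christoffel_differentiable[OF g x] has_derivative_ident has_derivative_const)
  then have "dir_deriv (\<lambda>y. 2 * g y (christoffel g y a b) w) x k =
     2 * (dir_deriv (\<lambda>y. g y (christoffel g x a b) w) x k + g x (dir_deriv (\<lambda>y. christoffel g y a b) x k) w)"
    by (simp add: dir_deriv_eqI bilinear_rzero[OF gx])
  moreover have "dir_deriv (\<lambda>y. 2 * g y (christoffel g y a b) w) x k = dir_deriv ?K x k"
    by (rule dir_deriv_cong_open[OF local_riemannian_imp(1)[OF g x] x]) (rule christoffel_koszul[OF g])
  moreover have "dir_deriv ?K x k = dir_deriv (\<lambda>y. dir_deriv (\<lambda>y. g y b w) y a) x k +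
    dir_deriv (\<lambda>y. dir_deriv (\<lambda>y. g y a w) y b) x k -
    dir_deriv (\<lambda>y. dir_deriv (\<lambda>y. g y a b) y w) x k"
    by (rule dir_deriv_eqI) (intro has_derivative_diff has_derivative_add has_derivative_dir_deriv sm)
  ultimately show ?thesis by simp
qed

section \<open>The complete lift\<close>

text \<open>A linear family is a bilinear one whose second argument is a scalar, here kept
  constantly equal to 1.\<close>

lemma has_derivative_linear_family:
  fixes L :: "'y::real_normed_vector \<Rightarrow> 'a::euclidean_space \<Rightarrow> 'c::real_normed_vector"
    and F :: "'z::real_normed_vector \<Rightarrow> 'y"
  assumes W: "open W" "F z \<in> W" and L: "\<And>y. y \<in> W \<Longrightarrow> linear (L y)"
    and diff: "\<And>a. (\<lambda>y. L y a) differentiable (at (F z))"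
    and F: "(F has_derivative F') (at z)"
    and u: "(u has_derivative u') (at z)"
  shows "((\<lambda>z. L (F z) (u z)) has_derivative
    (\<lambda>h. dir_deriv (\<lambda>y. L y (u z)) (F z) (F' h) + L (F z) (u' h))) (at z)"
proof -
  have "bilinear (\<lambda>a (r::real). r *\<^sub>R L y a)" if "y \<in> W" for y
    using L[OF that] unfolding bilinear_def
    by (auto intro!: linearI simp: linear_add linear_cmul algebra_simps)
  then have "((\<lambda>z. 1 *\<^sub>R L (F z) (u z)) has_derivative (\<lambda>h. dir_deriv (\<lambda>y. 1 *\<^sub>R L y (u z)) (F z) (F' h) +
      1 *\<^sub>R L (F z) (u' h) + 0 *\<^sub>R L (F z) (u z))) (at z)"
    by (intro has_derivative_bilinear_family[where B = "\<lambda>y a r. r *\<^sub>R L y a" and w = "\<lambda>_. 1" and w' = "\<lambda>_. 0" and W = W]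
        W F u has_derivative_const) (simp_all add: diff)
  then show ?thesis by simp
qed

text \<open>This is the \<open>t\<close>-derivative at \<open>0\<close> of \<open>g\<close> at \<open>y + t v\<close> on \<open>a + t \<alpha>\<close> and \<open>b + t \<beta>\<close>, for the point \<open>(y, v)\<close>
  and the vectors \<open>(a, \<alpha>)\<close> and \<open>(b, \<beta>)\<close> of the tangent bundle.\<close>

definition complete_lift :: "'k::euclidean_space local_metric \<Rightarrow> ('k \<times> 'k) local_metric"
  where "complete_lift g p a b = dir_deriv (\<lambda>y. g y (fst a) (fst b)) (fst p) (snd p) +
    g (fst p) (snd a) (fst b) + g (fst p) (fst a) (snd b)"

lemma complete_lift_has_derivative:
  assumes g: "local_riemannian W g" and p: "fst p \<in> W"
  shows "((\<lambda>p. complete_lift g p a b) has_derivative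
    (\<lambda>h. dir_deriv (\<lambda>y. dir_deriv (\<lambda>y. g y (fst a) (fst b)) y (snd p)) (fst p) (fst h) +
      dir_deriv (\<lambda>y. g y (fst a) (fst b)) (fst p) (snd h) +
      dir_deriv (\<lambda>y. g y (snd a) (fst b)) (fst p) (fst h) +
      dir_deriv (\<lambda>y. g y (fst a) (snd b)) (fst p) (fst h))) (at p)"
proof -
  have sm: "(\<lambda>y. g y a b) differentiable (at y)"
    "(\<lambda>y. dir_deriv (\<lambda>y. g y a b) y k) differentiable (at y)" if "y \<in> W" for a b k y
    using local_riemannian_imp(2)[OF g p]
    by (blast intro: smooth_on_imp_differentiable[OF _ that] smooth_on_dir_deriv)+
  have "linear (dir_deriv (\<lambda>y. g y a b) y)" if "y \<in> W" for y a b
    by (rule linear_frechet_derivative[OF sm(1)[OF that]])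
  then have "((\<lambda>p. dir_deriv (\<lambda>y. g y (fst a) (fst b)) (fst p) (snd p)) has_derivative
     (\<lambda>h. dir_deriv (\<lambda>y. dir_deriv (\<lambda>y. g y (fst a) (fst b)) y (snd p)) (fst p) (fst h) +
      dir_deriv (\<lambda>y. g y (fst a) (fst b)) (fst p) (snd h))) (at p)"
    using p by (intro has_derivative_linear_family[where F = fst and W = W] local_riemannian_imp(1)[OF g p] sm
        has_derivative_fst has_derivative_snd has_derivative_ident)
  moreover have "((\<lambda>p. g (fst p) c d) has_derivative (\<lambda>h. dir_deriv (\<lambda>y. g y c d) (fst p) (fst h))) (at p)" for c d
    by (rule has_derivative_compose[OF has_derivative_fst[OF has_derivative_ident] has_derivative_dir_deriv[OF sm(1)[OF p]]])
  ultimately show ?thesis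
    unfolding complete_lift_def by (intro has_derivative_add)
qed

text \<open>This makes the holomorphy argument applicable to maps into the tangent bundle. The fibre
  coordinate is unrestricted, whence the factor \<open>UNIV\<close>.\<close>

lemma form_field_complete_lift:
  assumes g: "local_riemannian W g"
  shows "form_field (W \<times> UNIV) (complete_lift g)"
  unfolding form_field_def
proof (intro conjI ballI allI)
  show "open (W \<times> (UNIV :: 'a set))"
    using g by (simp add: local_riemannian_def open_Times)
  fix p :: "'a \<times> 'a" assume "p \<in> W \<times> UNIV"
  then have p: "fst p \<in> W" by auto
  note ff = local_riemannian_imp_form_field[OF g]
  note gp = form_field_imp(2)[OF ff p] and D = form_field_dir_deriv_bilinear[OF ff p]
  show "bilinear (complete_lift g p)"
    unfolding bilinear_def
    by (auto intro!: linearI simp: complete_lift_def bilinear_ladd[OF gp] bilinear_radd[OF gp]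
        bilinear_lmul[OF gp] bilinear_rmul[OF gp] bilinear_ladd[OF D] bilinear_radd[OF D]
        bilinear_lmul[OF D] bilinear_rmul[OF D] algebra_simps)
  show "complete_lift g p a b = complete_lift g p b a" for a b
    unfolding complete_lift_def
    using form_field_dir_deriv_commute[OF ff p, of "fst a" "fst b"] form_field_imp(3)[OF ff p, of "fst a" "snd b"]
      form_field_imp(3)[OF ff p, of "snd a" "fst b"] by simp
  show "(\<lambda>p. complete_lift g p a b) differentiable (at p)" for a b
    unfolding differentiable_def using complete_lift_has_derivative[OF g p, of a b] by blast
qed

section \<open>Tension and Jacobi equations for the flat source metric\<close>

definition flat_tension :: "'k::euclidean_space local_metric \<Rightarrow> ('e::euclidean_space \<Rightarrow> 'k) \<Rightarrow> 'e \<Rightarrow> 'k"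
  where "flat_tension g F x = (\<Sum>e\<in>Basis. dir_deriv (\<lambda>y. dir_deriv F y e) x e +
    christoffel g (F x) (dir_deriv F x e) (dir_deriv F x e))"

text \<open>The linearization of \<open>flat_tension\<close> in the coordinate direction \<open>V\<close>.\<close>

definition flat_jacobi ::
    "'k::euclidean_space local_metric \<Rightarrow> ('e::euclidean_space \<Rightarrow> 'k) \<Rightarrow> ('e \<Rightarrow> 'k) \<Rightarrow> 'e \<Rightarrow> 'k"
  where "flat_jacobi g F V x = (\<Sum>e\<in>Basis. dir_deriv (\<lambda>y. dir_deriv V y e) x e +
    2 *\<^sub>R christoffel g (F x) (dir_deriv F x e) (dir_deriv V x e) +
    dir_deriv (\<lambda>y. christoffel g y (dir_deriv F x e) (dir_deriv F x e)) (F x) (V x))"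

text \<open>For each basis direction \<open>e\<close> this is the Koszul formula with both arguments
  equal to \<open>dir_deriv F x e\<close>. It ties the lowered equation to the connection when the
  metric is positive definite.\<close>

lemma lowered_tension_eq:
  assumes g: "local_riemannian W g" and x: "F x \<in> W"
  shows "lowered_tension g F x w = 2 * g (F x) (flat_tension g F x) w"
proof -
  have gx: "bilinear (g (F x))" by (rule local_riemannian_imp(3)[OF g x])
  then have lin: "linear (\<lambda>a. g (F x) a w)" by (simp add: bilinear_def)
  show ?thesis
    using christoffel_koszul[OF g x, of "dir_deriv F x _" "dir_deriv F x _" w]
    unfolding lowered_tension_def flat_tension_def linear_sum[OF lin] linear_add[OF lin] sum_distrib_left
    by (intro sum.cong) (simp_all add: algebra_simps)
qed

lemma dir_deriv_Pair:
  assumes "F differentiable (at x)" "V differentiable (at x)"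
  shows "dir_deriv (\<lambda>x. (F x, V x)) x a = (dir_deriv F x a, dir_deriv V x a)"
  using has_derivative_Pair[OF has_derivative_dir_deriv has_derivative_dir_deriv, OF assms]
  by (rule dir_deriv_eqI)

lemma dir_deriv_dir_deriv_Pair:
  assumes S: "open S" "x \<in> S" and F: "smooth_on S F" and V: "smooth_on S V"
  shows "((\<lambda>y. dir_deriv (\<lambda>x. (F x, V x)) y a) has_derivative
    (\<lambda>b. (dir_deriv (\<lambda>y. dir_deriv F y a) x b, dir_deriv (\<lambda>y. dir_deriv V y a) x b))) (at x)"
proof (rule has_derivative_transform_within_open[OF _ S])
  show "((\<lambda>y. (dir_deriv F y a, dir_deriv V y a)) has_derivative
    (\<lambda>b. (dir_deriv (\<lambda>y. dir_deriv F y a) x b, dir_deriv (\<lambda>y. dir_deriv V y a) x b))) (at x)"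
    by (intro has_derivative_Pair has_derivative_dir_deriv smooth_on_imp_differentiable[OF smooth_on_dir_deriv S(2)] F V)
  show "(dir_deriv F y a, dir_deriv V y a) = dir_deriv (\<lambda>x. (F x, V x)) y a" if "y \<in> S" for y
    using smooth_on_imp_differentiable[OF F that] smooth_on_imp_differentiable[OF V that]
    by (simp add: dir_deriv_Pair)
qed

text \<open>Formally the right-hand side is the derivative at \<open>t = 0\<close> of twice the
  inner product of the flat tension of \<open>F + t V\<close> with \<open>fst w + t * snd w\<close>,
  taken at \<open>F x + t V x\<close>: the three terms come from varying the tension, the metric and
  the test vector. Hence the lifted tension vanishes when both the tension and its linearization
  do.\<close>

lemma lowered_tension_complete_lift:
  assumes g: "local_riemannian W g" and x: "F x \<in> W"
    and S: "open S" "x \<in> S" and F: "smooth_on S F" and V: "smooth_on S V"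
  shows "lowered_tension (complete_lift g) (\<lambda>x. (F x, V x)) x w =
    2 * g (F x) (flat_jacobi g F V x) (fst w) +
    2 * dir_deriv (\<lambda>y. g y (flat_tension g F x) (fst w)) (F x) (V x) +
    2 * g (F x) (flat_tension g F x) (snd w)"
proof -
  note ff = local_riemannian_imp_form_field[OF g]
  note gx = local_riemannian_imp(3)[OF g x] and Dg = form_field_dir_deriv_bilinear[OF ff x]
  have lin: "linear (\<lambda>a. g (F x) a u)" "linear (\<lambda>a. dir_deriv (\<lambda>y. g y a u) (F x) (V x))" for u
    using gx Dg by (auto simp: bilinear_def)
  have lift: "dir_deriv (\<lambda>p. complete_lift g p a b) (F x, V x) h =
      dir_deriv (\<lambda>y. dir_deriv (\<lambda>y. g y (fst a) (fst b)) y (V x)) (F x) (fst h) +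
      dir_deriv (\<lambda>y. g y (fst a) (fst b)) (F x) (snd h) +
      dir_deriv (\<lambda>y. g y (snd a) (fst b)) (F x) (fst h) +
      dir_deriv (\<lambda>y. g y (fst a) (snd b)) (F x) (fst h)" for a b h
    using dir_deriv_eqI[OF complete_lift_has_derivative[OF g, of "(F x, V x)" a b]] x by simp
  \<comment> \<open>In the derivative of the lift \<open>g\<close> is differentiated along
    \<open>V x\<close> before the other direction, in the derivative of the Koszul formula after
    it.\<close>
  have swap: "dir_deriv (\<lambda>y. dir_deriv (\<lambda>y. g y a b) y k) (F x) l =
      dir_deriv (\<lambda>y. dir_deriv (\<lambda>y. g y a b) y l) (F x) k" for a b k l
    by (rule second_derivative_symmetric[OF local_riemannian_imp(1)[OF g x] x local_riemannian_imp(2)[OF g x]])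
  have U1: "dir_deriv (\<lambda>x. (F x, V x)) x e = (dir_deriv F x e, dir_deriv V x e)" for e
    by (intro dir_deriv_Pair smooth_on_imp_differentiable[OF F S(2)] smooth_on_imp_differentiable[OF V S(2)])
  have U2: "dir_deriv (\<lambda>y. dir_deriv (\<lambda>x. (F x, V x)) y e) x e =
      (dir_deriv (\<lambda>y. dir_deriv F y e) x e, dir_deriv (\<lambda>y. dir_deriv V y e) x e)" for e
    by (rule dir_deriv_eqI[OF dir_deriv_dir_deriv_Pair[OF S F V]])
  obtain w1 w2 where w: "w = (w1, w2)" by (cases w)
  show ?thesis
    unfolding lowered_tension_def flat_tension_def flat_jacobi_def linear_sum[OF lin(1)] linear_sum[OF lin(2)]
      sum_distrib_left sum.distrib[symmetric]
  proof (rule sum.cong[OF refl])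
    fix e :: 'b
    define a \<alpha> where "a = dir_deriv F x e" and "\<alpha> = dir_deriv V x e"
    have K1: "2 * g (F x) (christoffel g (F x) a \<alpha>) w1 = dir_deriv (\<lambda>y. g y \<alpha> w1) (F x) a +
        dir_deriv (\<lambda>y. g y a w1) (F x) \<alpha> - dir_deriv (\<lambda>y. g y a \<alpha>) (F x) w1"
      by (rule christoffel_koszul[OF g x])
    have K2: "2 * g (F x) (christoffel g (F x) a a) w2 = dir_deriv (\<lambda>y. g y a w2) (F x) a +
        dir_deriv (\<lambda>y. g y a w2) (F x) a - dir_deriv (\<lambda>y. g y a a) (F x) w2"
      by (rule christoffel_koszul[OF g x])
    have K3: "2 * g (F x) (dir_deriv (\<lambda>y. christoffel g y a a) (F x) (V x)) w1 =
        2 * dir_deriv (\<lambda>y. dir_deriv (\<lambda>y. g y a w1) y (V x)) (F x) a -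
        dir_deriv (\<lambda>y. dir_deriv (\<lambda>y. g y a a) y (V x)) (F x) w1 -
        2 * dir_deriv (\<lambda>y. g y (christoffel g (F x) a a) w1) (F x) (V x)"
      using christoffel_dir_deriv[OF g x, of a a "V x" w1] swap[of a w1 a "V x"] swap[of a a w1 "V x"] by simp
    have c: "dir_deriv (\<lambda>y. g y \<alpha> a) (F x) w1 = dir_deriv (\<lambda>y. g y a \<alpha>) (F x) w1"
      by (rule form_field_dir_deriv_commute[OF ff x])
    show "2 * complete_lift g (F x, V x) (dir_deriv (\<lambda>y. dir_deriv (\<lambda>x. (F x, V x)) y e) x e) w +
         2 * dir_deriv (\<lambda>y. complete_lift g y (dir_deriv (\<lambda>x. (F x, V x)) x e) w) (F x, V x)
              (dir_deriv (\<lambda>x. (F x, V x)) x e) -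
         dir_deriv (\<lambda>y. complete_lift g y (dir_deriv (\<lambda>x. (F x, V x)) x e) (dir_deriv (\<lambda>x. (F x, V x)) x e))
          (F x, V x) w =
         2 * g (F x) (dir_deriv (\<lambda>y. dir_deriv V y e) x e +
               2 *\<^sub>R christoffel g (F x) (dir_deriv F x e) (dir_deriv V x e) +
               dir_deriv (\<lambda>y. christoffel g y (dir_deriv F x e) (dir_deriv F x e)) (F x) (V x)) (fst w) +
         2 * dir_deriv (\<lambda>y. g y (dir_deriv (\<lambda>y. dir_deriv F y e) x e +
               christoffel g (F x) (dir_deriv F x e) (dir_deriv F x e)) (fst w)) (F x) (V x) +
         2 * g (F x) (dir_deriv (\<lambda>y. dir_deriv F y e) x e +
               christoffel g (F x) (dir_deriv F x e) (dir_deriv F x e)) (snd w)"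
      unfolding U1 U2 w lift fst_conv snd_conv a_def[symmetric] \<alpha>_def[symmetric]
        bilinear_ladd[OF gx] bilinear_lmul[OF gx] bilinear_ladd[OF Dg]
      unfolding complete_lift_def fst_conv snd_conv
      using K1 K2 K3 c by simp
  qed
qed

section \<open>Conformal source metrics\<close>

text \<open>Raising the index of \<open>b\<close> with respect to \<open>r\<close> times the
  Euclidean product gives \<open>b / r\<close>.\<close>

lemma metric_trace_conformal:
  fixes H :: "'e::euclidean_space \<Rightarrow> 'e \<Rightarrow> real"
  assumes "r > 0" and H: "\<And>a b. H a b = r * (a \<bullet> b)"
  shows "metric_trace H B = (\<Sum>b\<in>Basis. B b ((1 / r) *\<^sub>R b))"
proof -
  have "(THE z. \<forall>w. H z w = b \<bullet> w) = (1 / r) *\<^sub>R b" for b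
  proof (rule the_equality)
    show "\<forall>w. H ((1 / r) *\<^sub>R b) w = b \<bullet> w" using \<open>r > 0\<close> by (simp add: H[of "(1 / r) *\<^sub>R b"])
    show "z = (1 / r) *\<^sub>R b" if "\<forall>w. H z w = b \<bullet> w" for z
    proof -
      have "z \<bullet> w = (1 / r) *\<^sub>R b \<bullet> w" for w
        using that[rule_format, of w] H[of z w] \<open>r > 0\<close> by (simp add: field_simps)
      then show ?thesis by (metis vector_eq_rdot)
    qed
  qed
  then show ?thesis by (simp add: metric_trace_def)
qed

text \<open>The reason for the conformal invariance of the harmonic map equation in dimension two.\<close>

lemma christoffel_conformal_trace:
  fixes h :: "complex local_metric"
  assumes h: "local_riemannian S h" and x: "x \<in> S"
    and conf: "\<And>x. x \<in> S \<Longrightarrow> \<exists>r>0. \<forall>a b. h x a b = r * (a \<bullet> b)"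
  shows "christoffel h x 1 1 + christoffel h x \<i> \<i> = 0"
proof (rule positive_form_cancel[of "h x"])
  let ?r = "\<lambda>y. h y 1 1"
  note hx = local_riemannian_imp(3)[OF h x]
  note r = form_field_imp(4)[OF local_riemannian_imp_form_field[OF h] x, of 1 1]
  \<comment> \<open>Conformality supplies an unrelated factor at each point; reading it off as
    \<open>h y 1 1\<close> turns it into a function that can be differentiated.\<close>
  have conf': "h y a b = (a \<bullet> b) * ?r y" if "y \<in> S" for y a b
  proof -
    obtain r where "\<forall>a b. h y a b = r * (a \<bullet> b)" using conf[OF \<open>y \<in> S\<close>] by blast
    then have "h y a b = r * (a \<bullet> b)" "?r y = r * (1 \<bullet> (1::complex))" by blast+
    then show ?thesis by simp
  qed
  have d: "dir_deriv (\<lambda>y. h y a b) x k = (a \<bullet> b) * dir_deriv ?r x k" for a b k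
  proof -
    have "dir_deriv (\<lambda>y. h y a b) x k = dir_deriv (\<lambda>y. (a \<bullet> b) * ?r y) x k"
      by (rule dir_deriv_cong_open[OF local_riemannian_imp(1)[OF h x] x conf'])
    also have "\<dots> = (a \<bullet> b) * dir_deriv ?r x k"
      by (rule dir_deriv_eqI[OF has_derivative_mult_right[OF has_derivative_dir_deriv[OF r]]])
    finally show ?thesis .
  qed
  have D: "dir_deriv ?r x w = (w \<bullet> 1) * dir_deriv ?r x 1 + (w \<bullet> \<i>) * dir_deriv ?r x \<i>" for w
    using linear_expand[OF linear_frechet_derivative[OF r], of w] by (simp add: Basis_complex_def)
  \<comment> \<open>In dimension n the Koszul formulas for a conformal metric sum to (2 - n) times
    the derivative of the factor along \<open>w\<close>; here n = 2.\<close>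
  show "h x (christoffel h x 1 1 + christoffel h x \<i> \<i>) w = h x 0 w" for w
    using christoffel_koszul[OF h x, of 1 1 w] christoffel_koszul[OF h x, of \<i> \<i> w] D[of w]
      d[of 1 w 1] d[of \<i> w \<i>] d[of \<i> \<i> w]
    by (simp add: bilinear_ladd[OF hx] bilinear_lzero[OF hx] inner_commute[of _ w])
qed (use local_riemannian_imp[OF h x] in auto)

text \<open>Constant fields have zero bracket, so only the commutator survives; the sign convention
  puts the term that differentiates along \<open>b\<close> first with a plus sign.\<close>

lemma curvature_eq:
  assumes g: "local_riemannian W g" and y: "y \<in> W"
  shows "curvature g y a b z =
    dir_deriv (\<lambda>y. christoffel g y a z) y b + christoffel g y b (christoffel g y a z) -
    dir_deriv (\<lambda>y. christoffel g y b z) y a - christoffel g y a (christoffel g y b z)"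
proof -
  have "nabla g (\<lambda>_. c) (\<lambda>_. z) = (\<lambda>y. christoffel g y c z)" for c
    by (rule ext) (simp add: nabla_def)
  moreover have "nabla g (lie_bracket (\<lambda>_. a) (\<lambda>_. b)) (\<lambda>_. z) y = 0"
    by (simp add: nabla_def lie_bracket_def bilinear_lzero[OF bilinear_christoffel[OF g y]])
  ultimately show ?thesis
    by (simp add: curvature_def curvature_op_def nabla_def)
qed

text \<open>Serves to move the factor \<open>1 / r\<close> from a raised basis vector out of second
  derivatives.\<close>

lemma dir_deriv_scaleR_direction:
  assumes S: "open S" "x \<in> S" and F: "smooth_on S F"
  shows "dir_deriv (\<lambda>y. dir_deriv F y (s *\<^sub>R b)) x a = s *\<^sub>R dir_deriv (\<lambda>y. dir_deriv F y b) x a"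
proof -
  have "dir_deriv F y (s *\<^sub>R b) = s *\<^sub>R dir_deriv F y b" if "y \<in> S" for y
    by (rule linear_cmul[OF linear_frechet_derivative[OF smooth_on_imp_differentiable[OF F that]]])
  then have "dir_deriv (\<lambda>y. dir_deriv F y (s *\<^sub>R b)) x a = dir_deriv (\<lambda>y. s *\<^sub>R dir_deriv F y b) x a"
    by (rule dir_deriv_cong_open[OF S])
  also have "\<dots> = s *\<^sub>R dir_deriv (\<lambda>y. dir_deriv F y b) x a"
    by (rule dir_deriv_eqI) (intro has_derivative_scaleR_right has_derivative_dir_deriv
        smooth_on_imp_differentiable[OF smooth_on_dir_deriv[OF F] S(2)])
  finally show ?thesis .
qed

text \<open>One complex coordinate on the source and one chart of the target: \<open>S\<close>
  stands for the coordinate points that are mapped into the chart, \<open>W\<close> for its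
  range.\<close>

locale conformal_source =
  fixes S :: "complex set" and h :: "complex local_metric"
    and W :: "'k::euclidean_space set" and g :: "'k local_metric" and F :: "complex \<Rightarrow> 'k"
  assumes h: "local_riemannian S h"
    and conformal: "\<And>x. x \<in> S \<Longrightarrow> \<exists>r>0. \<forall>a b. h x a b = r * (a \<bullet> b)"
    and g: "local_riemannian W g"
    and F: "smooth_on S F" and FW: "\<And>x. x \<in> S \<Longrightarrow> F x \<in> W"
begin

lemma open_S: "open S"
  using h by (simp add: local_riemannian_def)

lemma linear_deriv: "smooth_on S f \<Longrightarrow> x \<in> S \<Longrightarrow> linear (dir_deriv f x)"
  by (rule linear_frechet_derivative[OF smooth_on_imp_differentiable])

lemma nabla_const: "nabla k (\<lambda>_. a) (\<lambda>_. b) = (\<lambda>x. christoffel k x a b)"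
  by (rule ext) (simp add: nabla_def)

lemma nabla_d_eq: "nabla_d h g F x a b = dir_deriv (\<lambda>y. dir_deriv F y b) x a +
    christoffel g (F x) (dir_deriv F x a) (dir_deriv F x b) - dir_deriv F x (christoffel h x a b)"
  by (simp add: nabla_d_def pullback_nabla_def nabla_const)

lemma nabla_sq_eq:
  assumes x: "x \<in> S" and V: "smooth_on S V"
  shows "nabla_sq h g F V x a b = dir_deriv (\<lambda>y. dir_deriv V y b) x a +
    dir_deriv (\<lambda>y. christoffel g y (dir_deriv F x b) (V x)) (F x) (dir_deriv F x a) +
    christoffel g (F x) (dir_deriv (\<lambda>y. dir_deriv F y b) x a) (V x) +
    christoffel g (F x) (dir_deriv F x b) (dir_deriv V x a) +
    christoffel g (F x) (dir_deriv F x a) (dir_deriv V x b + christoffel g (F x) (dir_deriv F x b) (V x)) -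
    (dir_deriv V x (christoffel h x a b) + christoffel g (F x) (dir_deriv F x (christoffel h x a b)) (V x))"
proof -
  note diff = has_derivative_dir_deriv[OF smooth_on_imp_differentiable[OF _ x]]
  have "((\<lambda>y. dir_deriv V y b + christoffel g (F y) (dir_deriv F y b) (V y)) has_derivative
    (\<lambda>a. dir_deriv (\<lambda>y. dir_deriv V y b) x a +
      (dir_deriv (\<lambda>y. christoffel g y (dir_deriv F x b) (V x)) (F x) (dir_deriv F x a) +
       christoffel g (F x) (dir_deriv (\<lambda>y. dir_deriv F y b) x a) (V x) +
       christoffel g (F x) (dir_deriv F x b) (dir_deriv V x a)))) (at x)"
    by (intro has_derivative_add has_derivative_bilinear_family[where F = F and W = W] diff smooth_on_dir_deriv F V
        local_riemannian_imp(1)[OF g FW[OF x]] FW[OF x] bilinear_christoffel[OF g] christoffel_differentiable[OF g])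
  from dir_deriv_eqI[OF this, of a] show ?thesis
    by (simp add: nabla_sq_def pullback_nabla_def[abs_def] nabla_const)
qed

text \<open>The tension field is \<open>1 / r\<close> times the flat one: the trace contributes the
  factor, and the source Christoffel symbols enter only through their trace, which is zero.\<close>

lemma tension_field_eq_0_iff:
  assumes x: "x \<in> S"
  shows "tension_field h g F x = 0 \<longleftrightarrow> flat_tension g F x = 0"
proof -
  obtain r where r: "r > 0" "\<And>a b. h x a b = r * (a \<bullet> b)"
    using conformal[OF x] by blast
  note FL = linear_deriv[OF F x]
  note G = bilinear_christoffel[OF g FW[OF x]] and H = bilinear_christoffel[OF h x]
  have scale: "nabla_d h g F x a (s *\<^sub>R b) = s *\<^sub>R nabla_d h g F x a b" for a b s
    by (simp add: nabla_d_eq dir_deriv_scaleR_direction[OF open_S x F] linear_cmul[OF FL]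
        bilinear_rmul[OF G] bilinear_rmul[OF H] algebra_simps)
  have "dir_deriv F x (christoffel h x 1 1) + dir_deriv F x (christoffel h x \<i> \<i>) = 0"
    using christoffel_conformal_trace[OF h x conformal] linear_add[OF FL] linear_0[OF FL] by metis
  then have "nabla_d h g F x 1 1 + nabla_d h g F x \<i> \<i> = flat_tension g F x"
    unfolding nabla_d_eq flat_tension_def Basis_complex_def by (simp add: algebra_simps)
  then have "tension_field h g F x = (1 / r) *\<^sub>R flat_tension g F x"
    unfolding tension_field_def metric_trace_conformal[OF r] scale Basis_complex_def
    by (simp flip: scaleR_right_distrib)
  then show ?thesis using r by simp
qed

text \<open>The covariant Jacobi operator and the linearization of the tension in coordinates
  differ, up to the factor \<open>- 1 / r\<close>, by the Christoffel symbol of \<open>V x\<close>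
  with the tension. This is where harmonicity enters.\<close>

lemma jacobi_operator_eq_0_imp:
  assumes x: "x \<in> S" and V: "smooth_on S V"
    and harmonic: "flat_tension g F x = 0" and jacobi: "jacobi_operator h g F V x = 0"
  shows "flat_jacobi g F V x = 0"
proof -
  obtain r where r: "r > 0" "\<And>a b. h x a b = r * (a \<bullet> b)"
    using conformal[OF x] by blast
  note FL = linear_deriv[OF F x] and VL = linear_deriv[OF V x]
  note G = bilinear_christoffel[OF g FW[OF x]] and H = bilinear_christoffel[OF h x]
  note Gc = christoffel_commute[OF g FW[OF x]]
  have DG: "bilinear (\<lambda>a b. dir_deriv (\<lambda>y. christoffel g y a b) (F x) k)" for k
    by (intro dir_deriv_bilinear_family[of W] local_riemannian_imp(1)[OF g FW[OF x]] FW[OF x]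
        bilinear_christoffel[OF g] christoffel_differentiable[OF g])
  have DGc: "dir_deriv (\<lambda>y. christoffel g y a b) (F x) k = dir_deriv (\<lambda>y. christoffel g y b a) (F x) k" for a b k
    by (rule dir_deriv_cong_open[OF local_riemannian_imp(1)[OF g FW[OF x]] FW[OF x]]) (rule christoffel_commute[OF g])
  have scale1: "nabla_sq h g F V x a (s *\<^sub>R b) = s *\<^sub>R nabla_sq h g F V x a b" for a b s
    by (simp add: nabla_sq_eq[OF x V] dir_deriv_scaleR_direction[OF open_S x F]
        dir_deriv_scaleR_direction[OF open_S x V] linear_cmul[OF FL] linear_cmul[OF VL]
        bilinear_rmul[OF G] bilinear_lmul[OF G] bilinear_radd[OF G] bilinear_rmul[OF H]
        bilinear_lmul[OF DG] algebra_simps)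
  have scale2: "curvature g (F x) a v (dir_deriv F x (s *\<^sub>R b)) = s *\<^sub>R curvature g (F x) a v (dir_deriv F x b)" for a b v s
    by (simp add: curvature_eq[OF g FW[OF x]] linear_cmul[OF FL] bilinear_rmul[OF G] bilinear_rmul[OF DG] algebra_simps)
  let ?T = "\<lambda>e. nabla_sq h g F V x e e + curvature g (F x) (dir_deriv F x e) (V x) (dir_deriv F x e)"
  have tr: "christoffel h x 1 1 + christoffel h x \<i> \<i> = 0"
    by (rule christoffel_conformal_trace[OF h x conformal])
  have tr1: "dir_deriv V x (christoffel h x 1 1) + dir_deriv V x (christoffel h x \<i> \<i>) = 0"
    using tr linear_add[OF VL] linear_0[OF VL] by metis
  have tr2: "christoffel g (F x) (dir_deriv F x (christoffel h x 1 1)) (V x) +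
      christoffel g (F x) (dir_deriv F x (christoffel h x \<i> \<i>)) (V x) = 0"
    using tr linear_add[OF FL] linear_0[OF FL] bilinear_ladd[OF G] bilinear_lzero[OF G] by metis
  \<comment> \<open>The curvature cancels from the second covariant derivative both the Christoffel
    derivative along \<open>dir_deriv F x e\<close> and the iterated symbol in that direction; what
    it adds is the derivative along \<open>V x\<close> and the symbol of \<open>V x\<close> with the
    quadratic part of the tension.\<close>
  have T: "?T e = (dir_deriv (\<lambda>y. dir_deriv V y e) x e +
      2 *\<^sub>R christoffel g (F x) (dir_deriv F x e) (dir_deriv V x e) +
      dir_deriv (\<lambda>y. christoffel g y (dir_deriv F x e) (dir_deriv F x e)) (F x) (V x)) +
      christoffel g (F x) (V x) (dir_deriv (\<lambda>y. dir_deriv F y e) x e +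
        christoffel g (F x) (dir_deriv F x e) (dir_deriv F x e)) -
      (dir_deriv V x (christoffel h x e e) + christoffel g (F x) (dir_deriv F x (christoffel h x e e)) (V x))" for e
    unfolding nabla_sq_eq[OF x V] curvature_eq[OF g FW[OF x]] bilinear_radd[OF G] scaleR_2
    using DGc[of "dir_deriv F x e" "V x" "dir_deriv F x e"] Gc[of "dir_deriv F x e" "V x"]
      Gc[of "dir_deriv (\<lambda>y. dir_deriv F y e) x e" "V x"] by simp
  have "christoffel g (F x) (V x) (flat_tension g F x) = 0"
    by (simp add: harmonic bilinear_rzero[OF G])
  then have "?T 1 + ?T \<i> = flat_jacobi g F V x"
    using tr1 tr2 unfolding T flat_tension_def flat_jacobi_def Basis_complex_def
    by (simp add: bilinear_radd[OF G] algebra_simps)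
  moreover have "jacobi_operator h g F V x = - ((1 / r) *\<^sub>R (?T 1 + ?T \<i>))"
    unfolding jacobi_operator_def rough_laplacian_def metric_trace_conformal[OF r] scale1 scale2 Basis_complex_def
    by (simp add: algebra_simps)
  ultimately show ?thesis using jacobi r by simp
qed

end

section \<open>Quadratic differentials on the sphere\<close>

lemma is_chart_subset: "is_chart X c \<Longrightarrow> fst c \<subseteq> topspace X"
  by (simp add: is_chart_def openin_subset)

lemma is_chart_topspace: "is_chart X c \<Longrightarrow> topspace (subtopology X (fst c)) = fst c"
  by (simp add: is_chart_subset inf_absorb2)

lemma is_chart_inj_on: "is_chart X c \<Longrightarrow> inj_on (snd c) (fst c)"
  using homeomorphic_imp_injective_map is_chart_topspace unfolding is_chart_def by metis

lemma chart_inv_coord: "is_chart X c \<Longrightarrow> p \<in> fst c \<Longrightarrow> chart_inv c (snd c p) = p"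
  unfolding chart_inv_def by (rule inv_into_f_f[OF is_chart_inj_on])

lemma chart_range_iff: "x \<in> chart_range c \<longleftrightarrow> (\<exists>p\<in>fst c. x = snd c p)"
  unfolding chart_range_def by blast

lemma chart_inv_in: "x \<in> chart_range c \<Longrightarrow> chart_inv c x \<in> fst c"
  unfolding chart_inv_def chart_range_def by (rule inv_into_into)

lemma coord_chart_inv: "x \<in> chart_range c \<Longrightarrow> snd c (chart_inv c x) = x"
  unfolding chart_inv_def chart_range_def by (rule f_inv_into_f)

lemma open_chart_image:
  assumes c: "is_chart X c" and "openin X U"
  shows "open (snd c ` (fst c \<inter> U))"
proof -
  have "openin (subtopology X (fst c)) (fst c \<inter> U)"
    using assms(2) by (metis openin_subtopology_Int2)
  moreover have "open_map (subtopology X (fst c)) (top_of_set (chart_range c)) (snd c)"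
    using c homeomorphic_imp_open_map unfolding is_chart_def by blast
  ultimately have "openin (top_of_set (chart_range c)) (snd c ` (fst c \<inter> U))"
    unfolding open_map_def by blast
  then show ?thesis
    using c by (simp add: is_chart_def openin_open_eq)
qed

text \<open>The inverse furnished by the homeomorphism agrees with \<open>chart_inv\<close> on the
  chart range.\<close>

lemma continuous_map_chart_inv:
  assumes c: "is_chart X c"
  shows "continuous_map (top_of_set (chart_range c)) X (chart_inv c)"
proof -
  obtain k where k: "homeomorphic_maps (subtopology X (fst c)) (top_of_set (chart_range c)) (snd c) k"
    using c homeomorphic_map_maps unfolding is_chart_def by blast
  have "k x = chart_inv c x" if "x \<in> chart_range c" for x
  proof -
    from that obtain p where "p \<in> fst c" "x = snd c p" by (auto simp: chart_range_iff)
    then show ?thesis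
      using k c by (simp add: homeomorphic_maps_def chart_inv_coord is_chart_topspace[OF c, unfolded topspace_subtopology])
  qed
  moreover have "continuous_map (top_of_set (chart_range c)) X k"
    using k continuous_map_into_fulltopology unfolding homeomorphic_maps_def by blast
  ultimately show ?thesis by (metis continuous_map_eq topspace_euclidean_subtopology)
qed

lemma transition_coord: "is_chart X c \<Longrightarrow> p \<in> fst c \<Longrightarrow> transition c c' (snd c p) = snd c' p"
  by (simp add: transition_def chart_inv_coord)

section \<open>Stereographic coordinates and the atlas of the sphere\<close>

definition stereo_north_inv :: "complex \<Rightarrow> complex \<times> real"
  where "stereo_north_inv z =
    (of_real (2 / ((norm z)\<^sup>2 + 1)) * z, ((norm z)\<^sup>2 - 1) / ((norm z)\<^sup>2 + 1))"

definition stereo_south_inv :: "complex \<Rightarrow> complex \<times> real"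
  where "stereo_south_inv z =
    (of_real (2 / ((norm z)\<^sup>2 + 1)) * cnj z, (1 - (norm z)\<^sup>2) / ((norm z)\<^sup>2 + 1))"

lemma sphere_iff: "(w, s) \<in> sphere (0::complex \<times> real) 1 \<longleftrightarrow> (norm w)\<^sup>2 + s\<^sup>2 = 1"
  by (simp add: dist_norm norm_Pair real_sqrt_eq_1_iff)

lemma norm_sq_plus_1_pos: "(norm (z::complex))\<^sup>2 + 1 > 0"
  by (simp add: add_nonneg_pos)

lemma of_real_mult_divide: "complex_of_real a * w / complex_of_real b = complex_of_real (a / b) * w"
  by simp

text \<open>A continuous inverse \<open>k\<close> defined on the whole coordinate space gives the
  homeomorphism and at the same time identifies the range and \<open>chart_inv\<close>.\<close>

lemma is_chart_if_inverse:
  fixes f :: "'a::topological_space \<Rightarrow> 'b::topological_space"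
  assumes "A \<subseteq> X" "openin (top_of_set X) A" "continuous_on A f" "continuous_on UNIV k"
    and "\<And>p. p \<in> A \<Longrightarrow> k (f p) = p" "\<And>z. k z \<in> A" "\<And>z. f (k z) = z"
  shows "is_chart (top_of_set X) (A, f)" "chart_range (A, f) = UNIV" "chart_inv (A, f) = k"
proof -
  show r: "chart_range (A, f) = UNIV"
    unfolding chart_range_def using assms(6,7) by (metis UNIV_eq_I fst_conv image_eqI snd_conv)
  have inj: "inj_on f A" using assms(5) by (rule inj_on_inverseI)
  show "chart_inv (A, f) = k"
    unfolding chart_inv_def using inv_into_f_f[OF inj assms(6)] assms(7) by auto
  have "homeomorphic_maps (top_of_set A) euclidean f k"
    using assms by (auto simp: homeomorphic_maps_def continuous_map_in_subtopology)
  then show "is_chart (top_of_set X) (A, f)"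
    unfolding is_chart_def r using assms(1,2)
    by (simp add: subtopology_subtopology inf_absorb2 homeomorphic_maps_imp_map)
qed

lemma stereo_north_chart:
  shows is_chart_stereo_north: "is_chart (top_of_set (sphere 0 1)) stereo_north"
    and chart_range_stereo_north: "chart_range stereo_north = UNIV"
    and chart_inv_stereo_north: "chart_inv stereo_north = stereo_north_inv"
proof -
  let ?A = "sphere (0::complex \<times> real) 1 - {(0, 1)}" and ?f = "\<lambda>(w :: complex, s). w / of_real (1 - s)"
  \<comment> \<open>Away from the removed pole the denominator \<open>1 - s\<close> is positive:
    \<open>s \<ge> 1\<close> on the unit sphere forces \<open>w = 0\<close> and
    \<open>s = 1\<close>.\<close>
  have s: "s < 1" if "(w, s) \<in> ?A" for w s
  proof (rule ccontr)
    assume "\<not> s < 1"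
    then have "s\<^sup>2 \<ge> 1" by (simp add: one_le_power)
    moreover have eq: "(norm w)\<^sup>2 + s\<^sup>2 = 1" using that unfolding Diff_iff sphere_iff by blast
    ultimately have "(norm w)\<^sup>2 = 0" "s\<^sup>2 = 1" using zero_le_power2[of "norm w"] by linarith+
    then show False using that \<open>\<not> s < 1\<close> by (auto simp: power2_eq_1_iff)
  qed
  have op: "openin (top_of_set (sphere (0::complex \<times> real) 1)) ?A"
    by (simp add: openin_delete)
  have cf: "continuous_on ?A ?f"
    unfolding case_prod_beta by (intro continuous_intros) (use s in force)
  have ck: "continuous_on UNIV stereo_north_inv"
    unfolding stereo_north_inv_def by (intro continuous_intros) (use norm_sq_plus_1_pos in \<open>auto simp: less_imp_neq[symmetric]\<close>)
  have kf: "stereo_north_inv (?f p) = p" if p: "p \<in> ?A" for p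
  proof -
    obtain w s where ws: "p = (w, s)" by (cases p)
    have s1: "1 - s > 0" using s p ws by simp
    have "(norm w)\<^sup>2 + s\<^sup>2 = 1" using p sphere_iff unfolding ws Diff_iff by blast
    then have "(norm w)\<^sup>2 = (1 - s) * (1 + s)" by (simp add: power2_eq_square algebra_simps)
    moreover have "norm (complex_of_real (1 - s)) = 1 - s"
      unfolding norm_of_real using s1 by simp
    ultimately have n: "(norm (w / of_real (1 - s)))\<^sup>2 = (1 + s) / (1 - s)"
      unfolding norm_divide power_divide using s1 by (simp add: power2_eq_square)
    have n1: "(1 + s) / (1 - s) + 1 = 2 / (1 - s)" "(1 + s) / (1 - s) - 1 = 2 * s / (1 - s)"
      using s1 by (simp_all add: field_simps)
    show ?thesis
      unfolding ws stereo_north_inv_def case_prod_conv n n1 using s1 by simp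
  qed
  have kA: "stereo_north_inv z \<in> ?A" for z
  proof -
    have "(norm z)\<^sup>2 - 1 \<noteq> (norm z)\<^sup>2 + 1" by simp
    then have "snd (stereo_north_inv z) \<noteq> 1"
      using norm_sq_plus_1_pos[of z] by (simp add: stereo_north_inv_def)
    moreover have "stereo_north_inv z \<in> sphere 0 1"
    proof -
      define n where "n = (norm z)\<^sup>2"
      have n: "n + 1 > 0" unfolding n_def by (rule norm_sq_plus_1_pos)
      then have "(norm (complex_of_real (2 / (n + 1)) * z))\<^sup>2 = 4 * n / (n + 1)\<^sup>2"
        unfolding norm_mult norm_of_real by (simp add: power_mult_distrib power_divide n_def)
      moreover have "4 * n / (n + 1)\<^sup>2 + ((n - 1) / (n + 1))\<^sup>2 = (4 * n + (n - 1)\<^sup>2) / (n + 1)\<^sup>2"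
        by (simp add: power_divide add_divide_distrib)
      moreover have "4 * n + (n - 1)\<^sup>2 = (n + 1)\<^sup>2"
        by (simp add: power2_eq_square algebra_simps)
      ultimately show ?thesis
        using n unfolding stereo_north_inv_def sphere_iff n_def[symmetric] by simp
    qed
    ultimately show ?thesis by auto
  qed
  have fk: "?f (stereo_north_inv z) = z" for z
  proof -
    have "1 - ((norm z)\<^sup>2 - 1) / ((norm z)\<^sup>2 + 1) = 2 / ((norm z)\<^sup>2 + 1)"
      using norm_sq_plus_1_pos[of z] by (simp add: field_simps)
    moreover have "2 / ((norm z)\<^sup>2 + 1) / (2 / ((norm z)\<^sup>2 + 1)) = 1"
      using norm_sq_plus_1_pos[of z] by simp
    ultimately show ?thesis
      unfolding stereo_north_inv_def case_prod_conv by (simp only: of_real_mult_divide of_real_1 mult_1_left)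
  qed
  note * = is_chart_if_inverse[OF Diff_subset op cf ck kf kA fk]
  then show "is_chart (top_of_set (sphere 0 1)) stereo_north" "chart_range stereo_north = UNIV"
    "chart_inv stereo_north = stereo_north_inv"
    unfolding stereo_north_def by blast+
qed

text \<open>The map \<open>R\<close> is a half-turn of the sphere exchanging the poles, and the
  southern coordinate is the northern one after \<open>R\<close>; everything is transported from the
  northern chart.\<close>

lemma stereo_south_chart:
  shows is_chart_stereo_south: "is_chart (top_of_set (sphere 0 1)) stereo_south"
    and chart_range_stereo_south: "chart_range stereo_south = UNIV"
    and chart_inv_stereo_south: "chart_inv stereo_south = stereo_south_inv"
proof -
  define R :: "complex \<times> real \<Rightarrow> complex \<times> real" where "R = (\<lambda>(w, s). (cnj w, - s))"
  have R: "R (R p) = p" "R p \<in> sphere 0 1 \<longleftrightarrow> p \<in> sphere 0 1" "R p = (0, 1) \<longleftrightarrow> p = (0, -1)" for p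
    by (auto simp: R_def sphere_iff split: prod.splits simp del: mem_sphere mem_sphere_0)
  have south: "snd stereo_south = snd stereo_north \<circ> R" "stereo_south_inv = R \<circ> stereo_north_inv"
    by (auto simp: R_def stereo_south_def stereo_north_def stereo_south_inv_def stereo_north_inv_def
        fun_eq_iff minus_divide_left)
  have RA: "R p \<in> fst stereo_north \<longleftrightarrow> p \<in> fst stereo_south" for p
    using R by (simp add: stereo_north_def stereo_south_def)
  have cR: "continuous_on A R" for A
    unfolding R_def case_prod_beta by (intro continuous_intros)
  have fst_south: "fst stereo_south = sphere 0 1 - {(0, -1)}" by (simp add: stereo_south_def)
  have sub: "fst stereo_north \<subseteq> sphere 0 1" by (auto simp: stereo_north_def)
  have "continuous_map (subtopology (top_of_set (sphere 0 1)) (fst stereo_north)) euclidean (snd stereo_north)"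
    using is_chart_stereo_north homeomorphic_imp_continuous_map
    unfolding is_chart_def chart_range_stereo_north by fastforce
  then have cN: "continuous_on (fst stereo_north) (snd stereo_north)"
    using sub by (simp add: subtopology_subtopology inf_absorb2)
  have "continuous_map euclidean (top_of_set (sphere 0 1)) stereo_north_inv"
    using continuous_map_chart_inv[OF is_chart_stereo_north]
    by (simp add: chart_range_stereo_north chart_inv_stereo_north)
  then have cNi: "continuous_on UNIV stereo_north_inv"
    by (simp add: continuous_map_in_subtopology)
  have sub': "fst stereo_south \<subseteq> sphere 0 1" by (auto simp: fst_south)
  have op: "openin (top_of_set (sphere 0 1)) (fst stereo_south)"
    unfolding fst_south by (simp add: openin_delete)
  have cf: "continuous_on (fst stereo_south) (snd stereo_south)"
    unfolding south by (intro continuous_on_compose cR continuous_on_subset[OF cN]) (use RA in auto)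
  have ck: "continuous_on UNIV stereo_south_inv"
    unfolding south by (intro continuous_on_compose cR cNi)
  have kf: "stereo_south_inv (snd stereo_south p) = p" if "p \<in> fst stereo_south" for p
    using chart_inv_coord[OF is_chart_stereo_north, of "R p"] that RA
    by (simp add: south R chart_inv_stereo_north)
  have kA: "stereo_south_inv z \<in> fst stereo_south" for z
    using chart_inv_in[of z stereo_north] RA[of "stereo_south_inv z"]
    by (simp add: south R chart_inv_stereo_north chart_range_stereo_north)
  have fk: "snd stereo_south (stereo_south_inv z) = z" for z
    using coord_chart_inv[of z stereo_north]
    by (simp add: south R chart_inv_stereo_north chart_range_stereo_north)
  note * = is_chart_if_inverse[OF sub' op cf ck kf kA fk]
  show "is_chart (top_of_set (sphere 0 1)) stereo_south" "chart_range stereo_south = UNIV"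
    "chart_inv stereo_south = stereo_south_inv"
    using * by simp_all
qed

lemma sphere2_atlas_chart: "c \<in> atlas sphere2 \<Longrightarrow> is_chart (mtop sphere2) c"
  by (simp add: sphere2_def)

lemma mtop_sphere2: "mtop sphere2 = top_of_set (sphere 0 1)"
  by (simp add: sphere2_def)

text \<open>The pole removed from one chart has coordinate 0 in the other.\<close>

lemma coord_overlap_stereo:
  "snd stereo_north ` (fst stereo_north \<inter> fst stereo_south) = - {0}"
  "snd stereo_south ` (fst stereo_south \<inter> fst stereo_north) = - {0}"
proof -
  have n: "(norm z)\<^sup>2 - 1 = - ((norm z)\<^sup>2 + 1) \<longleftrightarrow> z = 0" "1 - (norm z)\<^sup>2 = (norm z)\<^sup>2 + 1 \<longleftrightarrow> z = 0" for z :: complex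
    using zero_le_power2[of "norm z"] by (auto simp: power2_eq_square)
  have pos: "(norm z)\<^sup>2 + 1 \<noteq> 0" for z :: complex using norm_sq_plus_1_pos[of z] by linarith
  have N: "stereo_north_inv z \<in> fst stereo_south \<longleftrightarrow> z \<noteq> 0" for z
  proof -
    have "stereo_north_inv z \<in> sphere 0 1"
      using chart_inv_in[of z stereo_north] unfolding chart_inv_stereo_north chart_range_stereo_north
      by (simp add: stereo_north_def)
    moreover have "snd (stereo_north_inv z) = -1 \<longleftrightarrow> z = 0"
      using n[of z] pos[of z] by (simp add: stereo_north_inv_def divide_eq_eq)
    moreover have "z = 0 \<Longrightarrow> fst (stereo_north_inv z) = 0" by (simp add: stereo_north_inv_def)
    ultimately show ?thesis by (cases "stereo_north_inv z") (auto simp: stereo_south_def)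
  qed
  have S: "stereo_south_inv z \<in> fst stereo_north \<longleftrightarrow> z \<noteq> 0" for z
  proof -
    have "stereo_south_inv z \<in> sphere 0 1"
      using chart_inv_in[of z stereo_south] unfolding chart_inv_stereo_south chart_range_stereo_south
      by (simp add: stereo_south_def)
    moreover have "snd (stereo_south_inv z) = 1 \<longleftrightarrow> z = 0"
      using n[of z] pos[of z] by (simp add: stereo_south_inv_def divide_eq_eq)
    moreover have "z = 0 \<Longrightarrow> fst (stereo_south_inv z) = 0" by (simp add: stereo_south_inv_def)
    ultimately show ?thesis by (cases "stereo_south_inv z") (auto simp: stereo_north_def)
  qed
  have image: "snd c ` (fst c \<inter> A) = {z. chart_inv c z \<in> A}"
    if "is_chart X c" "chart_range c = UNIV" for X and A and c :: "(complex \<times> real, complex) chart"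
  proof (intro equalityI subsetI)
    show "z \<in> {z. chart_inv c z \<in> A}" if "z \<in> snd c ` (fst c \<inter> A)" for z
      using that chart_inv_coord[OF \<open>is_chart X c\<close>] by auto
    show "z \<in> snd c ` (fst c \<inter> A)" if "z \<in> {z. chart_inv c z \<in> A}" for z
      using that coord_chart_inv[of z c] chart_inv_in[of z c] \<open>chart_range c = UNIV\<close> by force
  qed
  show "snd stereo_north ` (fst stereo_north \<inter> fst stereo_south) = - {0}"
    using image[OF is_chart_stereo_north chart_range_stereo_north] N by (auto simp: chart_inv_stereo_north)
  show "snd stereo_south ` (fst stereo_south \<inter> fst stereo_north) = - {0}"
    using image[OF is_chart_stereo_south chart_range_stereo_south] S by (auto simp: chart_inv_stereo_south)
qed

text \<open>The computation leads to \<open>cnj z\<close> divided by the square of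
  \<open>norm z\<close>, that is \<open>1 / z\<close>. Without the conjugation in the southern
  coordinate it would lead to \<open>1 / cnj z\<close>, which is antiholomorphic.\<close>

lemma transition_stereo:
  assumes "z \<noteq> 0"
  shows "transition stereo_north stereo_south z = 1 / z"
    and "transition stereo_south stereo_north z = 1 / z"
proof -
  define n where "n = (norm z)\<^sup>2"
  have "n > 0" using assms by (simp add: n_def)
  have z: "cnj z / of_real n = 1 / z"
    using assms complex_norm_square[of z] \<open>n > 0\<close> by (simp add: n_def field_simps)
  have e: "1 + (n - 1) / (n + 1) = 2 * n / (n + 1)" "1 - (1 - n) / (n + 1) = 2 * n / (n + 1)"
    using \<open>n > 0\<close> by (simp_all add: field_simps)
  have f: "complex_of_real (2 / (n + 1)) * w / complex_of_real (2 * n / (n + 1)) = w / of_real n" for w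
  proof -
    have "(2 / (n + 1)) / (2 * n / (n + 1)) = 1 / n"
    proof -
      have ne: "2 * n / (n + 1) \<noteq> 0" using \<open>n > 0\<close> by simp
      have "2 / (n + 1) = 1 / n * (2 * n / (n + 1))" using \<open>n > 0\<close> by simp
      then show ?thesis by (simp only: nonzero_divide_eq_eq[OF ne])
    qed
    then show ?thesis unfolding of_real_mult_divide by simp
  qed
  show "transition stereo_north stereo_south z = 1 / z"
    unfolding transition_def comp_def chart_inv_stereo_north stereo_north_inv_def stereo_south_def
      snd_conv case_prod_conv n_def[symmetric] e complex_cnj_mult complex_cnj_complex_of_real f z ..
  show "transition stereo_south stereo_north z = 1 / z"
    unfolding transition_def comp_def chart_inv_stereo_south stereo_south_inv_def stereo_north_def
      snd_conv case_prod_conv n_def[symmetric] e f z ..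
qed

lemma holomorphically_compatible_self:
  assumes "is_chart X c"
  shows "holomorphically_compatible c c"
proof -
  have "transition c c holomorphic_on (snd c ` (fst c \<inter> fst c))"
    by (rule holomorphic_transform[OF holomorphic_on_ident]) (use transition_coord[OF assms, of _ c] in auto)
  then show ?thesis by (simp add: holomorphically_compatible_def)
qed

lemma stereo_in_atlas: "stereo_north \<in> atlas sphere2" "stereo_south \<in> atlas sphere2"
proof -
  have "(\<lambda>z. 1 / z) holomorphic_on (- {0 :: complex})"
    by (intro holomorphic_intros) auto
  then have "transition stereo_north stereo_south holomorphic_on (- {0})"
    "transition stereo_south stereo_north holomorphic_on (- {0})"
    by (rule holomorphic_transform; simp add: transition_stereo)+
  then have "holomorphically_compatible stereo_north stereo_south" "holomorphically_compatible stereo_south stereo_north"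
    unfolding holomorphically_compatible_def
    by (simp_all only: coord_overlap_stereo coord_overlap_stereo[unfolded Int_commute[of "fst stereo_north"]]
        coord_overlap_stereo[unfolded Int_commute[of "fst stereo_south"]])
  then show "stereo_north \<in> atlas sphere2" "stereo_south \<in> atlas sphere2"
    by (simp_all add: sphere2_def is_chart_stereo_north is_chart_stereo_south
        holomorphically_compatible_self[OF is_chart_stereo_north] holomorphically_compatible_self[OF is_chart_stereo_south])
qed

lemma points_sphere2_covered:
  assumes "p \<in> points sphere2"
  shows "p \<in> fst stereo_north \<or> p \<in> fst stereo_south"
  using assms by (auto simp: mtop_sphere2 stereo_north_def stereo_south_def)

text \<open>Transitions in both directions are holomorphic, and the chain rule for their composite,
  the identity, gives \<open>E * D = 1\<close>.\<close>

lemma transition_from_stereo: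
  assumes c: "c \<in> {stereo_north, stereo_south}" and c': "c' \<in> atlas sphere2" and p: "p \<in> fst c \<inter> fst c'"
  obtains D where "(transition c c' has_field_derivative D) (at (snd c p))" "D \<noteq> 0"
proof -
  have ch: "is_chart (mtop sphere2) c" "is_chart (mtop sphere2) c'"
    using c c' stereo_in_atlas sphere2_atlas_chart by blast+
  have "holomorphically_compatible c c'"
    using c c' by (auto simp: sphere2_def)
  then have hol: "transition c c' holomorphic_on (snd c ` (fst c \<inter> fst c'))"
    "transition c' c holomorphic_on (snd c' ` (fst c' \<inter> fst c))"
    by (auto simp: holomorphically_compatible_def Int_commute)
  have op: "open (snd c ` (fst c \<inter> fst c'))" "open (snd c' ` (fst c' \<inter> fst c))"
    using ch open_chart_image unfolding is_chart_def by blast+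
  have x: "snd c p \<in> snd c ` (fst c \<inter> fst c')" "snd c' p \<in> snd c' ` (fst c' \<inter> fst c)"
    using p by auto
  obtain D E where D: "(transition c c' has_field_derivative D) (at (snd c p))"
    and E: "(transition c' c has_field_derivative E) (at (snd c' p))"
    using hol op x holomorphic_on_imp_differentiable_at unfolding field_differentiable_def by meson
  have t: "transition c c' (snd c p) = snd c' p"
    using p ch by (simp add: transition_coord)
  have "((transition c' c \<circ> transition c c') has_field_derivative E * D) (at (snd c p))"
    using D E t by (intro DERIV_chain) auto
  moreover have "((\<lambda>z. z) has_field_derivative 1) (at (snd c p))" by (rule DERIV_ident)
  then have "((transition c' c \<circ> transition c c') has_field_derivative 1) (at (snd c p))"
    by (rule has_field_derivative_transform_within_open[OF _ op(1) x(1)])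
      (use ch in \<open>auto simp: transition_coord\<close>)
  ultimately have "E * D = 1" by (rule DERIV_unique)
  then have "D \<noteq> 0" by auto
  then show thesis by (rule that[OF D])
qed

text \<open>The transformation law is asked only from the stereographic coordinates to others; this
  fits the atlas, which is defined by compatibility with these two. Vanishing passes to any other
  coordinate because the factor \<open>D\<^sup>2\<close> is nonzero.\<close>

lemma quadratic_differential_sphere2_eq_0:
  fixes q :: "(complex \<times> real, complex) chart \<Rightarrow> complex \<Rightarrow> complex"
  assumes holo: "\<And>c. c \<in> {stereo_north, stereo_south} \<Longrightarrow> q c holomorphic_on UNIV"
    and trans: "\<And>c c' p D. c \<in> {stereo_north, stereo_south} \<Longrightarrow> c' \<in> atlas sphere2 \<Longrightarrow> p \<in> fst c \<inter> fst c' \<Longrightarrow>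
      (transition c c' has_field_derivative D) (at (snd c p)) \<Longrightarrow> q c (snd c p) = D\<^sup>2 * q c' (snd c' p)"
    and c: "c \<in> atlas sphere2" and x: "x \<in> chart_range c"
  shows "q c x = 0"
proof -
  have NS: "q stereo_north z = q stereo_south (inverse z) * inverse (z ^ 4)" if "z \<noteq> 0" for z
  proof -
    obtain p where p: "p \<in> fst stereo_north \<inter> fst stereo_south" and zp: "z = snd stereo_north p"
      using \<open>z \<noteq> 0\<close> coord_overlap_stereo(1) by blast
    \<comment> \<open>The square of this derivative is the factor \<open>inverse (z ^ 4)\<close> in
      \<open>NS\<close>; it supplies the decay at infinity.\<close>
    have "((\<lambda>z. 1 / z) has_field_derivative - inverse (z\<^sup>2)) (at z)"
      using \<open>z \<noteq> 0\<close> by (auto intro!: derivative_eq_intros simp: divide_simps power2_eq_square)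
    then have "(transition stereo_north stereo_south has_field_derivative - inverse (z\<^sup>2)) (at z)"
      by (rule has_field_derivative_transform_within_open[of _ _ _ "- {0}"])
        (use \<open>z \<noteq> 0\<close> in \<open>auto simp: transition_stereo\<close>)
    then have "q stereo_north z = (- inverse (z\<^sup>2))\<^sup>2 * q stereo_south (snd stereo_south p)"
      using trans[OF _ stereo_in_atlas(2) p] unfolding zp by blast
    moreover have "snd stereo_south p = inverse z"
      using transition_coord[OF is_chart_stereo_north, of p stereo_south] transition_stereo(1)[OF \<open>z \<noteq> 0\<close>] p
      by (simp add: zp inverse_eq_divide)
    ultimately show ?thesis by (simp add: power_inverse flip: power_mult)
  qed
  have contS: "isCont (q stereo_south) 0"
    using holo[of stereo_south] by (meson continuous_on_eq_continuous_at holomorphic_on_imp_continuous_on insertI1 insertI2 open_UNIV UNIV_I)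
  have "((\<lambda>z. q stereo_south (inverse z) * inverse (z ^ 4)) \<longlongrightarrow> q stereo_south 0 * 0) at_infinity"
  proof (rule tendsto_mult)
    show "((\<lambda>z. q stereo_south (inverse z)) \<longlongrightarrow> q stereo_south 0) at_infinity"
      by (rule isCont_tendsto_compose[OF contS tendsto_inverse_0])
    have "((\<lambda>z::complex. inverse z ^ 4) \<longlongrightarrow> 0 ^ 4) at_infinity"
      by (intro tendsto_power tendsto_inverse_0)
    then show "((\<lambda>z::complex. inverse (z ^ 4)) \<longlongrightarrow> 0) at_infinity"
      by (simp add: power_inverse)
  qed
  moreover have "eventually (\<lambda>z. q stereo_south (inverse z) * inverse (z ^ 4) = q stereo_north z) at_infinity"
    unfolding eventually_at_infinity by (intro exI[of _ 1] allI impI NS[symmetric]) auto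
  ultimately have "(q stereo_north \<longlongrightarrow> 0) at_infinity"
    using Lim_transform_eventually by force
  then have N0: "q stereo_north z = 0" for z
    using holo by (intro Liouville_weak_0) auto
  have S0: "q stereo_south z = 0" if "z \<noteq> 0" for z
    using NS[of "inverse z"] N0 that by simp
  \<comment> \<open>The southern coordinate 0 is the north pole, which \<open>NS\<close> does not
    reach; continuity covers it.\<close>
  have "eventually (\<lambda>z. q stereo_south z = 0) (at 0)"
    using S0 by (simp add: eventually_at_filter)
  then have "(q stereo_south \<longlongrightarrow> 0) (at 0)"
    by (rule tendsto_eventually)
  then have "q stereo_south 0 = 0"
    using contS LIM_unique unfolding isCont_def by blast
  with S0 have S0: "q stereo_south z = 0" for z by (cases "z = 0") auto
  define p where "p = chart_inv c x"
  have p: "p \<in> fst c" "snd c p = x"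
    using x by (simp_all add: p_def chart_inv_in coord_chart_inv)
  then have "p \<in> points sphere2"
    using is_chart_subset[OF sphere2_atlas_chart[OF c]] by blast
  then obtain c0 where c0: "c0 \<in> {stereo_north, stereo_south}" "p \<in> fst c0"
    using points_sphere2_covered by blast
  obtain D where D: "(transition c0 c has_field_derivative D) (at (snd c0 p))" "D \<noteq> 0"
    using transition_from_stereo[OF c0(1) c, of p] c0 p by auto
  have "q c0 (snd c0 p) = D\<^sup>2 * q c x"
    using trans[OF c0(1) c _ D(1)] c0 p by auto
  moreover have "q c0 (snd c0 p) = 0" using c0 N0 S0 by auto
  ultimately show ?thesis using D by simp
qed

section \<open>The quadratic differential under changes of coordinates\<close>

lemma hopf_mult:
  assumes B: "bilinear B" and sym: "\<And>a b. B a b = B b a"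
  shows "hopf (\<lambda>a b. B (D * a) (D * b)) = D\<^sup>2 * hopf B"
proof -
  obtain s t where st: "D = Complex s t" by (cases D)
  \<comment> \<open>Multiplication by \<open>D\<close> takes the complexified vector
    \<open>d_dz\<close> to \<open>D\<close> times itself, so a quadratic expression in it scales by
    \<open>D\<^sup>2\<close>; in components this is the expansion below.\<close>
  then have D: "D * 1 = s *\<^sub>R 1 + t *\<^sub>R \<i>" "D * \<i> = s *\<^sub>R \<i> - t *\<^sub>R 1"
    by (simp_all add: complex_eq_iff)
  have D2: "D\<^sup>2 = Complex (s\<^sup>2 - t\<^sup>2) (2 * s * t)"
    by (simp add: st power2_eq_square complex_eq_iff)
  show ?thesis
    unfolding hopf_def D2 D bilinear_ladd[OF B] bilinear_radd[OF B] bilinear_lsub[OF B] bilinear_rsub[OF B]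
      bilinear_lmul[OF B] bilinear_rmul[OF B] sym[of \<i> 1]
    by (simp add: complex_eq_iff power2_eq_square algebra_simps)
qed

lemma bilinear_pullback_form:
  assumes "bilinear (g (F x))" "F differentiable (at x)"
  shows "bilinear (pullback_form g F x)"
  using assms(1) linear_frechet_derivative[OF assms(2)]
  unfolding bilinear_def pullback_form_def by (auto intro: linear_compose[unfolded comp_def])

lemma pullback_form_compose:
  assumes S: "open S" "x \<in> S" and FF': "\<And>y. y \<in> S \<Longrightarrow> F y = F' (t y)"
    and t: "(t has_derivative t') (at x)" and F': "F' differentiable (at (t x))"
  shows "pullback_form g F x a b = pullback_form g F' (t x) (t' a) (t' b)"
proof -
  have "dir_deriv F x c = dir_deriv F' (t x) (t' c)" for c
  proof -
    have "dir_deriv F x c = dir_deriv (\<lambda>y. F' (t y)) x c"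
      by (rule dir_deriv_cong_open[OF S FF'])
    also have "\<dots> = dir_deriv F' (t x) (t' c)"
      by (rule dir_deriv_eqI[OF has_derivative_compose[OF t has_derivative_dir_deriv[OF F']]])
    finally show ?thesis .
  qed
  then show ?thesis by (simp add: pullback_form_def FF'[OF S(2)])
qed

text \<open>The change of chart \<open>T\<close> is assumed isometric only at the point
  \<open>F x\<close>; pullback forms do not see an isometry of the target.\<close>

lemma pullback_form_change_target:
  assumes S: "open S" "x \<in> S" and F': "\<And>y. y \<in> S \<Longrightarrow> F' y = T (F y)"
    and F: "F differentiable (at x)" and T: "(T has_derivative T') (at (F x))"
    and g: "\<And>a b. g (F x) a b = g' (T (F x)) (T' a) (T' b)"
  shows "pullback_form g F x = pullback_form g' F' x"
proof -
  have "dir_deriv F' x c = T' (dir_deriv F x c)" for c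
  proof -
    have "dir_deriv F' x c = dir_deriv (\<lambda>y. T (F y)) x c"
      by (rule dir_deriv_cong_open[OF S F'])
    also have "\<dots> = T' (dir_deriv F x c)"
      by (rule dir_deriv_eqI[OF has_derivative_compose[OF has_derivative_dir_deriv[OF F] T]])
    finally show ?thesis .
  qed
  then show ?thesis by (simp add: pullback_form_def fun_eq_iff g F'[OF S(2)])
qed

text \<open>A gluing statement: \<open>u p d\<close> holds the coordinates of a lifted map at
  \<open>p\<close> in the target chart \<open>d\<close>, and \<open>P d\<close> is the set of points
  where \<open>d\<close> may be used. Independence of \<open>d\<close> makes the local coefficients
  one quadratic differential on the sphere.\<close>

lemma hopf_pullback_form_sphere2_eq_0:
  fixes u :: "complex \<times> real \<Rightarrow> 'd \<Rightarrow> 'k::euclidean_space" and G :: "'d \<Rightarrow> 'k local_metric"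
    and P :: "'d \<Rightarrow> (complex \<times> real) set"
  defines "U \<equiv> \<lambda>c d x. u (chart_inv c x) d" and "S \<equiv> \<lambda>c d. snd c ` (fst c \<inter> P d)"
  assumes openP: "\<And>d. d \<in> A \<Longrightarrow> openin (mtop sphere2) (P d)"
    and cover: "\<And>p. p \<in> points sphere2 \<Longrightarrow> \<exists>d\<in>A. p \<in> P d"
    and G: "\<And>d p a b. d \<in> A \<Longrightarrow> p \<in> P d \<Longrightarrow> bilinear (G d (u p d)) \<and> G d (u p d) a b = G d (u p d) b a"
    and diff: "\<And>c d x. c \<in> atlas sphere2 \<Longrightarrow> d \<in> A \<Longrightarrow> x \<in> S c d \<Longrightarrow> U c d differentiable (at x)"
    and target: "\<And>c d d' x. c \<in> atlas sphere2 \<Longrightarrow> d \<in> A \<Longrightarrow> d' \<in> A \<Longrightarrow> x \<in> S c d \<inter> S c d' \<Longrightarrow>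
      pullback_form (G d) (U c d) x = pullback_form (G d') (U c d') x"
    and holo: "\<And>c d x. c \<in> atlas sphere2 \<Longrightarrow> d \<in> A \<Longrightarrow> x \<in> S c d \<Longrightarrow>
      (\<lambda>y. hopf (pullback_form (G d) (U c d) y)) field_differentiable (at x)"
    and c: "c \<in> atlas sphere2" and d: "d \<in> A" and x: "x \<in> S c d"
  shows "hopf (pullback_form (G d) (U c d) x) = 0"
proof -
  \<comment> \<open>An arbitrary choice of target chart at each point. It may jump from point to
    point, which is harmless since \<open>q_eq\<close> shows the coefficient to be independent of
    it.\<close>
  define \<delta> where "\<delta> p = (SOME d. d \<in> A \<and> p \<in> P d)" for p
  have \<delta>: "\<delta> p \<in> A" "p \<in> P (\<delta> p)" if "p \<in> points sphere2" for p
    using someI_ex[of "\<lambda>d. d \<in> A \<and> p \<in> P d"] cover[OF that] unfolding \<delta>_def by blast+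
  define q where "q c x = hopf (pullback_form (G (\<delta> (chart_inv c x))) (U c (\<delta> (chart_inv c x))) x)" for c x
  have inS: "snd c p \<in> S c (\<delta> p)" "p \<in> points sphere2" "chart_inv c (snd c p) = p"
    if "c \<in> atlas sphere2" "p \<in> fst c" for c p
  proof -
    note ch = sphere2_atlas_chart[OF that(1)]
    show p: "p \<in> points sphere2" using is_chart_subset[OF ch] that(2) by blast
    show "snd c p \<in> S c (\<delta> p)" using \<delta>[OF p] that(2) by (auto simp: S_def)
    show "chart_inv c (snd c p) = p" by (rule chart_inv_coord[OF ch that(2)])
  qed
  have q_eq: "q c x = hopf (pullback_form (G d) (U c d) x)"
    if asm: "c \<in> atlas sphere2" "d \<in> A" "x \<in> S c d" for c d x
  proof -
    obtain p where p: "p \<in> fst c" "x = snd c p" using asm(3) by (auto simp: S_def)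
    note i = inS[OF asm(1) p(1), folded p(2)]
    have "pullback_form (G (\<delta> p)) (U c (\<delta> p)) x = pullback_form (G d) (U c d) x"
      using asm i \<delta>(1)[OF i(2)] by (intro target) auto
    then show ?thesis by (simp add: q_def i)
  qed
  have openS: "open (S c d)" if "c \<in> atlas sphere2" "d \<in> A" for c d
    unfolding S_def by (rule open_chart_image[OF sphere2_atlas_chart[OF that(1)] openP[OF that(2)]])
  have "q c x = 0"
  proof (rule quadratic_differential_sphere2_eq_0[where q = q, OF _ _ c])
    show "x \<in> chart_range c" using x by (auto simp: S_def chart_range_def)
    fix c0 :: "(complex \<times> real, complex) chart" assume c0: "c0 \<in> {stereo_north, stereo_south}"
    then have c0A: "c0 \<in> atlas sphere2" using stereo_in_atlas by auto
    have range: "chart_range c0 = UNIV"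
      using c0 chart_range_stereo_north chart_range_stereo_south by auto
    show "q c0 holomorphic_on UNIV"
      unfolding holomorphic_on_def
    proof
      fix z :: complex
      obtain p where p: "p \<in> fst c0" "z = snd c0 p"
        using range chart_range_iff[of z c0] by auto
      note i = inS[OF c0A p(1), folded p(2)]
      have "(\<lambda>y. hopf (pullback_form (G (\<delta> p)) (U c0 (\<delta> p)) y)) field_differentiable (at z)"
        by (rule holo[OF c0A \<delta>(1)[OF i(2)] i(1)])
      then obtain D where "((\<lambda>y. hopf (pullback_form (G (\<delta> p)) (U c0 (\<delta> p)) y)) has_field_derivative D) (at z)"
        unfolding field_differentiable_def by blast
      \<comment> \<open>Near \<open>z\<close> the varying choice is replaced by the single chart
        chosen at \<open>p\<close>, whose domain is open.\<close>
      then have "(q c0 has_field_derivative D) (at z)"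
        by (rule has_field_derivative_transform_within_open[OF _ openS[OF c0A \<delta>(1)[OF i(2)]] i(1)])
          (rule q_eq[OF c0A \<delta>(1)[OF i(2)], symmetric])
      then show "q c0 field_differentiable at z within UNIV"
        unfolding field_differentiable_def by blast
    qed
    fix c' :: "(complex \<times> real, complex) chart" and p D assume c': "c' \<in> atlas sphere2"
      and p: "p \<in> fst c0 \<inter> fst c'"
      and D: "(transition c0 c' has_field_derivative D) (at (snd c0 p))"
    have p0: "p \<in> fst c0" and p': "p \<in> fst c'" using p by auto
    note ch0 = sphere2_atlas_chart[OF c0A] and ch' = sphere2_atlas_chart[OF c']
    note i0 = inS[OF c0A p0] and i' = inS[OF c' p']
    have t: "transition c0 c' (snd c0 p) = snd c' p" by (rule transition_coord[OF ch0 p0])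
    let ?d = "\<delta> p"
    have dA: "?d \<in> A" and pP: "p \<in> P ?d" by (rule \<delta>[OF i0(2)])+
    let ?B = "pullback_form (G ?d) (U c' ?d) (snd c' p)"
    have "pullback_form (G ?d) (U c0 ?d) (snd c0 p) a b = ?B (D * a) (D * b)" for a b
      unfolding t[symmetric]
    proof (rule pullback_form_compose[of "snd c0 ` (fst c0 \<inter> fst c')"])
      show "open (snd c0 ` (fst c0 \<inter> fst c'))"
        using ch' by (intro open_chart_image[OF ch0]) (simp add: is_chart_def)
      show "snd c0 p \<in> snd c0 ` (fst c0 \<inter> fst c')" using p by blast
      show "U c0 ?d y = U c' ?d (transition c0 c' y)" if y: "y \<in> snd c0 ` (fst c0 \<inter> fst c')" for y
      proof -
        obtain p1 where "p1 \<in> fst c0" "p1 \<in> fst c'" "y = snd c0 p1" using y by blast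
        then show ?thesis
          using chart_inv_coord[OF ch0] chart_inv_coord[OF ch'] by (simp add: U_def transition_def)
      qed
      show "(transition c0 c' has_derivative (*) D) (at (snd c0 p))"
        using D unfolding has_field_derivative_def .
      show "U c' ?d differentiable at (transition c0 c' (snd c0 p))"
        unfolding t by (rule diff[OF c' dA i'(1)])
    qed
    moreover have "U c' ?d (snd c' p) = u p ?d" by (simp add: U_def i'(3))
    then have "bilinear ?B" "?B a b = ?B b a" for a b
      using G[OF dA pP] diff[OF c' dA i'(1)] by (auto intro!: bilinear_pullback_form simp: pullback_form_def)
    ultimately have "hopf (pullback_form (G ?d) (U c0 ?d) (snd c0 p)) = D\<^sup>2 * hopf ?B"
      using hopf_mult[of ?B D] by (metis (no_types, lifting) ext)
    then show "q c0 (snd c0 p) = D\<^sup>2 * q c' (snd c' p)"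
      using q_eq[OF c0A dA i0(1)] q_eq[OF c' dA i'(1)] by simp
  qed
  then show ?thesis using q_eq[OF c d x] by simp
qed

text \<open>The change of chart that \<open>T\<close> induces on the tangent bundle.\<close>

definition tangent_lift :: "('a::real_normed_vector \<Rightarrow> 'b::real_normed_vector) \<Rightarrow> 'a \<times> 'a \<Rightarrow> 'b \<times> 'b"
  where "tangent_lift T p = (T (fst p), dir_deriv T (fst p) (snd p))"

lemma tangent_lift_has_derivative:
  fixes T :: "'k::euclidean_space \<Rightarrow> 'l::real_normed_vector"
  assumes W: "open W" "y \<in> W" and T: "smooth_on W T"
  shows "(tangent_lift T has_derivative (\<lambda>h. (dir_deriv T y (fst h),
    dir_deriv (\<lambda>y. dir_deriv T y v) y (fst h) + dir_deriv T y (snd h)))) (at (y, v))"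
proof -
  note d = smooth_on_imp_differentiable[OF T] smooth_on_imp_differentiable[OF smooth_on_dir_deriv[OF T]]
  have "((\<lambda>p. T (fst p)) has_derivative (\<lambda>h. dir_deriv T (fst (y, v)) (fst h))) (at (y, v))"
    using W by (intro has_derivative_compose[where g = T and f = fst] has_derivative_dir_deriv d
        has_derivative_fst has_derivative_ident) simp
  moreover have "((\<lambda>p. dir_deriv T (fst p) (snd p)) has_derivative
    (\<lambda>h. dir_deriv (\<lambda>z. dir_deriv T z (snd (y, v))) (fst (y, v)) (fst h) + dir_deriv T (fst (y, v)) (snd h))) (at (y, v))"
  proof (rule has_derivative_linear_family[where L = "dir_deriv T" and F = fst and u = snd and W = W])
    show "linear (dir_deriv T y)" if "y \<in> W" for y
      by (rule linear_frechet_derivative[OF d(1)[OF that]])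
    show "(\<lambda>y. dir_deriv T y a) differentiable (at (fst (y, v)))" for a
      using d(2)[OF W(2)] by simp
  qed (use W in \<open>auto intro!: has_derivative_fst has_derivative_snd has_derivative_ident\<close>)
  ultimately show ?thesis
    unfolding tangent_lift_def[abs_def] by (auto intro: has_derivative_Pair)
qed

text \<open>The isometry relation between \<open>g\<close> and \<open>g'\<close>, valid on all of
  \<open>W\<close>, is differentiated along \<open>v\<close>. The second derivatives of
  \<open>T\<close> that appear are exactly those in the derivative \<open>T'\<close> of the tangent
  lift.\<close>

lemma complete_lift_change_target:
  fixes T :: "'k::euclidean_space \<Rightarrow> 'k"
  assumes W: "open W" "y \<in> W" and T: "smooth_on W T" and TW: "T y \<in> W'"
    and g': "form_field W' g'"
    and iso: "\<And>y a b. y \<in> W \<Longrightarrow> g y a b = g' (T y) (dir_deriv T y a) (dir_deriv T y b)"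
    and T': "T' = (\<lambda>h. (dir_deriv T y (fst h),
      dir_deriv (\<lambda>y. dir_deriv T y v) y (fst h) + dir_deriv T y (snd h)))"
  shows "complete_lift g (y, v) a b = complete_lift g' (tangent_lift T (y, v)) (T' a) (T' b)"
proof -
  note d = has_derivative_dir_deriv[OF smooth_on_imp_differentiable[OF _ W(2)]]
  \<comment> \<open>Differentiating the isometry relation takes the direction \<open>v\<close> last,
    whereas \<open>T'\<close> takes it first.\<close>
  have swap: "dir_deriv (\<lambda>y. dir_deriv T y c) y v = dir_deriv (\<lambda>y. dir_deriv T y v) y c" for c
    by (rule second_derivative_symmetric[OF W T])
  let ?T = "dir_deriv T y" and ?T2 = "\<lambda>c. dir_deriv (\<lambda>y. dir_deriv T y v) y c"
  have "dir_deriv (\<lambda>y. g y (fst a) (fst b)) y v =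
      dir_deriv (\<lambda>y. g' (T y) (dir_deriv T y (fst a)) (dir_deriv T y (fst b))) y v"
    by (rule dir_deriv_cong_open[OF W]) (rule iso)
  also have "\<dots> = dir_deriv (\<lambda>z. g' z (?T (fst a)) (?T (fst b))) (T y) (?T v) +
      g' (T y) (dir_deriv (\<lambda>y. dir_deriv T y (fst a)) y v) (?T (fst b)) +
      g' (T y) (?T (fst a)) (dir_deriv (\<lambda>y. dir_deriv T y (fst b)) y v)"
    by (rule dir_deriv_eqI) (intro form_field_has_derivative[where F = T, OF g' TW] d T smooth_on_dir_deriv)
  finally show ?thesis
    using iso[OF W(2)] unfolding complete_lift_def tangent_lift_def T'
    by (simp add: swap bilinear_ladd[OF form_field_imp(2)[OF g' TW]] bilinear_radd[OF form_field_imp(2)[OF g' TW]])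
qed

section \<open>Conformality in terms of the quadratic differential\<close>

lemma complex_half: "(1 / 2 :: complex) = (1 / 2) *\<^sub>R 1" "- \<i> / 2 = (- (1 / 2)) *\<^sub>R \<i>"
  by (simp_all add: complex_eq_iff)

text \<open>The 4 comes from the two factors 1/2 in \<open>d_dz\<close>, which \<open>hopf\<close>
  omits.\<close>

lemma eta_R_eq:
  assumes B: "bilinear (g (F x))" and sym: "\<And>a b. g (F x) a b = g (F x) b a" and F: "F differentiable (at x)"
  shows "eta_R g F x = hopf (pullback_form g F x) / 4"
  unfolding eta_R_def complex_bilinear_ext_def map_dz_def complex_linear_ext_def d_dz_def fst_conv snd_conv
    complex_half linear_cmul[OF linear_frechet_derivative[OF F]] bilinear_lmul[OF B] bilinear_rmul[OF B]
    hopf_def pullback_form_def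
  using sym[of "dir_deriv F x 1" "dir_deriv F x \<i>"] by (simp add: complex_eq_iff)

lemma pullback_form_complete_lift:
  assumes "F differentiable (at x)" "V differentiable (at x)"
  shows "pullback_form (complete_lift g) (\<lambda>x. (F x, V x)) x a b =
    dir_deriv (\<lambda>y. g y (dir_deriv F x a) (dir_deriv F x b)) (F x) (V x) +
    g (F x) (dir_deriv V x a) (dir_deriv F x b) + g (F x) (dir_deriv F x a) (dir_deriv V x b)"
  by (simp add: pullback_form_def complete_lift_def dir_deriv_Pair assms)

text \<open>Beyond the 4 contained in \<open>hopf\<close> there is a 2, because the lifted pullback
  form is the symmetrization of the product of the covariant derivative of \<open>V\<close> with the
  differential of \<open>F\<close>.\<close>

lemma conformality_eq:
  assumes g: "local_riemannian W g" and x: "F x \<in> W"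
    and F: "F differentiable (at x)" and V: "V differentiable (at x)"
  shows "complex_bilinear_ext (g (F x)) (nabla_dz g F V x) (map_dz F x) =
    hopf (pullback_form (complete_lift g) (\<lambda>x. (F x, V x)) x) / 8"
proof -
  note B = local_riemannian_imp(3)[OF g x] and sym = local_riemannian_imp(4)[OF g x]
  note ff = local_riemannian_imp_form_field[OF g]
  note C = bilinear_christoffel[OF g x]
  let ?N = "\<lambda>a. dir_deriv V x a + christoffel g (F x) (dir_deriv F x a) (V x)"
  have N: "pullback_nabla g F (\<lambda>_. s *\<^sub>R a) V x = s *\<^sub>R ?N a" for s a
    unfolding pullback_nabla_def linear_cmul[OF linear_frechet_derivative[OF F]]
      linear_cmul[OF linear_frechet_derivative[OF V]] bilinear_lmul[OF C] by (simp add: algebra_simps)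
  \<comment> \<open>Compatibility of the connection with the metric: the two Koszul formulas add up
    to the derivative of \<open>g\<close> along \<open>V x\<close>.\<close>
  have P: "pullback_form (complete_lift g) (\<lambda>x. (F x, V x)) x a b =
      g (F x) (?N a) (dir_deriv F x b) + g (F x) (?N b) (dir_deriv F x a)" for a b
  proof -
    let ?a = "dir_deriv F x a" and ?b = "dir_deriv F x b"
    show ?thesis
      using christoffel_koszul[OF g x, of ?a "V x" ?b] christoffel_koszul[OF g x, of ?b "V x" ?a]
        form_field_dir_deriv_commute[OF ff x, of ?a ?b "V x"]
        form_field_dir_deriv_commute[OF ff x, of ?a "V x" ?b]
        form_field_dir_deriv_commute[OF ff x, of ?b "V x" ?a]
        sym[of ?a "dir_deriv V x b"]
      unfolding pullback_form_complete_lift[OF F V] bilinear_ladd[OF B] by simp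
  qed
  show ?thesis
    unfolding complex_bilinear_ext_def nabla_dz_def map_dz_def complex_linear_ext_def d_dz_def fst_conv snd_conv
      complex_half N linear_cmul[OF linear_frechet_derivative[OF F]] bilinear_lmul[OF B] bilinear_rmul[OF B]
      hopf_def P
    by (simp add: complex_eq_iff)
qed

section \<open>Harmonic maps from the sphere\<close>

lemma smooth_on_subset:
  assumes "smooth_on S f" "T \<subseteq> S"
  shows "smooth_on T f"
proof -
  have "Ck_on k T f" if "Ck_on k S f" for k
    using that by (induction k arbitrary: f) (use assms(2) in \<open>auto intro: continuous_on_subset\<close>)
  then show ?thesis using assms(1) by (simp add: smooth_on_def)
qed

lemma local_riemannian_subset:
  "local_riemannian S g \<Longrightarrow> open T \<Longrightarrow> T \<subseteq> S \<Longrightarrow> local_riemannian T g"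
  unfolding local_riemannian_def by (blast intro: smooth_on_subset)

lemma riemannian_metric_chart:
  assumes "riemannian_metric M g" "c \<in> atlas M" "is_chart (mtop M) c"
  shows "local_riemannian (chart_range c) (g c)"
  using assms unfolding riemannian_metric_def local_riemannian_def is_chart_def by blast

lemma rep_domain_eq:
  assumes "is_chart X c"
  shows "rep_domain c d f = snd c ` (fst c \<inter> {p \<in> topspace X. f p \<in> fst d})"
  using is_chart_subset[OF assms] unfolding rep_domain_def by blast

lemma rep_domain_iff:
  assumes "is_chart X c"
  shows "x \<in> rep_domain c d f \<longleftrightarrow> x \<in> chart_range c \<and> f (chart_inv c x) \<in> fst d"
  unfolding rep_domain_def chart_range_iff using chart_inv_coord[OF assms] by force

lemma open_rep_domain:
  assumes "is_chart X c" "continuous_map X Y f" "openin Y (fst d)"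
  shows "open (rep_domain c d f)"
  unfolding rep_domain_eq[OF assms(1)]
  by (intro open_chart_image[OF assms(1)] openin_continuous_map_preimage[OF assms(2,3)])

text \<open>The charts in which the smoothness of a variation is expressed. As \<open>I\<close> is
  open, their ranges are open, so the calculus on open sets applies jointly in the coordinate and in
  \<open>t\<close>.\<close>

lemma times_interval_chart:
  fixes c :: "('p, 'e::euclidean_space) chart"
  assumes c: "is_chart X c" and I: "open (I :: real set)"
  defines "C \<equiv> (fst c \<times> I, \<lambda>(p, t). (snd c p, t))"
  shows "is_chart (prod_topology X (top_of_set I)) C" and "chart_range C = chart_range c \<times> I"
    and "y \<in> chart_range c \<Longrightarrow> t \<in> I \<Longrightarrow> chart_inv C (y, t) = (chart_inv c y, t)"
proof -
  show R: "chart_range C = chart_range c \<times> I"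
    by (force simp: C_def chart_range_def)
  obtain k where "homeomorphic_maps (subtopology X (fst c)) (top_of_set (chart_range c)) (snd c) k"
    using c homeomorphic_map_maps unfolding is_chart_def by blast
  moreover have "homeomorphic_maps (top_of_set I) (top_of_set I) (\<lambda>t. t) (\<lambda>t. t)"
    by (simp add: homeomorphic_maps_def)
  ultimately have "homeomorphic_maps (prod_topology (subtopology X (fst c)) (top_of_set I))
      (prod_topology (top_of_set (chart_range c)) (top_of_set I)) (\<lambda>(p, t). (snd c p, t)) (\<lambda>(y, t). (k y, t))"
    by (simp only: homeomorphic_maps_prod) blast
  then have "homeomorphic_maps (subtopology (prod_topology X (top_of_set I)) (fst c \<times> I))
      (top_of_set (chart_range c \<times> I)) (\<lambda>(p, t). (snd c p, t)) (\<lambda>(y, t). (k y, t))"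
    by (simp add: subtopology_Times subtopology_subtopology)
  moreover have "openin (prod_topology X (top_of_set I)) (fst c \<times> I)"
    using c by (simp add: is_chart_def openin_prod_Times_iff)
  ultimately show C: "is_chart (prod_topology X (top_of_set I)) C"
    using c I unfolding is_chart_def R
    by (simp add: C_def open_Times homeomorphic_maps_imp_map)
  show "chart_inv C (y, t) = (chart_inv c y, t)" if "y \<in> chart_range c" "t \<in> I"
    using chart_inv_coord[OF C, of "(chart_inv c y, t)"] chart_inv_in[OF that(1)] coord_chart_inv[OF that(1)] that(2)
    by (simp add: C_def)
qed

section \<open>The harmonic map and its Jacobi fields in charts\<close>

locale harmonic_sphere =
  fixes N :: "('n, 'f::euclidean_space) manifold"
    and g :: "('n, 'f) metric_tensor"
    and h :: "(complex \<times> real, complex) metric_tensor"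
    and \<phi> :: "complex \<times> real \<Rightarrow> 'n"
  assumes N: "smooth_manifold N" and g: "riemannian_metric N g"
    and h: "compatible_metric sphere2 h"
    and harmonic: "harmonic_map sphere2 h N g \<phi>"
begin

lemma chart_N: "d \<in> atlas N \<Longrightarrow> is_chart (mtop N) d"
  using N by (simp add: smooth_manifold_def)

lemma g_chart: "d \<in> atlas N \<Longrightarrow> local_riemannian (chart_range d) (g d)"
  using riemannian_metric_chart[OF g] chart_N by blast

lemma continuous_\<phi>: "continuous_map (mtop sphere2) (mtop N) \<phi>"
  using harmonic by (simp add: harmonic_map_def smooth_map_def)

lemma open_domain: "c \<in> atlas sphere2 \<Longrightarrow> d \<in> atlas N \<Longrightarrow> open (rep_domain c d \<phi>)"
  using open_rep_domain[OF sphere2_atlas_chart continuous_\<phi>] chart_N unfolding is_chart_def by blast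

lemma smooth_local_rep: "c \<in> atlas sphere2 \<Longrightarrow> d \<in> atlas N \<Longrightarrow> smooth_on (rep_domain c d \<phi>) (local_rep c d \<phi>)"
  using harmonic by (simp add: harmonic_map_def smooth_map_def)

lemma local_rep_in:
  assumes "c \<in> atlas sphere2" "x \<in> rep_domain c d \<phi>"
  shows "local_rep c d \<phi> x \<in> chart_range d"
  using assms(2) unfolding rep_domain_iff[OF sphere2_atlas_chart[OF assms(1)]] local_rep_def chart_range_def
  by simp

lemma conformal_source_chart:
  assumes c: "c \<in> atlas sphere2" and d: "d \<in> atlas N"
  shows "conformal_source (rep_domain c d \<phi>) (h c) (chart_range d) (g d) (local_rep c d \<phi>)"
proof
  have sub: "rep_domain c d \<phi> \<subseteq> chart_range c"
    using rep_domain_iff[OF sphere2_atlas_chart[OF c]] by blast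
  have "local_riemannian (chart_range c) (h c)"
    using h riemannian_metric_chart[OF _ c sphere2_atlas_chart[OF c]] by (simp add: compatible_metric_def)
  then show "local_riemannian (rep_domain c d \<phi>) (h c)"
    by (rule local_riemannian_subset[OF _ open_domain[OF c d] sub])
  show "\<exists>r>0. \<forall>a b. h c x a b = r * (a \<bullet> b)" if "x \<in> rep_domain c d \<phi>" for x
    using h c that sub unfolding compatible_metric_def by blast
qed (simp_all add: g_chart[OF d] smooth_local_rep[OF c d] local_rep_in[OF c])

lemma flat_tension_eq_0:
  assumes c: "c \<in> atlas sphere2" and d: "d \<in> atlas N" and x: "x \<in> rep_domain c d \<phi>"
  shows "flat_tension (g d) (local_rep c d \<phi>) x = 0"
  using conformal_source.tension_field_eq_0_iff[OF conformal_source_chart[OF c d] x] harmonic c d x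
  by (simp add: harmonic_map_def)

lemma transition_N:
  assumes "d \<in> atlas N" "d' \<in> atlas N"
  shows "open (snd d ` (fst d \<inter> fst d'))" "smooth_on (snd d ` (fst d \<inter> fst d')) (transition d d')"
    and "y \<in> snd d ` (fst d \<inter> fst d') \<Longrightarrow>
      g d y a b = g d' (transition d d' y) (dir_deriv (transition d d') y a) (dir_deriv (transition d d') y b)"
proof -
  show "open (snd d ` (fst d \<inter> fst d'))"
    using chart_N[OF assms(2)] by (intro open_chart_image[OF chart_N[OF assms(1)]]) (simp add: is_chart_def)
  show "smooth_on (snd d ` (fst d \<inter> fst d')) (transition d d')"
    using N assms by (simp add: smooth_manifold_def)
  assume "y \<in> snd d ` (fst d \<inter> fst d')"
  then obtain p where p: "p \<in> fst d \<inter> fst d'" "y = snd d p" by blast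
  then have "g d (snd d p) a b = g d' (snd d' p) (dir_deriv (transition d d') (snd d p) a)
      (dir_deriv (transition d d') (snd d p) b)"
    using g assms unfolding riemannian_metric_def by blast
  then show "g d y a b = g d' (transition d d' y) (dir_deriv (transition d d') y a) (dir_deriv (transition d d') y b)"
    using p transition_coord[OF chart_N[OF assms(1)], of p d'] by simp
qed

lemma local_rep_transition:
  assumes c: "c \<in> atlas sphere2" and d: "d \<in> atlas N" and x: "x \<in> rep_domain c d \<phi> \<inter> rep_domain c d' \<phi>"
  shows "local_rep c d \<phi> x \<in> snd d ` (fst d \<inter> fst d')"
    and "local_rep c d' \<phi> x = transition d d' (local_rep c d \<phi> x)"
proof -
  have p: "\<phi> (chart_inv c x) \<in> fst d" "\<phi> (chart_inv c x) \<in> fst d'"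
    using x rep_domain_iff[OF sphere2_atlas_chart[OF c]] by blast+
  then show "local_rep c d \<phi> x \<in> snd d ` (fst d \<inter> fst d')"
    by (simp add: local_rep_def)
  show "local_rep c d' \<phi> x = transition d d' (local_rep c d \<phi> x)"
    using transition_coord[OF chart_N[OF d] p(1)] by (simp add: local_rep_def)
qed

text \<open>The common core of the harmonic and the Jacobi case: a map lying over \<phi>, whose
  values in the chart \<open>d\<close> are points of \<open>W d\<close> carrying the form
  \<open>G d\<close>.\<close>

lemma hopf_lift_eq_0:
  fixes u :: "complex \<times> real \<Rightarrow> ('n, 'f) chart \<Rightarrow> 'k::euclidean_space"
    and G :: "('n, 'f) chart \<Rightarrow> 'k local_metric"
  assumes W: "\<And>d. d \<in> atlas N \<Longrightarrow> form_field (W d) (G d)"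
    and uW: "\<And>d p. d \<in> atlas N \<Longrightarrow> p \<in> points sphere2 \<Longrightarrow> \<phi> p \<in> fst d \<Longrightarrow> u p d \<in> W d"
    and diff: "\<And>c d x. c \<in> atlas sphere2 \<Longrightarrow> d \<in> atlas N \<Longrightarrow> x \<in> rep_domain c d \<phi> \<Longrightarrow>
      (\<lambda>x. u (chart_inv c x) d) differentiable (at x)"
    and diff2: "\<And>c d x a. c \<in> atlas sphere2 \<Longrightarrow> d \<in> atlas N \<Longrightarrow> x \<in> rep_domain c d \<phi> \<Longrightarrow>
      (\<lambda>y. dir_deriv (\<lambda>x. u (chart_inv c x) d) y a) differentiable (at x)"
    and mixed: "\<And>c d x a b. c \<in> atlas sphere2 \<Longrightarrow> d \<in> atlas N \<Longrightarrow> x \<in> rep_domain c d \<phi> \<Longrightarrow>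
      dir_deriv (\<lambda>y. dir_deriv (\<lambda>x. u (chart_inv c x) d) y a) x b =
      dir_deriv (\<lambda>y. dir_deriv (\<lambda>x. u (chart_inv c x) d) y b) x a"
    and L: "\<And>c d x w. c \<in> atlas sphere2 \<Longrightarrow> d \<in> atlas N \<Longrightarrow> x \<in> rep_domain c d \<phi> \<Longrightarrow>
      lowered_tension (G d) (\<lambda>x. u (chart_inv c x) d) x w = 0"
    and target: "\<And>c d d' x. c \<in> atlas sphere2 \<Longrightarrow> d \<in> atlas N \<Longrightarrow> d' \<in> atlas N \<Longrightarrow>
      x \<in> rep_domain c d \<phi> \<inter> rep_domain c d' \<phi> \<Longrightarrow>
      pullback_form (G d) (\<lambda>x. u (chart_inv c x) d) x = pullback_form (G d') (\<lambda>x. u (chart_inv c x) d') x"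
    and c: "c \<in> atlas sphere2" and d: "d \<in> atlas N" and x: "x \<in> rep_domain c d \<phi>"
  shows "hopf (pullback_form (G d) (\<lambda>x. u (chart_inv c x) d) x) = 0"
proof (rule hopf_pullback_form_sphere2_eq_0[where A = "atlas N" and P = "\<lambda>d. {p \<in> points sphere2. \<phi> p \<in> fst d}"])
  have dom: "snd c ` (fst c \<inter> {p \<in> points sphere2. \<phi> p \<in> fst d}) = rep_domain c d \<phi>"
    if "c \<in> atlas sphere2" for c d
    by (rule rep_domain_eq[OF sphere2_atlas_chart[OF that], symmetric])
  show "openin (mtop sphere2) {p \<in> points sphere2. \<phi> p \<in> fst d}" if "d \<in> atlas N" for d
    using chart_N[OF that] by (intro openin_continuous_map_preimage[OF continuous_\<phi>]) (simp add: is_chart_def)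
  show "\<exists>d\<in>atlas N. p \<in> {p \<in> points sphere2. \<phi> p \<in> fst d}" if "p \<in> points sphere2" for p
  proof -
    have "\<phi> p \<in> points N" using continuous_map_image_subset_topspace[OF continuous_\<phi>] that by blast
    then show ?thesis using N that unfolding smooth_manifold_def by auto
  qed
  show "bilinear (G d (u p d)) \<and> G d (u p d) a b = G d (u p d) b a"
    if "d \<in> atlas N" "p \<in> {p \<in> points sphere2. \<phi> p \<in> fst d}" for d p a b
    using form_field_imp(2,3)[OF W uW, of d p] that by blast
  show "c \<in> atlas sphere2" "d \<in> atlas N" by fact+
  show "x \<in> snd c ` (fst c \<inter> {p \<in> points sphere2. \<phi> p \<in> fst d})" using x unfolding dom[OF c] .
  fix c d x assume c: "c \<in> atlas sphere2" and d: "d \<in> atlas N"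
  show "(\<lambda>x. u (chart_inv c x) d) differentiable (at x)"
    if "x \<in> snd c ` (fst c \<inter> {p \<in> points sphere2. \<phi> p \<in> fst d})"
    by (rule diff[OF c d that[unfolded dom[OF c]]])
  show "pullback_form (G d) (\<lambda>x. u (chart_inv c x) d) x = pullback_form (G d') (\<lambda>x. u (chart_inv c x) d') x"
    if "d' \<in> atlas N" "x \<in> snd c ` (fst c \<inter> {p \<in> points sphere2. \<phi> p \<in> fst d}) \<inter>
      snd c ` (fst c \<inter> {p \<in> points sphere2. \<phi> p \<in> fst d'})" for d'
    using that(2) target[OF c d that(1)] unfolding dom[OF c] by blast
  assume "x \<in> snd c ` (fst c \<inter> {p \<in> points sphere2. \<phi> p \<in> fst d})"
  then have x: "x \<in> rep_domain c d \<phi>" unfolding dom[OF c] .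
  have xc: "x \<in> chart_range c" and \<phi>: "\<phi> (chart_inv c x) \<in> fst d"
    using x by (simp_all add: rep_domain_iff[OF sphere2_atlas_chart[OF c]])
  have "chart_inv c x \<in> points sphere2"
    by (rule subsetD[OF is_chart_subset[OF sphere2_atlas_chart[OF c]] chart_inv_in[OF xc]])
  then have "u (chart_inv c x) d \<in> W d" using \<phi> by (rule uW[OF d])
  then show "(\<lambda>y. hopf (pullback_form (G d) (\<lambda>x. u (chart_inv c x) d) y)) field_differentiable (at x)"
    by (rule hopf_pullback_form_field_differentiable[where F = "\<lambda>x. u (chart_inv c x) d", OF W[OF d] _
          diff[OF c d x] diff2[OF c d x] mixed[OF c d x] L[OF c d x]])
qed

lemma hopf_harmonic_eq_0:
  assumes c: "c \<in> atlas sphere2" and d: "d \<in> atlas N" and x: "x \<in> rep_domain c d \<phi>"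
  shows "hopf (pullback_form (g d) (local_rep c d \<phi>) x) = 0"
proof -
  have rep: "(\<lambda>x. snd d (\<phi> (chart_inv c x))) = local_rep c d \<phi>" for c :: "(complex \<times> real, complex) chart" and d :: "('n, 'f) chart"
    by (simp add: local_rep_def comp_def)
  show ?thesis
  proof (rule hopf_lift_eq_0[where W = chart_range and u = "\<lambda>p d. snd d (\<phi> p)", unfolded rep, OF _ _ _ _ _ _ _ c d x])
    show "form_field (chart_range d) (g d)" if "d \<in> atlas N" for d
      by (rule local_riemannian_imp_form_field[OF g_chart[OF that]])
    show "snd d (\<phi> p) \<in> chart_range d" if "\<phi> p \<in> fst d" for d p
      using that by (simp add: chart_range_def)
    fix c d x assume c: "c \<in> atlas sphere2" and d: "d \<in> atlas N"
    note sm = smooth_local_rep[OF c d]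
    show "pullback_form (g d) (local_rep c d \<phi>) x = pullback_form (g d') (local_rep c d' \<phi>) x"
      if d': "d' \<in> atlas N" and x: "x \<in> rep_domain c d \<phi> \<inter> rep_domain c d' \<phi>" for d'
    proof (rule pullback_form_change_target[OF open_Int[OF open_domain[OF c d] open_domain[OF c d']] x])
      show "local_rep c d' \<phi> y = transition d d' (local_rep c d \<phi> y)" if "y \<in> rep_domain c d \<phi> \<inter> rep_domain c d' \<phi>" for y
        by (rule local_rep_transition(2)[OF c d that])
      show "local_rep c d \<phi> differentiable (at x)"
        using smooth_on_imp_differentiable[OF sm] x by blast
      note T = transition_N[OF d d'] and y = local_rep_transition(1)[OF c d x]
      show "(transition d d' has_derivative dir_deriv (transition d d') (local_rep c d \<phi> x)) (at (local_rep c d \<phi> x))"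
        by (rule has_derivative_dir_deriv[OF smooth_on_imp_differentiable[OF T(2) y]])
      show "g d (local_rep c d \<phi> x) a b = g d' (transition d d' (local_rep c d \<phi> x))
          (dir_deriv (transition d d') (local_rep c d \<phi> x) a) (dir_deriv (transition d d') (local_rep c d \<phi> x) b)" for a b
        by (rule T(3)[OF y])
    qed
    assume x: "x \<in> rep_domain c d \<phi>"
    show "local_rep c d \<phi> differentiable (at x)"
      by (rule smooth_on_imp_differentiable[OF sm x])
    show "(\<lambda>y. dir_deriv (local_rep c d \<phi>) y a) differentiable (at x)" for a
      by (rule smooth_on_imp_differentiable[OF smooth_on_dir_deriv[OF sm] x])
    show "dir_deriv (\<lambda>y. dir_deriv (local_rep c d \<phi>) y a) x b = dir_deriv (\<lambda>y. dir_deriv (local_rep c d \<phi>) y b) x a" for a b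
      by (rule second_derivative_symmetric[OF open_domain[OF c d] x sm])
    show "lowered_tension (g d) (local_rep c d \<phi>) x w = 0" for w
      unfolding lowered_tension_eq[where F = "local_rep c d \<phi>", OF g_chart[OF d] local_rep_in[OF c x]] flat_tension_eq_0[OF c d x]
      by (simp add: bilinear_lzero[OF local_riemannian_imp(3)[OF g_chart[OF d] local_rep_in[OF c x]]])
  qed
qed

text \<open>The core result applied to the tangent bundle, whose charts are those of N with the
  fibre coordinate added and whose transitions are tangent lifts.\<close>

lemma hopf_jacobi_eq_0:
  assumes v: "jacobi_field sphere2 h N g \<phi> v"
    and c: "c \<in> atlas sphere2" and d: "d \<in> atlas N" and x: "x \<in> rep_domain c d \<phi>"
  shows "hopf (pullback_form (complete_lift (g d)) (\<lambda>x. (local_rep c d \<phi> x, section_rep c d v x)) x) = 0"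
proof -
  have rep: "(\<lambda>x. (snd d (\<phi> (chart_inv c x)), v (chart_inv c x) d)) = (\<lambda>x. (local_rep c d \<phi> x, section_rep c d v x))"
    for c :: "(complex \<times> real, complex) chart" and d :: "('n, 'f) chart"
    by (simp add: local_rep_def section_rep_def)
  have smv: "smooth_on (rep_domain c d \<phi>) (section_rep c d v)" if "c \<in> atlas sphere2" "d \<in> atlas N" for c d
    using v that by (simp add: jacobi_field_def vector_field_along_def)
  show ?thesis
  proof (rule hopf_lift_eq_0[where W = "\<lambda>d. chart_range d \<times> UNIV" and u = "\<lambda>p d. (snd d (\<phi> p), v p d)"
        and G = "\<lambda>d. complete_lift (g d)", unfolded rep, OF _ _ _ _ _ _ _ c d x])
    show "form_field (chart_range d \<times> UNIV) (complete_lift (g d))" if "d \<in> atlas N" for d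
      by (rule form_field_complete_lift[OF g_chart[OF that]])
    show "(snd d (\<phi> p), v p d) \<in> chart_range d \<times> UNIV" if "\<phi> p \<in> fst d" for d p
      using that by (simp add: chart_range_def)
    fix c d x assume c: "c \<in> atlas sphere2" and d: "d \<in> atlas N"
    note sm = smooth_local_rep[OF c d] smv[OF c d]
    let ?U = "\<lambda>d x. (local_rep c d \<phi> x, section_rep c d v x)"
    have diff: "?U d differentiable (at x)" if x: "x \<in> rep_domain c d \<phi>"
      using has_derivative_Pair[OF has_derivative_dir_deriv[OF smooth_on_imp_differentiable[OF sm(1) x]]
          has_derivative_dir_deriv[OF smooth_on_imp_differentiable[OF sm(2) x]]]
      unfolding differentiable_def by blast
    then show "?U d differentiable (at x)" if "x \<in> rep_domain c d \<phi>" using that .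
    show "pullback_form (complete_lift (g d)) (?U d) x = pullback_form (complete_lift (g d')) (?U d') x"
      if d': "d' \<in> atlas N" and x: "x \<in> rep_domain c d \<phi> \<inter> rep_domain c d' \<phi>" for d'
    proof (rule pullback_form_change_target[OF open_Int[OF open_domain[OF c d] open_domain[OF c d']] x])
      note T = transition_N[OF d d'] and y = local_rep_transition(1)[OF c d x]
      show "?U d differentiable (at x)" using diff x by blast
      \<comment> \<open>The transformation law of the tangent vector at each point is precisely the
        second component of the tangent lift.\<close>
      show "?U d' y = tangent_lift (transition d d') (?U d y)" if y: "y \<in> rep_domain c d \<phi> \<inter> rep_domain c d' \<phi>" for y
      proof -
        let ?p = "chart_inv c y"
        have y1: "y \<in> chart_range c" and p1: "\<phi> ?p \<in> fst d \<inter> fst d'"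
          using y by (simp_all add: rep_domain_iff[OF sphere2_atlas_chart[OF c]])
        have p2: "?p \<in> points sphere2"
          using chart_inv_in[OF y1] is_chart_subset[OF sphere2_atlas_chart[OF c]] by blast
        have "tangent_vector N (\<phi> ?p) (v ?p)"
          using v p2 by (simp add: jacobi_field_def vector_field_along_def)
        then have "v ?p d' = dir_deriv (transition d d') (snd d (\<phi> ?p)) (v ?p d)"
          using d d' p1 unfolding tangent_vector_def by blast
        then show ?thesis
          using local_rep_transition(2)[OF c d y] by (simp add: tangent_lift_def section_rep_def local_rep_def)
      qed
      let ?T' = "\<lambda>h. (dir_deriv (transition d d') (local_rep c d \<phi> x) (fst h),
        dir_deriv (\<lambda>y. dir_deriv (transition d d') y (section_rep c d v x)) (local_rep c d \<phi> x) (fst h) +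
        dir_deriv (transition d d') (local_rep c d \<phi> x) (snd h))"
      show "(tangent_lift (transition d d') has_derivative ?T') (at (?U d x))"
        by (rule tangent_lift_has_derivative[OF T(1) y T(2)])
      have TW: "transition d d' (local_rep c d \<phi> x) \<in> chart_range d'"
        using local_rep_in[OF c, of x d'] x local_rep_transition(2)[OF c d x] by simp
      show "complete_lift (g d) (?U d x) a b =
          complete_lift (g d') (tangent_lift (transition d d') (?U d x)) (?T' a) (?T' b)" for a b
        by (rule complete_lift_change_target[OF T(1) y T(2) TW local_riemannian_imp_form_field[OF g_chart[OF d']]])
          (simp_all add: T(3))
    qed
    assume x: "x \<in> rep_domain c d \<phi>"
    note D2 = dir_deriv_dir_deriv_Pair[OF open_domain[OF c d] x sm]
    show "(\<lambda>y. dir_deriv (?U d) y a) differentiable (at x)" for a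
      using D2 unfolding differentiable_def by blast
    show "dir_deriv (\<lambda>y. dir_deriv (?U d) y a) x b = dir_deriv (\<lambda>y. dir_deriv (?U d) y b) x a" for a b
      using second_derivative_symmetric[OF open_domain[OF c d] x sm(1), of a b]
        second_derivative_symmetric[OF open_domain[OF c d] x sm(2), of a b]
      by (simp add: dir_deriv_eqI[OF D2])
    \<comment> \<open>With the flat tension also zero, every term of the lifted tension
      vanishes.\<close>
    have "flat_jacobi (g d) (local_rep c d \<phi>) (section_rep c d v) x = 0"
      using v c d x by (intro conformal_source.jacobi_operator_eq_0_imp[OF conformal_source_chart[OF c d] x sm(2)]
          flat_tension_eq_0) (auto simp: jacobi_field_def)
    moreover note ff = local_riemannian_imp_form_field[OF g_chart[OF d]] and y = local_rep_in[OF c x]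
    ultimately show "lowered_tension (complete_lift (g d)) (?U d) x w = 0" for w
      unfolding lowered_tension_complete_lift[where F = "local_rep c d \<phi>", OF g_chart[OF d] y open_domain[OF c d] x sm] flat_tension_eq_0[OF c d x]
      by (simp add: bilinear_lzero[OF form_field_imp(2)[OF ff y]] bilinear_lzero[OF form_field_dir_deriv_bilinear[OF ff y]])
  qed
qed

lemma conformal_field_if_jacobi:
  assumes v: "jacobi_field sphere2 h N g \<phi> v"
  shows "conformal_field sphere2 N g \<phi> v"
  unfolding conformal_field_def
proof (intro ballI)
  fix c d x assume c: "c \<in> atlas sphere2" and d: "d \<in> atlas N" and x: "x \<in> rep_domain c d \<phi>"
  have V: "smooth_on (rep_domain c d \<phi>) (section_rep c d v)"
    using v c d by (simp add: jacobi_field_def vector_field_along_def)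
  show "complex_bilinear_ext (g d (local_rep c d \<phi> x))
      (nabla_dz (g d) (local_rep c d \<phi>) (section_rep c d v) x) (map_dz (local_rep c d \<phi>) x) = 0"
    unfolding conformality_eq[where F = "local_rep c d \<phi>", OF g_chart[OF d] local_rep_in[OF c x]
        smooth_on_imp_differentiable[OF smooth_local_rep[OF c d] x] smooth_on_imp_differentiable[OF V x]]
      hopf_jacobi_eq_0[OF v c d x] by simp
qed

text \<open>At \<open>t = 0\<close> the pullback forms of the maps \<open>\<Phi> t\<close> have as
  derivative the pullback of the complete lift by (\<phi>, v), whose \<open>hopf\<close> value is
  zero. The variation is handled through its joint coordinate representation \<open>H\<close> on an
  open set \<open>R\<close> of pairs \<open>(y, t)\<close>.\<close>

lemma conformal_to_first_order_if_jacobi: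
  assumes v: "jacobi_field sphere2 h N g \<phi> v"
    and \<Phi>: "smooth_variation sphere2 N \<phi> I \<Phi>" and \<Phi>v: "variation_tangent_to sphere2 N \<Phi> v"
  shows "conformal_to_first_order sphere2 N g \<phi> \<Phi>"
  unfolding conformal_to_first_order_def
proof (intro ballI)
  fix c d x assume c: "c \<in> atlas sphere2" and d: "d \<in> atlas N" and x: "x \<in> rep_domain c d \<phi>"
  define f where "f = (\<lambda>(p, t). \<Phi> t p)"
  define C :: "((complex \<times> real) \<times> real, complex \<times> real) chart"
    where "C = (fst c \<times> I, \<lambda>(p, t). (snd c p, t))"
  define R where "R = rep_domain C d f"
  define H where "H = local_rep C d f"
  let ?F = "local_rep c d \<phi>" and ?V = "section_rep c d v"
  have I: "open I" "0 \<in> I" and smooth: "smooth_map (times_interval sphere2 I) N f"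
    and \<Phi>0: "\<And>p. p \<in> points sphere2 \<Longrightarrow> \<Phi> 0 p = \<phi> p"
    using \<Phi> by (auto simp: smooth_variation_def f_def)
  note ch = sphere2_atlas_chart[OF c]
  note C_chart = times_interval_chart[OF ch I(1), folded C_def]
  have C_in: "C \<in> atlas (times_interval sphere2 I)"
    using c by (auto simp: times_interval_def C_def)
  have R_iff: "(y, t) \<in> R \<longleftrightarrow> y \<in> chart_range c \<and> t \<in> I \<and> \<Phi> t (chart_inv c y) \<in> fst d" for y t
    using C_chart(3)[of y t] unfolding R_def rep_domain_iff[OF C_chart(1)] C_chart(2) by (auto simp: f_def)
  have H_eq: "local_rep c d (\<Phi> t) y = H (y, t)" if "(y, t) \<in> R" for y t
    using that[unfolded R_iff] C_chart(3)[of y t] by (simp add: H_def local_rep_def f_def)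
  have openR: "open R"
    unfolding R_def
  proof (rule open_rep_domain[OF C_chart(1)])
    show "continuous_map (prod_topology (mtop sphere2) (top_of_set I)) (mtop N) f"
      using smooth by (simp add: smooth_map_def times_interval_def)
    show "openin (mtop N) (fst d)" using chart_N[OF d] by (simp add: is_chart_def)
  qed
  have smH: "smooth_on R H"
    using smooth C_in d by (simp add: smooth_map_def R_def H_def)
  have inp: "chart_inv c y \<in> points sphere2" if "y \<in> chart_range c" for y
    by (rule subsetD[OF is_chart_subset[OF ch] chart_inv_in[OF that]])
  have \<Phi>0': "\<Phi> 0 (chart_inv c y) = \<phi> (chart_inv c y)" if "y \<in> chart_range c" for y
    by (rule \<Phi>0[OF inp[OF that]])
  have R0: "(y, 0) \<in> R \<longleftrightarrow> y \<in> rep_domain c d \<phi>" for y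
    using R_iff[of y 0] rep_domain_iff[OF ch, of y d \<phi>] \<Phi>0'[of y] I
    by (cases "y \<in> chart_range c") simp_all
  have F_eq: "?F y = H (y, 0)" if "y \<in> rep_domain c d \<phi>" for y
    using H_eq[of y 0] that R0 \<Phi>0'[of y] rep_domain_iff[OF ch, of y d \<phi>] by (simp add: local_rep_def)
  have slice: "open {y. (y, t) \<in> R}" "open {t. (y, t) \<in> R}" for t y
  proof -
    have "open ((\<lambda>y. (y, t)) -` R)" "open ((\<lambda>t. (y, t)) -` R)"
      by (rule open_vimage[OF openR]; intro continuous_intros)+
    then show "open {y. (y, t) \<in> R}" "open {t. (y, t) \<in> R}" by (simp_all add: vimage_def)
  qed
  have rep_deriv: "(local_rep c d (\<Phi> t) has_derivative (\<lambda>a. dir_deriv H (y, t) (a, 0))) (at y)"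
    if "(y, t) \<in> R" for y t
  proof (rule has_derivative_transform_within_open[OF _ slice(1)])
    show "((\<lambda>y. H (y, t)) has_derivative (\<lambda>a. dir_deriv H (y, t) (a, 0))) (at y)"
      by (rule has_derivative_compose[where g = H, OF has_derivative_Pair[OF has_derivative_ident has_derivative_const]
            has_derivative_dir_deriv[OF smooth_on_imp_differentiable[OF smH that]]])
  qed (use that H_eq in auto)
  \<comment> \<open>Proved along the whole slice \<open>t = 0\<close>, not just at \<open>x\<close>,
    since it is differentiated in \<open>y\<close> below.\<close>
  have V_eq: "dir_deriv H (y, 0) (0, 1) = ?V y" if "y \<in> rep_domain c d \<phi>" for y
  proof -
    have yR: "(y, 0) \<in> R" using that R0 by simp
    have yc: "y \<in> chart_range c" using yR R_iff by blast
    have "((\<lambda>t. H (y, t)) has_derivative (\<lambda>s. dir_deriv H (y, 0) (0, s))) (at 0)"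
      by (rule has_derivative_compose[where g = H, OF has_derivative_Pair[OF has_derivative_const has_derivative_ident]
            has_derivative_dir_deriv[OF smooth_on_imp_differentiable[OF smH yR]]])
    moreover have "((\<lambda>t. H (y, t)) has_derivative (\<lambda>s. s *\<^sub>R ?V y)) (at 0)"
    proof (rule has_derivative_transform_within_open[OF _ slice(2)])
      show "((\<lambda>t. snd d (\<Phi> t (chart_inv c y))) has_derivative (\<lambda>s. s *\<^sub>R ?V y)) (at 0)"
        using \<Phi>v d inp[OF yc] yR[unfolded R_iff]
        by (simp add: variation_tangent_to_def section_rep_def has_vector_derivative_def)
      show "0 \<in> {t. (y, t) \<in> R}" using yR by simp
    qed (use H_eq in \<open>auto simp: local_rep_def\<close>)
    ultimately have "(\<lambda>s. dir_deriv H (y, 0) (0, s)) = (\<lambda>s. s *\<^sub>R ?V y)"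
      by (rule has_derivative_unique)
    from fun_cong[OF this, of 1] show ?thesis by simp
  qed
  note ff = local_riemannian_imp_form_field[OF g_chart[OF d]]
  have HW: "H (y, t) \<in> chart_range d" if "(y, t) \<in> R" for y t
  proof -
    have "snd d (\<Phi> t (chart_inv c y)) \<in> chart_range d"
      using that[unfolded R_iff] unfolding chart_range_def by blast
    then show ?thesis using H_eq[OF that] by (simp add: local_rep_def)
  qed
  have eta: "eta_R (g d) (local_rep c d (\<Phi> t)) x = hopf (pullback_form (g d) (local_rep c d (\<Phi> t)) x) / 4"
    if "(x, t) \<in> R" for t
  proof (rule eta_R_eq)
    have W: "local_rep c d (\<Phi> t) x \<in> chart_range d" using HW H_eq that by simp
    show "bilinear (g d (local_rep c d (\<Phi> t) x))" by (rule form_field_imp(2)[OF ff W])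
    show "g d (local_rep c d (\<Phi> t) x) a b = g d (local_rep c d (\<Phi> t) x) b a" for a b
      by (rule form_field_imp(3)[OF ff W])
    show "local_rep c d (\<Phi> t) differentiable (at x)" using rep_deriv[OF that] unfolding differentiable_def by blast
  qed
  have xR: "(x, 0) \<in> R" using x R0 by simp
  have smF: "smooth_on (rep_domain c d \<phi>) ?F" and smV: "smooth_on (rep_domain c d \<phi>) ?V"
    using smooth_local_rep[OF c d] v c d by (auto simp: jacobi_field_def vector_field_along_def)
  let ?P = "pullback_form (complete_lift (g d)) (\<lambda>x. (?F x, ?V x)) x"
  have dF: "dir_deriv ?F x a = dir_deriv H (x, 0) (a, 0)" for a
  proof -
    have "dir_deriv ?F x a = dir_deriv (local_rep c d (\<Phi> 0)) x a"
      by (rule dir_deriv_cong_open[OF open_domain[OF c d] x]) (simp add: F_eq H_eq R0)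
    then show ?thesis using dir_deriv_eqI[OF rep_deriv[OF xR]] by simp
  qed
  \<comment> \<open>Mixed derivatives of \<open>H\<close> commute, so the derivative in
    \<open>t\<close> of the spatial derivative of the variation is the spatial derivative of
    \<open>v\<close>.\<close>
  have dV: "dir_deriv (\<lambda>p. dir_deriv H p (a, 0)) (x, 0) (0, 1) = dir_deriv ?V x a" for a
  proof -
    have "dir_deriv ?V x a = dir_deriv (\<lambda>y. dir_deriv H (y, 0) (0, 1)) x a"
      by (rule dir_deriv_cong_open[OF open_domain[OF c d] x]) (simp add: V_eq)
    also have "\<dots> = dir_deriv (\<lambda>p. dir_deriv H p (0, 1)) (x, 0) (a, 0)"
      by (rule dir_deriv_eqI[OF has_derivative_compose[where g = "\<lambda>p. dir_deriv H p (0, 1)",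
              OF has_derivative_Pair[OF has_derivative_ident has_derivative_const]
              has_derivative_dir_deriv[OF smooth_on_imp_differentiable[OF smooth_on_dir_deriv[OF smH] xR]]]])
    also have "\<dots> = dir_deriv (\<lambda>p. dir_deriv H p (a, 0)) (x, 0) (0, 1)"
      by (rule second_derivative_symmetric[OF openR xR smH])
    finally show ?thesis by simp
  qed
  have P_deriv: "((\<lambda>t. pullback_form (g d) (local_rep c d (\<Phi> t)) x a b) has_vector_derivative ?P a b) (at 0)" for a b
  proof -
    have line: "((\<lambda>t. k (x, t)) has_derivative (\<lambda>s. dir_deriv k (x, 0) (0, s))) (at 0)" if "smooth_on R k" for k :: "_ \<Rightarrow> 'f"
      by (rule has_derivative_compose[where g = k, OF has_derivative_Pair[OF has_derivative_const has_derivative_ident]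
            has_derivative_dir_deriv[OF smooth_on_imp_differentiable[OF that xR]]])
    let ?D = "\<lambda>s. dir_deriv (\<lambda>y. g d y (dir_deriv H (x, 0) (a, 0)) (dir_deriv H (x, 0) (b, 0))) (H (x, 0)) (dir_deriv H (x, 0) (0, s)) +
        g d (H (x, 0)) (dir_deriv (\<lambda>p. dir_deriv H p (a, 0)) (x, 0) (0, s)) (dir_deriv H (x, 0) (b, 0)) +
        g d (H (x, 0)) (dir_deriv H (x, 0) (a, 0)) (dir_deriv (\<lambda>p. dir_deriv H p (b, 0)) (x, 0) (0, s))"
    have "((\<lambda>t. g d (H (x, t)) (dir_deriv H (x, t) (a, 0)) (dir_deriv H (x, t) (b, 0))) has_derivative ?D) (at 0)"
      by (rule form_field_has_derivative[where F = "\<lambda>t. H (x, t)", OF ff HW[OF xR] line[OF smH]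
            line[OF smooth_on_dir_deriv[OF smH]] line[OF smooth_on_dir_deriv[OF smH]]])
    then have D: "((\<lambda>t. pullback_form (g d) (local_rep c d (\<Phi> t)) x a b) has_derivative ?D) (at 0)"
    proof (rule has_derivative_transform_within_open[OF _ slice(2)])
      show "0 \<in> {t. (x, t) \<in> R}" using xR by simp
      show "g d (H (x, t)) (dir_deriv H (x, t) (a, 0)) (dir_deriv H (x, t) (b, 0)) =
          pullback_form (g d) (local_rep c d (\<Phi> t)) x a b" if "t \<in> {t. (x, t) \<in> R}" for t
        using that by (simp add: pullback_form_def H_eq dir_deriv_eqI[OF rep_deriv])
    qed
    have val: "?D 1 = ?P a b"
      unfolding pullback_form_complete_lift[OF smooth_on_imp_differentiable[OF smF x] smooth_on_imp_differentiable[OF smV x]]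
      by (simp add: dF dV F_eq[OF x] V_eq[OF x])
    \<comment> \<open>Linearity in the increment reduces the claim to the increment 1, settled by
      \<open>val\<close>.\<close>
    have "?D = (\<lambda>s. s *\<^sub>R ?P a b)"
    proof
      show "?D s = s *\<^sub>R ?P a b" for s
        using linear_cmul[OF has_derivative_linear[OF D], of s 1] unfolding val by simp
    qed
    with D show ?thesis unfolding has_vector_derivative_def by (simp only:)
  qed
  have "((\<lambda>t. hopf (pullback_form (g d) (local_rep c d (\<Phi> t)) x) / 4) has_vector_derivative hopf ?P / 4) (at 0)"
    unfolding hopf_def Complex_eq
    by (intro has_vector_derivative_divide has_vector_derivative_add has_vector_derivative_of_real
        has_vector_derivative_mult_right DERIV_diff DERIV_cmult
        P_deriv[folded has_real_derivative_iff_has_vector_derivative])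
  then have "((\<lambda>t. hopf (pullback_form (g d) (local_rep c d (\<Phi> t)) x) / 4) has_vector_derivative 0) (at 0)"
    unfolding hopf_jacobi_eq_0[OF v c d x] by simp
  then have "((\<lambda>t. eta_R (g d) (local_rep c d (\<Phi> t)) x) has_vector_derivative 0) (at 0)"
    by (rule has_vector_derivative_transform_within_open[OF _ slice(2)[of x]]) (use xR eta in auto)
  moreover have "eta_R (g d) ?F x = 0"
    using local_riemannian_imp(3,4)[OF g_chart[OF d] local_rep_in[OF c x]] hopf_harmonic_eq_0[OF c d x]
    by (subst eta_R_eq) (auto intro: smooth_on_imp_differentiable[OF smF x])
  ultimately show "eta_R (g d) ?F x = 0 \<and>
      ((\<lambda>t. eta_R (g d) (local_rep c d (\<Phi> t)) x) has_vector_derivative 0) (at 0)" by blast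
qed

end

theorem proposition3p2:
  fixes N :: "('n, 'f::euclidean_space) manifold"
    and g :: "('n, 'f) metric_tensor"
    and h :: "(complex \<times> real, complex) metric_tensor"
    and \<phi> :: "complex \<times> real \<Rightarrow> 'n"
    and v :: "complex \<times> real \<Rightarrow> ('n, 'f) chart \<Rightarrow> 'f"
  assumes "smooth_manifold N" and "compact_space (mtop N)" and "riemannian_metric N g"
    and "compatible_metric sphere2 h"
    and "harmonic_map sphere2 h N g \<phi>"
    and "jacobi_field sphere2 h N g \<phi> v"
  shows "conformal_field sphere2 N g \<phi> v \<and>
    (\<forall>I \<Phi>. smooth_variation sphere2 N \<phi> I \<Phi> \<and> variation_tangent_to sphere2 N \<Phi> v \<longrightarrow>
       conformal_to_first_order sphere2 N g \<phi> \<Phi>)"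
proof -
  interpret harmonic_sphere N g h \<phi>
    using assms by unfold_locales
  show ?thesis
    using conformal_field_if_jacobi[OF assms(6)] conformal_to_first_order_if_jacobi[OF assms(6)] by blast
qed

end
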